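(* Let $R$ be a commutative ring, $H$ a Hopf algebra over $R$, and let $A=B\#_\sigma H$ be an $H$-crossed product over $R$, with $B$ a faithfully flat Mittag--Leffler $R$-module and $H$ a flat (thus faithfully flat) $R$-module. Then a subalgebra $S\in\mathrm{Sub}_{Alg}(A/B)$ is a closed element of the Galois connection $(\phi,\psi)$ between $\mathrm{Sub}_{Alg}(A/B)$ and $\mathrm{Quot}_{gen}(H)$ if and only if the canonical map $$\mathrm{can}_S:S\otimes_BA\to A\,\square_{\psi(S)}H,\qquad \mathrm{can}_S(a\otimes_Bb)=ab_{(0)}\otimes b_{(1)}$$ is an isomorphism.
   Context: Algebras are associative and unital; unadorned $\otimes$ is over $R$. An $R$-module $M$ is Mittag--Leffler if $M\otimes\prod_\lambda M_\lambda\to\prod_\lambda(M\otimes M_\lambda)$ is injective for every family of $R$-modules $(M_\lambda)$. Crossed product: $B$ is an $R$-algebra with a weak action $H\otimes B\to B$, $h\otimes a\mapsto h\cdot a$ ($h\cdot(ab)=(h_{(1)}\cdot a)(h_{(2)}\cdot b)$, $h\cdot1=\epsilon(h)1$, $1\cdot a=a$) and $\sigma:H\otimes H\to B$ is an $R$-linear convolution invertible map. $B\#_\sigma H$ is $B\otimes H$ as an $R$-module (with $a\#_\sigma h$ denoting $a\otimes h$), with multiplication $(a\#_\sigma h)(b\#_\sigma k)=a(h_{(1)}\cdot b)\sigma(h_{(2)}\otimes k_{(1)})\#_\sigma h_{(3)}k_{(2)}$. All crossed products are assumed associative with unit $1_B\#_\sigma1_H$. Equivalently: $(h_{(1)}\cdot(k_{(1)}\cdot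 a))\sigma(h_{(2)},k_{(2)})=\sigma(h_{(1)},k_{(1)})((h_{(2)}k_{(2)})\cdot a)$, $\sigma(h,1)=\sigma(1,h)=\epsilon(h)1_B$, and $(h_{(1)}\cdot\sigma(k_{(1)},l_{(1)}))\sigma(h_{(2)},k_{(2)}l_{(2)})=\sigma(h_{(1)},k_{(1)})\sigma(h_{(2)}k_{(2)},l)$. It is a right $H$-comodule algebra via $\delta(a\#_\sigma h)=a\#_\sigma h_{(1)}\otimes h_{(2)}$, written $\delta(a)=a_{(0)}\otimes a_{(1)}$ for $a\in A$, and $B$ is identified with $B\#_\sigma1_H$, which equals $A^{co\,H}=\{a\in A:\delta(a)=a\otimes1_H\}$. $\mathrm{Sub}_{Alg}(A/B)$ is the poset (under inclusion) of subalgebras $S$ with $B\subseteq S\subseteq A$. $\mathrm{Quot}_{gen}(H)$ is the complete lattice of quotients $H/I$ by right ideal coideals $I$, ordered by $H/I\succcurlyeq H/J\Leftrightarrow I\subseteq J$. For $Q$ in it with projection $\pi$, $A^{co\,Q}=\{a\in A:a_{(0)}\otimes\pi(a_{(1)})=a\otimes\pi(1_H)\}$. Under the present assumptions the maps $\phi(Q)=A^{co\,Q}$ and $\psi(S)=\bigvee\{Q:S\subseteq A^{co\,Q}\}$ form a Galois connection (order-reversing, $S\subseteq\phi\psi(S)$, $Q\preccurlyeq\psi\phi(Q)$); $S$ is closed if $\phi\psi(S)=S$. For a generalised quotient $\pi:H\to Q$, $A$ is a right $Q$-comodule via $(\mathrm{id}\otimes\pi)\delta$, $H$ is a left $Q$-comodule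 via $(\pi\otimes\mathrm{id})\Delta$, and $A\,\square_QH$ is the equaliser of the two induced maps $A\otimes H\rightrightarrows A\otimes Q\otimes H$. *)

theory Defs
  imports "HOL-Algebra.Module" "HOL-Algebra.Subrings" "HOL-Algebra.Complete_Lattice"
    "HOL-Algebra.Free_Abelian_Groups"
begin

section \<open>Tensor products\<close>

text \<open>
  The tensor product of \<open>M\<close> and \<open>N\<close> balanced over a set \<open>T\<close> that acts on \<open>M\<close> by \<open>ract\<close> and on
  \<open>N\<close> by \<open>lact\<close>: the free abelian group on \<open>carrier M \<times> carrier N\<close> modulo the subgroup generated
  by the usual relations.  The multiplicative fields of the record are irrelevant.
\<close>

definition bal_rels ::
  "'t set \<Rightarrow> ('m \<Rightarrow> 't \<Rightarrow> 'm) \<Rightarrow> ('t \<Rightarrow> 'n \<Rightarrow> 'n) \<Rightarrow> ('m, 'x) ring_scheme \<Rightarrow> ('n, 'y) ring_scheme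
    \<Rightarrow> ('m \<times> 'n \<Rightarrow>\<^sub>0 int) set" where
  "bal_rels T ract lact M N =
     {frag_of (x \<oplus>\<^bsub>M\<^esub> x', y) - frag_of (x, y) - frag_of (x', y) | x x' y.
        x \<in> carrier M \<and> x' \<in> carrier M \<and> y \<in> carrier N} \<union>
     {frag_of (x, y \<oplus>\<^bsub>N\<^esub> y') - frag_of (x, y) - frag_of (x, y') | x y y'.
        x \<in> carrier M \<and> y \<in> carrier N \<and> y' \<in> carrier N} \<union>
     {frag_of (ract x t, y) - frag_of (x, lact t y) | x t y.
        x \<in> carrier M \<and> t \<in> T \<and> y \<in> carrier N}"

definition bal_null ::
  "'t set \<Rightarrow> ('m \<Rightarrow> 't \<Rightarrow> 'm) \<Rightarrow> ('t \<Rightarrow> 'n \<Rightarrow> 'n) \<Rightarrow> ('m, 'x) ring_scheme \<Rightarrow> ('n, 'y) ring_scheme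
    \<Rightarrow> ('m \<times> 'n \<Rightarrow>\<^sub>0 int) set" where
  "bal_null T ract lact M N =
     generate (free_Abelian_group (carrier M \<times> carrier N)) (bal_rels T ract lact M N)"

definition bal_tens ::
  "'t set \<Rightarrow> ('m \<Rightarrow> 't \<Rightarrow> 'm) \<Rightarrow> ('t \<Rightarrow> 'n \<Rightarrow> 'n) \<Rightarrow> ('m, 'x) ring_scheme \<Rightarrow> ('n, 'y) ring_scheme
    \<Rightarrow> 'm \<Rightarrow> 'n \<Rightarrow> ('m \<times> 'n \<Rightarrow>\<^sub>0 int) set" where
  "bal_tens T ract lact M N x y =
     bal_null T ract lact M N #>\<^bsub>free_Abelian_group (carrier M \<times> carrier N)\<^esub> frag_of (x, y)"

definition bal_group ::
  "'t set \<Rightarrow> ('m \<Rightarrow> 't \<Rightarrow> 'm) \<Rightarrow> ('t \<Rightarrow> 'n \<Rightarrow> 'n) \<Rightarrow> ('m, 'x) ring_scheme \<Rightarrow> ('n, 'y) ring_scheme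
    \<Rightarrow> ('m \<times> 'n \<Rightarrow>\<^sub>0 int) set ring" where
  "bal_group T ract lact M N =
     (let G = free_Abelian_group (carrier M \<times> carrier N) Mod bal_null T ract lact M N
      in \<lparr>carrier = carrier G, monoid.mult = undefined, monoid.one = undefined,
          ring.zero = \<one>\<^bsub>G\<^esub>, ring.add = monoid.mult G\<rparr>)"

text \<open>
  The additive map out of a tensor product that sends \<open>x \<otimes> y\<close> to \<open>f x y\<close>, computed on an arbitrary
  representative; it is independent of the choice whenever \<open>f\<close> is biadditive and balanced.
\<close>

definition tensor_lift ::
  "('g, 'z) ring_scheme \<Rightarrow> ('m \<Rightarrow> 'n \<Rightarrow> 'g) \<Rightarrow> ('m \<times> 'n \<Rightarrow>\<^sub>0 int) set \<Rightarrow> 'g" where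
  "tensor_lift G f X =
     (let c = (SOME c. c \<in> X)
      in \<Oplus>\<^bsub>G\<^esub>p \<in> Poly_Mapping.keys c. [Poly_Mapping.lookup c p] \<cdot>\<^bsub>G\<^esub> f (fst p) (snd p))"

definition bal_tensor ::
  "'t set \<Rightarrow> ('m \<Rightarrow> 't \<Rightarrow> 'm) \<Rightarrow> ('t \<Rightarrow> 'n \<Rightarrow> 'n) \<Rightarrow> ('r, 'm, 'x) module_scheme
    \<Rightarrow> ('n, 'y) ring_scheme \<Rightarrow> ('r, ('m \<times> 'n \<Rightarrow>\<^sub>0 int) set) module" where
  "bal_tensor T ract lact M N =
     (let G = bal_group T ract lact M N
      in \<lparr>carrier = carrier G, monoid.mult = undefined, monoid.one = undefined,
          ring.zero = \<zero>\<^bsub>G\<^esub>, ring.add = ring.add G,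
          smult = (\<lambda>r. tensor_lift G (\<lambda>x y. bal_tens T ract lact M N (r \<odot>\<^bsub>M\<^esub> x) y))\<rparr>)"

definition tensor ::
  "('r, 'k) ring_scheme \<Rightarrow> ('r, 'm, 'x) module_scheme \<Rightarrow> ('r, 'n, 'y) module_scheme
    \<Rightarrow> ('r, ('m \<times> 'n \<Rightarrow>\<^sub>0 int) set) module" where
  "tensor R M N = bal_tensor (carrier R) (\<lambda>x r. r \<odot>\<^bsub>M\<^esub> x) (\<lambda>r y. r \<odot>\<^bsub>N\<^esub> y) M N"

definition tens ::
  "('r, 'k) ring_scheme \<Rightarrow> ('r, 'm, 'x) module_scheme \<Rightarrow> ('r, 'n, 'y) module_scheme
    \<Rightarrow> 'm \<Rightarrow> 'n \<Rightarrow> ('m \<times> 'n \<Rightarrow>\<^sub>0 int) set" where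
  "tens R M N x y = bal_tens (carrier R) (\<lambda>x r. r \<odot>\<^bsub>M\<^esub> x) (\<lambda>r y. r \<odot>\<^bsub>N\<^esub> y) M N x y"


section \<open>Modules\<close>

definition linear_maps ::
  "('r, 'k) ring_scheme \<Rightarrow> ('r, 'm, 'x) module_scheme \<Rightarrow> ('r, 'n, 'y) module_scheme
    \<Rightarrow> ('m \<Rightarrow> 'n) set" where
  "linear_maps R M N =
     {f \<in> carrier M \<rightarrow> carrier N.
        (\<forall>x\<in>carrier M. \<forall>y\<in>carrier M. f (x \<oplus>\<^bsub>M\<^esub> y) = f x \<oplus>\<^bsub>N\<^esub> f y) \<and>
        (\<forall>r\<in>carrier R. \<forall>x\<in>carrier M. f (r \<odot>\<^bsub>M\<^esub> x) = r \<odot>\<^bsub>N\<^esub> f x)}"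

definition bilinear_maps ::
  "('r, 'k) ring_scheme \<Rightarrow> ('r, 'm, 'x) module_scheme \<Rightarrow> ('r, 'n, 'y) module_scheme
    \<Rightarrow> ('r, 'p, 'z) module_scheme \<Rightarrow> ('m \<Rightarrow> 'n \<Rightarrow> 'p) set" where
  "bilinear_maps R M N P =
     {f. (\<forall>x\<in>carrier M. f x \<in> linear_maps R N P) \<and>
         (\<forall>y\<in>carrier N. (\<lambda>x. f x y) \<in> linear_maps R M P)}"

definition module_iso ::
  "('r, 'k) ring_scheme \<Rightarrow> ('r, 'm, 'x) module_scheme \<Rightarrow> ('r, 'n, 'y) module_scheme
    \<Rightarrow> ('m \<Rightarrow> 'n) \<Rightarrow> bool" where
  "module_iso R M N f \<longleftrightarrow> f \<in> linear_maps R M N \<and> bij_betw f (carrier M) (carrier N)"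

definition tensor_map ::
  "('r, 'k) ring_scheme \<Rightarrow> ('r, 'm, 'x) module_scheme \<Rightarrow> ('r, 'n, 'y) module_scheme
    \<Rightarrow> ('r, 'p, 'z) module_scheme \<Rightarrow> ('n \<Rightarrow> 'p)
    \<Rightarrow> ('m \<times> 'n \<Rightarrow>\<^sub>0 int) set \<Rightarrow> ('m \<times> 'p \<Rightarrow>\<^sub>0 int) set" where
  "tensor_map R M N P f = tensor_lift (tensor R M P) (\<lambda>x y. tens R M P x (f y))"

definition quot_module :: "('r, 'm, 'x) module_scheme \<Rightarrow> 'm set \<Rightarrow> ('r, 'm set) module" where
  "quot_module M I =
     \<lparr>carrier = a_rcosets\<^bsub>M\<^esub> I, monoid.mult = undefined, monoid.one = undefined,
      ring.zero = I, ring.add = set_add M,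
      smult = (\<lambda>r X. \<Union>x\<in>X. I +>\<^bsub>M\<^esub> (r \<odot>\<^bsub>M\<^esub> x))\<rparr>"

definition product_module ::
  "'i set \<Rightarrow> ('i \<Rightarrow> ('r, 'm, 'x) module_scheme) \<Rightarrow> ('r, 'i \<Rightarrow> 'm) module" where
  "product_module L N =
     \<lparr>carrier = (\<Pi>\<^sub>E i\<in>L. carrier (N i)), monoid.mult = undefined, monoid.one = undefined,
      ring.zero = (\<lambda>i\<in>L. \<zero>\<^bsub>N i\<^esub>), ring.add = (\<lambda>x y. \<lambda>i\<in>L. x i \<oplus>\<^bsub>N i\<^esub> y i),
      smult = (\<lambda>r x. \<lambda>i\<in>L. r \<odot>\<^bsub>N i\<^esub> x i)\<rparr>"

text \<open>
  Flatness and the Mittag--Leffler property quantify over all \<open>R\<close>-modules, which a formula cannot do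
  across types.  The test modules, and the index sets of families of them, live in the type below.
  It contains a copy of every subquotient of \<open>R\<^sup>n\<close>, in particular of every ideal, every cyclic and
  every finitely generated module, and at least as many elements as there are pairs of a finitely
  presented module with a finite tuple of its elements.  A failure of one of the three properties
  over arbitrary modules already occurs over modules of this kind, so nothing is lost.
\<close>

type_synonym 'r test = "(nat \<Rightarrow> 'r) set"

definition exact_at ::
  "('r, 'm, 'x) module_scheme \<Rightarrow> ('m \<Rightarrow> 'n) \<Rightarrow> ('r, 'n, 'y) module_scheme \<Rightarrow> ('n \<Rightarrow> 'p)
    \<Rightarrow> ('r, 'p, 'z) module_scheme \<Rightarrow> bool" where
  "exact_at M f N g P \<longleftrightarrow> f ` carrier M = a_kernel N P g"

definition flat :: "('r, 'k) ring_scheme \<Rightarrow> ('r, 'm, 'x) module_scheme \<Rightarrow> bool" where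
  "flat R M \<longleftrightarrow> module R M \<and>
     (\<forall>(N\<^sub>1 :: ('r, 'r test) module) (N\<^sub>2 :: ('r, 'r test) module) (N\<^sub>3 :: ('r, 'r test) module) f g.
        module R N\<^sub>1 \<and> module R N\<^sub>2 \<and> module R N\<^sub>3 \<and>
        f \<in> linear_maps R N\<^sub>1 N\<^sub>2 \<and> g \<in> linear_maps R N\<^sub>2 N\<^sub>3 \<and> exact_at N\<^sub>1 f N\<^sub>2 g N\<^sub>3 \<longrightarrow>
        exact_at (tensor R M N\<^sub>1) (tensor_map R M N\<^sub>1 N\<^sub>2 f) (tensor R M N\<^sub>2)
          (tensor_map R M N\<^sub>2 N\<^sub>3 g) (tensor R M N\<^sub>3))"

definition faithfully_flat :: "('r, 'k) ring_scheme \<Rightarrow> ('r, 'm, 'x) module_scheme \<Rightarrow> bool" where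
  "faithfully_flat R M \<longleftrightarrow> module R M \<and>
     (\<forall>(N\<^sub>1 :: ('r, 'r test) module) (N\<^sub>2 :: ('r, 'r test) module) (N\<^sub>3 :: ('r, 'r test) module) f g.
        module R N\<^sub>1 \<and> module R N\<^sub>2 \<and> module R N\<^sub>3 \<and>
        f \<in> linear_maps R N\<^sub>1 N\<^sub>2 \<and> g \<in> linear_maps R N\<^sub>2 N\<^sub>3 \<longrightarrow>
        (exact_at N\<^sub>1 f N\<^sub>2 g N\<^sub>3 \<longleftrightarrow>
         exact_at (tensor R M N\<^sub>1) (tensor_map R M N\<^sub>1 N\<^sub>2 f) (tensor R M N\<^sub>2)
           (tensor_map R M N\<^sub>2 N\<^sub>3 g) (tensor R M N\<^sub>3)))"

definition Mittag_Leffler :: "('r, 'k) ring_scheme \<Rightarrow> ('r, 'm, 'x) module_scheme \<Rightarrow> bool" where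
  "Mittag_Leffler R M \<longleftrightarrow> module R M \<and>
     (\<forall>(L :: 'r test set) (N :: 'r test \<Rightarrow> ('r, 'r test) module).
        (\<forall>i\<in>L. module R (N i)) \<longrightarrow>
        inj_on
          (tensor_lift (product_module L (\<lambda>i. tensor R M (N i)))
             (\<lambda>x y. \<lambda>i\<in>L. tens R M (N i) x (y i)))
          (carrier (tensor R M (product_module L N))))"


section \<open>Hopf algebras\<close>

locale assoc_algebra = module R A + ring A for R (structure) and A (structure) +
  assumes smult_mult_left:
      "\<lbrakk>r \<in> carrier R; x \<in> carrier A; y \<in> carrier A\<rbrakk> \<Longrightarrow>
       (r \<odot>\<^bsub>A\<^esub> x) \<otimes>\<^bsub>A\<^esub> y = r \<odot>\<^bsub>A\<^esub> (x \<otimes>\<^bsub>A\<^esub> y)"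
    and smult_mult_right:
      "\<lbrakk>r \<in> carrier R; x \<in> carrier A; y \<in> carrier A\<rbrakk> \<Longrightarrow>
       x \<otimes>\<^bsub>A\<^esub> (r \<odot>\<^bsub>A\<^esub> y) = r \<odot>\<^bsub>A\<^esub> (x \<otimes>\<^bsub>A\<^esub> y)"

record ('r, 'h) hopf = "('r, 'h) module" +
  comult :: "'h \<Rightarrow> ('h \<times> 'h \<Rightarrow>\<^sub>0 int) set"
  counit :: "'h \<Rightarrow> 'r"
  antipode :: "'h \<Rightarrow> 'h"

text \<open>Sweedler notation: \<open>sw H G h f\<close> is the sum of \<open>f h\<^sub>(\<^sub>1\<^sub>) h\<^sub>(\<^sub>2\<^sub>)\<close> in \<open>G\<close>, for bilinear \<open>f\<close>.\<close>

definition sw ::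
  "('r, 'h, 'x) hopf_scheme \<Rightarrow> ('g, 'z) ring_scheme \<Rightarrow> 'h \<Rightarrow> ('h \<Rightarrow> 'h \<Rightarrow> 'g) \<Rightarrow> 'g" where
  "sw H G h f = tensor_lift G f (comult H h)"

locale hopf_algebra = assoc_algebra R H
  for R (structure) and H :: "('r, 'h, 'x) hopf_scheme" (structure) +
  assumes comult_linear: "comult H \<in> linear_maps R H (tensor R H H)"
    and comult_mult:
      "\<lbrakk>h \<in> carrier H; k \<in> carrier H\<rbrakk> \<Longrightarrow>
       comult H (h \<otimes>\<^bsub>H\<^esub> k) =
         sw H (tensor R H H) h (\<lambda>h1 h2. sw H (tensor R H H) k (\<lambda>k1 k2.
           tens R H H (h1 \<otimes>\<^bsub>H\<^esub> k1) (h2 \<otimes>\<^bsub>H\<^esub> k2)))"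
    and comult_one: "comult H \<one>\<^bsub>H\<^esub> = tens R H H \<one>\<^bsub>H\<^esub> \<one>\<^bsub>H\<^esub>"
    and counit_hom: "counit H \<in> ring_hom H R"
    and counit_smult:
      "\<lbrakk>r \<in> carrier R; h \<in> carrier H\<rbrakk> \<Longrightarrow> counit H (r \<odot>\<^bsub>H\<^esub> h) = r \<otimes>\<^bsub>R\<^esub> counit H h"
    and coassoc:
      "h \<in> carrier H \<Longrightarrow>
       sw H (tensor R (tensor R H H) H) h (\<lambda>h1 h2. sw H (tensor R (tensor R H H) H) h1 (\<lambda>h11 h12.
         tens R (tensor R H H) H (tens R H H h11 h12) h2)) =
       sw H (tensor R (tensor R H H) H) h (\<lambda>h1 h2. sw H (tensor R (tensor R H H) H) h2 (\<lambda>h21 h22.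
         tens R (tensor R H H) H (tens R H H h1 h21) h22))"
    and counit_left: "h \<in> carrier H \<Longrightarrow> sw H H h (\<lambda>h1 h2. counit H h1 \<odot>\<^bsub>H\<^esub> h2) = h"
    and counit_right: "h \<in> carrier H \<Longrightarrow> sw H H h (\<lambda>h1 h2. counit H h2 \<odot>\<^bsub>H\<^esub> h1) = h"
    and antipode_linear: "antipode H \<in> linear_maps R H H"
    and antipode_left:
      "h \<in> carrier H \<Longrightarrow>
       sw H H h (\<lambda>h1 h2. antipode H h1 \<otimes>\<^bsub>H\<^esub> h2) = counit H h \<odot>\<^bsub>H\<^esub> \<one>\<^bsub>H\<^esub>"
    and antipode_right:
      "h \<in> carrier H \<Longrightarrow>
       sw H H h (\<lambda>h1 h2. h1 \<otimes>\<^bsub>H\<^esub> antipode H h2) = counit H h \<odot>\<^bsub>H\<^esub> \<one>\<^bsub>H\<^esub>"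


section \<open>Crossed products\<close>

text \<open>
  The weak action and the cocycle are given as curried bilinear maps \<open>act h b\<close> and \<open>\<sigma> h k\<close>.
\<close>

locale weak_action = hopf_algebra R H + B: assoc_algebra R B
  for R (structure) and H :: "('r, 'h, 'x) hopf_scheme" (structure)
    and B :: "('r, 'b, 'y) module_scheme" (structure) +
  fixes act :: "'h \<Rightarrow> 'b \<Rightarrow> 'b"
  assumes act_bilinear: "act \<in> bilinear_maps R H B B"
    and act_mult:
      "\<lbrakk>h \<in> carrier H; a \<in> carrier B; b \<in> carrier B\<rbrakk> \<Longrightarrow>
       act h (a \<otimes>\<^bsub>B\<^esub> b) = sw H B h (\<lambda>h1 h2. act h1 a \<otimes>\<^bsub>B\<^esub> act h2 b)"
    and act_one: "h \<in> carrier H \<Longrightarrow> act h \<one>\<^bsub>B\<^esub> = counit H h \<odot>\<^bsub>B\<^esub> \<one>\<^bsub>B\<^esub>"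
    and one_act: "a \<in> carrier B \<Longrightarrow> act \<one>\<^bsub>H\<^esub> a = a"

text \<open>Convolution is taken with respect to the tensor product coalgebra structure on \<open>H \<otimes> H\<close>.\<close>

definition conv_invertible ::
  "('r, 'k) ring_scheme \<Rightarrow> ('r, 'h, 'x) hopf_scheme \<Rightarrow> ('r, 'b, 'y) module_scheme
    \<Rightarrow> ('h \<Rightarrow> 'h \<Rightarrow> 'b) \<Rightarrow> bool" where
  "conv_invertible R H B \<sigma> \<longleftrightarrow>
     (\<exists>\<tau> \<in> bilinear_maps R H H B. \<forall>h\<in>carrier H. \<forall>k\<in>carrier H.
        sw H B h (\<lambda>h1 h2. sw H B k (\<lambda>k1 k2. \<sigma> h1 k1 \<otimes>\<^bsub>B\<^esub> \<tau> h2 k2)) =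
          (counit H h \<otimes>\<^bsub>R\<^esub> counit H k) \<odot>\<^bsub>B\<^esub> \<one>\<^bsub>B\<^esub> \<and>
        sw H B h (\<lambda>h1 h2. sw H B k (\<lambda>k1 k2. \<tau> h1 k1 \<otimes>\<^bsub>B\<^esub> \<sigma> h2 k2)) =
          (counit H h \<otimes>\<^bsub>R\<^esub> counit H k) \<odot>\<^bsub>B\<^esub> \<one>\<^bsub>B\<^esub>)"

definition crossed_mult ::
  "('r, 'k) ring_scheme \<Rightarrow> ('r, 'h, 'x) hopf_scheme \<Rightarrow> ('r, 'b, 'y) module_scheme
    \<Rightarrow> ('h \<Rightarrow> 'b \<Rightarrow> 'b) \<Rightarrow> ('h \<Rightarrow> 'h \<Rightarrow> 'b)
    \<Rightarrow> ('b \<times> 'h \<Rightarrow>\<^sub>0 int) set \<Rightarrow> ('b \<times> 'h \<Rightarrow>\<^sub>0 int) set \<Rightarrow> ('b \<times> 'h \<Rightarrow>\<^sub>0 int) set" where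
  "crossed_mult R H B act \<sigma> X Y =
     (let T = tensor R B H in
      tensor_lift T (\<lambda>a h. tensor_lift T (\<lambda>b k.
        sw H T h (\<lambda>h1 h'. sw H T h' (\<lambda>h2 h3. sw H T k (\<lambda>k1 k2.
          tens R B H (a \<otimes>\<^bsub>B\<^esub> act h1 b \<otimes>\<^bsub>B\<^esub> \<sigma> h2 k1) (h3 \<otimes>\<^bsub>H\<^esub> k2))))) Y) X)"

definition crossed_prod ::
  "('r, 'k) ring_scheme \<Rightarrow> ('r, 'h, 'x) hopf_scheme \<Rightarrow> ('r, 'b, 'y) module_scheme
    \<Rightarrow> ('h \<Rightarrow> 'b \<Rightarrow> 'b) \<Rightarrow> ('h \<Rightarrow> 'h \<Rightarrow> 'b) \<Rightarrow> ('r, ('b \<times> 'h \<Rightarrow>\<^sub>0 int) set) module" where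
  "crossed_prod R H B act \<sigma> =
     (tensor R B H)
       \<lparr>monoid.mult := crossed_mult R H B act \<sigma>, monoid.one := tens R B H \<one>\<^bsub>B\<^esub> \<one>\<^bsub>H\<^esub>\<rparr>"

text \<open>The last assumption says that \<open>B #\<^sub>\<sigma> H\<close> is associative with unit \<open>1 # 1\<close>.\<close>

locale crossed_product = weak_action R H B act
  for R (structure) and H :: "('r, 'h, 'x) hopf_scheme" (structure)
    and B :: "('r, 'b, 'y) module_scheme" (structure) and act +
  fixes \<sigma> :: "'h \<Rightarrow> 'h \<Rightarrow> 'b"
  assumes cocycle_bilinear: "\<sigma> \<in> bilinear_maps R H H B"
    and cocycle_invertible: "conv_invertible R H B \<sigma>"
    and crossed_prod_monoid: "Group.monoid (crossed_prod R H B act \<sigma>)"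

definition crossed_coact ::
  "('r, 'k) ring_scheme \<Rightarrow> ('r, 'h, 'x) hopf_scheme \<Rightarrow> ('r, 'b, 'y) module_scheme
    \<Rightarrow> ('h \<Rightarrow> 'b \<Rightarrow> 'b) \<Rightarrow> ('h \<Rightarrow> 'h \<Rightarrow> 'b)
    \<Rightarrow> ('b \<times> 'h \<Rightarrow>\<^sub>0 int) set \<Rightarrow> (('b \<times> 'h \<Rightarrow>\<^sub>0 int) set \<times> 'h \<Rightarrow>\<^sub>0 int) set" where
  "crossed_coact R H B act \<sigma> =
     (let A = crossed_prod R H B act \<sigma>; T = tensor R A H in
      tensor_lift T (\<lambda>a h. sw H T h (\<lambda>h1 h2. tens R A H (tens R B H a h1) h2)))"

definition crossed_base ::
  "('r, 'k) ring_scheme \<Rightarrow> ('r, 'h, 'x) hopf_scheme \<Rightarrow> ('r, 'b, 'y) module_scheme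
    \<Rightarrow> ('b \<times> 'h \<Rightarrow>\<^sub>0 int) set set" where
  "crossed_base R H B = (\<lambda>b. tens R B H b \<one>\<^bsub>H\<^esub>) ` carrier B"


section \<open>The Galois connection\<close>

text \<open>
  A generalised quotient \<open>H/I\<close> is represented by the right ideal coideal \<open>I\<close>.
\<close>

definition right_ideal_coideal ::
  "('r, 'k) ring_scheme \<Rightarrow> ('r, 'h, 'x) hopf_scheme \<Rightarrow> 'h set \<Rightarrow> bool" where
  "right_ideal_coideal R H I \<longleftrightarrow>
     submodule I R H \<and>
     (\<forall>x\<in>I. \<forall>h\<in>carrier H. x \<otimes>\<^bsub>H\<^esub> h \<in> I) \<and>
     (\<forall>x\<in>I. counit H x = \<zero>\<^bsub>R\<^esub>) \<and>
     (\<forall>x\<in>I. comult H x \<in>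
        generate (add_monoid (tensor R H H))
          ({tens R H H x h | x h. x \<in> I \<and> h \<in> carrier H} \<union>
           {tens R H H h x | x h. x \<in> I \<and> h \<in> carrier H}))"

definition Quot_gen :: "('r, 'k) ring_scheme \<Rightarrow> ('r, 'h, 'x) hopf_scheme \<Rightarrow> 'h set gorder" where
  "Quot_gen R H =
     \<lparr>carrier = {I. right_ideal_coideal R H I}, eq = (=), le = (\<lambda>I J. J \<subseteq> I)\<rparr>"

definition Sub_Alg :: "('r, 'k) ring_scheme \<Rightarrow> ('r, 'a, 'x) module_scheme \<Rightarrow> 'a set \<Rightarrow> 'a set gorder" where
  "Sub_Alg R A B =
     \<lparr>carrier = {S. subring S A \<and> submodule S R A \<and> B \<subseteq> S}, eq = (=), le = (\<subseteq>)\<rparr>"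

text \<open>In the following, \<open>\<delta>\<close> is a right \<open>H\<close>-coaction on \<open>A\<close>.\<close>

definition coinvariants ::
  "('r, 'k) ring_scheme \<Rightarrow> ('r, 'h, 'x) hopf_scheme \<Rightarrow> ('r, 'a, 'y) module_scheme
    \<Rightarrow> ('a \<Rightarrow> ('a \<times> 'h \<Rightarrow>\<^sub>0 int) set) \<Rightarrow> 'h set \<Rightarrow> 'a set" where
  "coinvariants R H A \<delta> I =
     {a \<in> carrier A.
        tensor_map R A H (quot_module H I) (\<lambda>h. I +>\<^bsub>H\<^esub> h) (\<delta> a) =
        tens R A (quot_module H I) a (I +>\<^bsub>H\<^esub> \<one>\<^bsub>H\<^esub>)}"

definition galois_psi ::
  "('r, 'k) ring_scheme \<Rightarrow> ('r, 'h, 'x) hopf_scheme \<Rightarrow> ('r, 'a, 'y) module_scheme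
    \<Rightarrow> ('a \<Rightarrow> ('a \<times> 'h \<Rightarrow>\<^sub>0 int) set) \<Rightarrow> 'a set \<Rightarrow> 'h set" where
  "galois_psi R H A \<delta> S =
     \<Squnion>\<^bsub>Quot_gen R H\<^esub> {I \<in> carrier (Quot_gen R H). S \<subseteq> coinvariants R H A \<delta> I}"

definition galois_closed ::
  "('r, 'k) ring_scheme \<Rightarrow> ('r, 'h, 'x) hopf_scheme \<Rightarrow> ('r, 'a, 'y) module_scheme
    \<Rightarrow> ('a \<Rightarrow> ('a \<times> 'h \<Rightarrow>\<^sub>0 int) set) \<Rightarrow> 'a set \<Rightarrow> bool" where
  "galois_closed R H A \<delta> S \<longleftrightarrow> coinvariants R H A \<delta> (galois_psi R H A \<delta> S) = S"

text \<open>
  The equaliser of \<open>a \<otimes> h \<mapsto> a\<^sub>(\<^sub>0\<^sub>) \<otimes> \<pi> a\<^sub>(\<^sub>1\<^sub>) \<otimes> h\<close> and \<open>a \<otimes> h \<mapsto> a \<otimes> \<pi> h\<^sub>(\<^sub>1\<^sub>) \<otimes> h\<^sub>(\<^sub>2\<^sub>)\<close>, as a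
  submodule of \<open>A \<otimes> H\<close>.
\<close>

definition cotensor ::
  "('r, 'k) ring_scheme \<Rightarrow> ('r, 'h, 'x) hopf_scheme \<Rightarrow> ('r, 'a, 'y) module_scheme
    \<Rightarrow> ('a \<Rightarrow> ('a \<times> 'h \<Rightarrow>\<^sub>0 int) set) \<Rightarrow> 'h set \<Rightarrow> ('r, ('a \<times> 'h \<Rightarrow>\<^sub>0 int) set) module" where
  "cotensor R H A \<delta> I =
     (let Q = quot_module H I; \<pi> = (\<lambda>h. I +>\<^bsub>H\<^esub> h);
          AQ = tensor R A Q; T = tensor R AQ H in
      (tensor R A H)\<lparr>carrier :=
        {z \<in> carrier (tensor R A H).
           tensor_lift T (\<lambda>a h. tens R AQ H (tensor_map R A H Q \<pi> (\<delta> a)) h) z =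
           tensor_lift T (\<lambda>a h. sw H T h (\<lambda>h1 h2. tens R AQ H (tens R A Q a (\<pi> h1)) h2)) z}\<rparr>)"

definition tensor_base ::
  "('r, 'a, 'y) module_scheme \<Rightarrow> 'a set \<Rightarrow> 'a set \<Rightarrow> ('r, ('a \<times> 'a \<Rightarrow>\<^sub>0 int) set) module" where
  "tensor_base A B S =
     bal_tensor B (\<lambda>s b. s \<otimes>\<^bsub>A\<^esub> b) (\<lambda>b a. b \<otimes>\<^bsub>A\<^esub> a) (A\<lparr>carrier := S\<rparr>) A"

definition can_map ::
  "('r, 'k) ring_scheme \<Rightarrow> ('r, 'h, 'x) hopf_scheme \<Rightarrow> ('r, 'a, 'y) module_scheme
    \<Rightarrow> ('a \<Rightarrow> ('a \<times> 'h \<Rightarrow>\<^sub>0 int) set) \<Rightarrow> ('a \<times> 'a \<Rightarrow>\<^sub>0 int) set \<Rightarrow> ('a \<times> 'h \<Rightarrow>\<^sub>0 int) set" where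
  "can_map R H A \<delta> =
     tensor_lift (tensor R A H) (\<lambda>s a.
       tensor_lift (tensor R A H) (\<lambda>a0 a1. tens R A H (s \<otimes>\<^bsub>A\<^esub> a0) a1) (\<delta> a))"

end

theory Submission
  imports Defs
begin

text \<open>
  Write \<open>A = B #\<^sub>\<sigma> H\<close>, let \<open>I\<close> be the right ideal coideal that represents \<open>\<psi>(S)\<close>, and let
  \<open>\<pi> : H \<rightarrow> Q = H/I\<close>.  The proof transports the canonical map into the \<open>R\<close>-module \<open>A \<otimes> H\<close>, in which
  both sides of the equivalence become statements about submodules.

  Since \<open>A\<close> is \<open>B \<otimes> H\<close> as a left \<open>B\<close>-module, \<open>s \<otimes> (b # h) \<mapsto> s b \<otimes> h\<close> is an isomorphism
  \<open>S \<otimes>\<^sub>B A \<cong> S \<otimes> H\<close> (lemma \<open>flatten_base_bij\<close>), and flatness of \<open>H\<close> embeds \<open>S \<otimes> H\<close> into \<open>A \<otimes> H\<close>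
  (\<open>flat_injective\<close>).  Through these identifications \<open>can\<^sub>S\<close> is the restriction of the map
  \<open>\<Gamma> : A \<otimes> H \<rightarrow> A \<otimes> H\<close>, \<open>a \<otimes> h \<mapsto> a (1 # h\<^sub>(\<^sub>1\<^sub>)) \<otimes> h\<^sub>(\<^sub>2\<^sub>)\<close> (\<open>can_eq\<close>).

  The map \<open>\<Gamma>\<close> is bijective (\<open>galois_map_bij\<close>).  Maps of the form \<open>x \<otimes> h \<mapsto> m x h\<^sub>(\<^sub>1\<^sub>) \<otimes> h\<^sub>(\<^sub>2\<^sub>)\<close>, for a
  family \<open>m\<close> of operators indexed by \<open>H\<close>, compose by convolution of the families (\<open>twist_op_conv\<close>),
  and the family \<open>a \<mapsto> a (1 # h)\<close> is the convolution product of \<open>b # k \<mapsto> b \<sigma>(k\<^sub>(\<^sub>1\<^sub>), h) # k\<^sub>(\<^sub>2\<^sub>)\<close>, which is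
  inverted by the convolution inverse of \<open>\<sigma>\<close>, and \<open>b # k \<mapsto> b # k h\<close>, which is inverted by the
  antipode.  Working with these two factors avoids the closed formula for the inverse of the
  cleaving map \<open>h \<mapsto> 1 # h\<close>, and with it the compatibility of the antipode with products and coproducts.

  The same factors, together with right multiplication on \<open>Q\<close>, give an injective map \<open>\<Theta>\<close> of
  \<open>A \<otimes> Q \<otimes> H\<close> (\<open>quot_twist\<close>).  It satisfies \<open>F\<^sub>1 \<circ> \<Gamma> = \<Theta> \<circ> F\<^sub>1\<close> and \<open>F\<^sub>2 \<circ> \<Gamma> = \<Theta> \<circ> E\<close>, where \<open>F\<^sub>1\<close> and \<open>F\<^sub>2\<close> are the two
  maps whose equaliser is \<open>A \<box>\<^sub>Q H\<close> and \<open>E (a \<otimes> h) = a \<otimes> \<pi>(1) \<otimes> h\<close>.  Hence \<open>\<Gamma>\<close> carries the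
  equaliser of \<open>F\<^sub>1\<close> and \<open>E\<close> onto \<open>A \<box>\<^sub>Q H\<close> (\<open>cotensor_image\<close>), and \<open>can\<^sub>S\<close> is an isomorphism if and
  only if \<open>S \<otimes> H\<close> is the equaliser of \<open>F\<^sub>1\<close> and \<open>E\<close>.

  That equaliser is \<open>A\<^sup>c\<^sup>o\<^sup>Q \<otimes> H\<close>, because tensoring with the flat module \<open>H\<close> preserves kernels
  (\<open>flat_kernel\<close>); so \<open>S = A\<^sup>c\<^sup>o\<^sup>Q\<close> suffices.  Conversely, \<open>S\<close> and \<open>A\<^sup>c\<^sup>o\<^sup>Q\<close> are recovered from \<open>S \<otimes> H\<close>
  and from the equaliser as the sets of those \<open>a\<close> for which \<open>a \<otimes> 1\<close> lies in them, by applying the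
  counit to the last factor (\<open>tensor_eq_coinv_tensor_iff\<close>).

  What remains is that \<open>\<psi>(S)\<close>, a least upper bound chosen by description, is represented by a right
  ideal at all.  The least upper bound exists because a sum of right ideal coideals is again one
  (\<open>Quot_gen_sup\<close>).
\<close>

section \<open>Balanced tensor products of abelian groups\<close>

text \<open>
  The map induced by \<open>f\<close> on formal sums, that is, the value of \<^const>\<open>tensor_lift\<close> on a fixed
  representative.
\<close>

definition frag_sum ::
  "('g, 'z) ring_scheme \<Rightarrow> ('m \<Rightarrow> 'n \<Rightarrow> 'g) \<Rightarrow> ('m \<times> 'n \<Rightarrow>\<^sub>0 int) \<Rightarrow> 'g" where
  "frag_sum G f c =
     (\<Oplus>\<^bsub>G\<^esub>p \<in> Poly_Mapping.keys c. [Poly_Mapping.lookup c p] \<cdot>\<^bsub>G\<^esub> f (fst p) (snd p))"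

lemma (in abelian_group) sum_diff_diff:
  "u \<in> carrier G \<Longrightarrow> v \<in> carrier G \<Longrightarrow> u \<oplus> v \<ominus> u \<ominus> v = \<zero>"
  by (metis add.inv_closed minus_add minus_eq r_neg add.m_assoc add.m_closed)

lemma (in abelian_group) add_pow_closed:
  "x \<in> carrier G \<Longrightarrow> [(n::int)] \<cdot> x \<in> carrier G"
  by (rule add.int_pow_closed)

text \<open>
  Additivity in the formal sum is not visible from the definition because the index set, the
  support, changes under addition.  Over a fixed finite set that contains all supports it is.
\<close>

lemma (in abelian_group) frag_sum_superset:
  assumes "finite K" "Poly_Mapping.keys c \<subseteq> K" "\<And>p. p \<in> K \<Longrightarrow> f (fst p) (snd p) \<in> carrier G"
  shows "frag_sum G f c = (\<Oplus>p \<in> K. [Poly_Mapping.lookup c p] \<cdot> f (fst p) (snd p))"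
  unfolding frag_sum_def
proof (rule add.finprod_mono_neutral_cong_left)
  show "\<And>i. i \<in> K - Poly_Mapping.keys c \<Longrightarrow> [Poly_Mapping.lookup c i] \<cdot> f (fst i) (snd i) = \<zero>"
    by (simp add: in_keys_iff add_pow_def)
qed (use assms add_pow_closed in auto)

lemma (in abelian_group) frag_sum_closed:
  assumes "\<And>p. p \<in> Poly_Mapping.keys c \<Longrightarrow> f (fst p) (snd p) \<in> carrier G"
  shows "frag_sum G f c \<in> carrier G"
  unfolding frag_sum_def using assms add_pow_closed by (intro finsum_closed) auto

lemma (in abelian_group) frag_sum_add:
  assumes "\<And>p. p \<in> Poly_Mapping.keys c \<union> Poly_Mapping.keys d \<Longrightarrow> f (fst p) (snd p) \<in> carrier G"
  shows "frag_sum G f (c + d) = frag_sum G f c \<oplus> frag_sum G f d"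
proof -
  let ?K = "Poly_Mapping.keys c \<union> Poly_Mapping.keys d"
  have "frag_sum G f (c + d) = (\<Oplus>p \<in> ?K. [Poly_Mapping.lookup (c + d) p] \<cdot> f (fst p) (snd p))"
    by (rule frag_sum_superset) (use assms Poly_Mapping.keys_add[of c d] in auto)
  also have "\<dots> = (\<Oplus>p \<in> ?K. [Poly_Mapping.lookup c p] \<cdot> f (fst p) (snd p) \<oplus>
      [Poly_Mapping.lookup d p] \<cdot> f (fst p) (snd p))"
    by (rule finsum_cong') (use assms add_pow_closed in \<open>auto simp: lookup_add add.int_pow_mult\<close>)
  also have "\<dots> = (\<Oplus>p \<in> ?K. [Poly_Mapping.lookup c p] \<cdot> f (fst p) (snd p)) \<oplus>
      (\<Oplus>p \<in> ?K. [Poly_Mapping.lookup d p] \<cdot> f (fst p) (snd p))"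
    by (rule finsum_addf) (use assms add_pow_closed in auto)
  also have "\<dots> = frag_sum G f c \<oplus> frag_sum G f d"
    by (subst (1 2) frag_sum_superset[where K = ?K]) (use assms in auto)
  finally show ?thesis .
qed

lemma (in abelian_group) frag_sum_of:
  "f x y \<in> carrier G \<Longrightarrow> frag_sum G f (frag_of (x, y)) = f x y"
  by (subst frag_sum_superset[where K = "{(x, y)}"]) (auto simp: keys_frag_of)

lemma (in abelian_group) frag_sum_0: "frag_sum G f 0 = \<zero>"
  by (simp add: frag_sum_def)

lemma (in abelian_group) frag_sum_minus:
  assumes "\<And>p. p \<in> Poly_Mapping.keys c \<Longrightarrow> f (fst p) (snd p) \<in> carrier G"
  shows "frag_sum G f (- c) = \<ominus> frag_sum G f c"
proof -
  have "frag_sum G f (- c) \<oplus> frag_sum G f c = frag_sum G f (- c + c)"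
    by (rule frag_sum_add[symmetric]) (use assms in auto)
  then show ?thesis
    using assms frag_sum_closed[of c f] frag_sum_closed[of "- c" f] frag_sum_0 minus_equality
    by (metis (mono_tags, lifting) ab_left_minus keys_minus)
qed

lemma (in abelian_group) frag_sum_diff:
  assumes "\<And>p. p \<in> Poly_Mapping.keys c \<union> Poly_Mapping.keys d \<Longrightarrow> f (fst p) (snd p) \<in> carrier G"
  shows "frag_sum G f (c - d) = frag_sum G f c \<ominus> frag_sum G f d"
proof -
  have "frag_sum G f (c + - d) = frag_sum G f c \<oplus> frag_sum G f (- d)"
    by (rule frag_sum_add) (use assms in auto)
  then show ?thesis using frag_sum_minus[of d f] assms by (simp add: minus_eq)
qed

locale balanced_pair = M: abelian_group M + N: abelian_group N
  for T :: "'t set" and ract :: "'m \<Rightarrow> 't \<Rightarrow> 'm" and lact :: "'t \<Rightarrow> 'n \<Rightarrow> 'n"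
    and M :: "('m, 'x) ring_scheme" and N :: "('n, 'y) ring_scheme" +
  assumes ract_closed: "\<lbrakk>x \<in> carrier M; t \<in> T\<rbrakk> \<Longrightarrow> ract x t \<in> carrier M"
    and lact_closed: "\<lbrakk>y \<in> carrier N; t \<in> T\<rbrakk> \<Longrightarrow> lact t y \<in> carrier N"
begin

abbreviation "free \<equiv> free_Abelian_group (carrier M \<times> carrier N)"
abbreviation "rels \<equiv> bal_rels T ract lact M N"
abbreviation "null \<equiv> bal_null T ract lact M N"
abbreviation "TG \<equiv> bal_group T ract lact M N"
abbreviation "tn \<equiv> bal_tens T ract lact M N"

lemma keys_diff_sub: "Poly_Mapping.keys a \<subseteq> S \<Longrightarrow> Poly_Mapping.keys b \<subseteq> S \<Longrightarrow>
   Poly_Mapping.keys (a - b) \<subseteq> S"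
  using keys_diff[of a b] by blast

lemma keys_add_sub: "Poly_Mapping.keys a \<subseteq> S \<Longrightarrow> Poly_Mapping.keys b \<subseteq> S \<Longrightarrow>
   Poly_Mapping.keys (a + b) \<subseteq> S"
  using Poly_Mapping.keys_add[of a b] by blast

lemma frag_free: "x \<in> carrier M \<Longrightarrow> y \<in> carrier N \<Longrightarrow> frag_of (x, y) \<in> carrier free"
  by (simp add: keys_frag_of)

lemma frag_free_diff: "a \<in> carrier free \<Longrightarrow> b \<in> carrier free \<Longrightarrow> a - b \<in> carrier free"
  using keys_diff_sub[of a "carrier M \<times> carrier N" b] by simp

text \<open>
  Stated as an elimination rule since the three shapes of relations are needed in two different
  inductions.
\<close>

lemma rels_cases:
  assumes "c \<in> rels"
  obtains (left) x x' y where "x \<in> carrier M" "x' \<in> carrier M" "y \<in> carrier N"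
      "c = frag_of (x \<oplus>\<^bsub>M\<^esub> x', y) - frag_of (x, y) - frag_of (x', y)"
    | (right) x y y' where "x \<in> carrier M" "y \<in> carrier N" "y' \<in> carrier N"
      "c = frag_of (x, y \<oplus>\<^bsub>N\<^esub> y') - frag_of (x, y) - frag_of (x, y')"
    | (balanced) x t y where "x \<in> carrier M" "t \<in> T" "y \<in> carrier N"
      "c = frag_of (ract x t, y) - frag_of (x, lact t y)"
  using assms unfolding bal_rels_def
proof (elim UnE CollectE exE conjE, goal_cases)
  case (1 x x' y)
  show ?case by (rule left[OF 1(5-7,4)])
next
  case (2 x y y')
  show ?case by (rule right[OF 2(5-7,4)])
next
  case (3 x t y)
  show ?case by (rule balanced[OF 3(5-7,4)])
qed

lemma frag_free_add: "a \<in> carrier free \<Longrightarrow> b \<in> carrier free \<Longrightarrow> a + b \<in> carrier free"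
  using keys_add_sub[of a "carrier M \<times> carrier N" b] by simp

lemma rels_carrier: "rels \<subseteq> carrier free"
  unfolding bal_rels_def
  by (safe intro!: frag_free_diff frag_free M.a_closed N.a_closed ract_closed lact_closed)

sublocale free: comm_group free
  by (rule abelian_free_Abelian_group)

lemma null_subgroup: "subgroup null free"
  unfolding bal_null_def by (rule free.generate_is_subgroup[OF rels_carrier])

sublocale null: normal null free
  by (rule free.subgroup_imp_normal[OF null_subgroup])

lemma rels_null: "c \<in> rels \<Longrightarrow> c \<in> null"
  unfolding bal_null_def by (rule generate.incl)

lemma TG_simps:
  "carrier TG = carrier (free Mod null)" "\<zero>\<^bsub>TG\<^esub> = null" "add TG = (<#>\<^bsub>free\<^esub>)"
  by (simp_all add: bal_group_def Let_def)

lemma TG_abelian: "abelian_group TG"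
proof -
  have "comm_group (free Mod null)"
    by (rule free.abelian_FactGroup[OF null_subgroup])
  moreover have "add_monoid TG = free Mod null"
    by (simp add: bal_group_def Let_def FactGroup_def)
  ultimately show ?thesis
    by (auto simp: abelian_group_def abelian_group_axioms_def abelian_monoid_def comm_group_def)
qed

sublocale TG: abelian_group TG by (rule TG_abelian)

lemma tn_closed: "x \<in> carrier M \<Longrightarrow> y \<in> carrier N \<Longrightarrow> tn x y \<in> carrier TG"
  unfolding bal_tens_def TG_simps carrier_FactGroup using frag_free by blast

lemma coset_add: "a \<in> carrier free \<Longrightarrow> b \<in> carrier free \<Longrightarrow>
   (null #>\<^bsub>free\<^esub> a) \<oplus>\<^bsub>TG\<^esub> (null #>\<^bsub>free\<^esub> b) = null #>\<^bsub>free\<^esub> (a + b)"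
  unfolding TG_simps using null.rcos_sum by simp

lemma coset_eqI:
  assumes "a \<in> carrier free" "b \<in> carrier free" "a - b \<in> null"
  shows "null #>\<^bsub>free\<^esub> a = null #>\<^bsub>free\<^esub> b"
proof -
  have "a \<in> null #>\<^bsub>free\<^esub> b"
    unfolding r_coset_def using assms(3) by (auto intro!: bexI[of _ "a - b"])
  then show ?thesis
    using free.repr_independence[OF _ assms(2) null_subgroup] by metis
qed

lemma tn_add_left:
  assumes "x \<in> carrier M" "x' \<in> carrier M" "y \<in> carrier N"
  shows "tn (x \<oplus>\<^bsub>M\<^esub> x') y = tn x y \<oplus>\<^bsub>TG\<^esub> tn x' y"
proof -
  have "frag_of (x \<oplus>\<^bsub>M\<^esub> x', y) - (frag_of (x, y) + frag_of (x', y)) \<in> null"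
    using assms by (intro rels_null) (auto simp: bal_rels_def diff_diff_eq)
  then show ?thesis
    unfolding bal_tens_def using assms
    by (simp only: coset_add frag_free) (rule coset_eqI,
      simp_all add: frag_free frag_free_add del: carrier_free_Abelian_group_iff)
qed

lemma tn_add_right:
  assumes "x \<in> carrier M" "y \<in> carrier N" "y' \<in> carrier N"
  shows "tn x (y \<oplus>\<^bsub>N\<^esub> y') = tn x y \<oplus>\<^bsub>TG\<^esub> tn x y'"
proof -
  have "frag_of (x, y \<oplus>\<^bsub>N\<^esub> y') - (frag_of (x, y) + frag_of (x, y')) \<in> null"
    using assms by (intro rels_null) (auto simp: bal_rels_def diff_diff_eq)
  then show ?thesis
    unfolding bal_tens_def using assms
    by (simp only: coset_add frag_free) (rule coset_eqI,
      simp_all add: frag_free frag_free_add del: carrier_free_Abelian_group_iff)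
qed

lemma tn_balanced:
  assumes "x \<in> carrier M" "t \<in> T" "y \<in> carrier N"
  shows "tn (ract x t) y = tn x (lact t y)"
  unfolding bal_tens_def
  by (rule coset_eqI) (use assms ract_closed lact_closed in \<open>auto intro!: rels_null
    simp: keys_frag_of bal_rels_def\<close>)

text \<open>
  Negatives of pure tensors are pure tensors, which is what makes the induction rule below possible
  without a case for subtraction.
\<close>

lemma tn_minus:
  assumes "x \<in> carrier M" "y \<in> carrier N"
  shows "tn (\<ominus>\<^bsub>M\<^esub> x) y = null #>\<^bsub>free\<^esub> (- frag_of (x, y))"
proof -
  have "tn \<zero>\<^bsub>M\<^esub> y = \<zero>\<^bsub>TG\<^esub>"
    using tn_add_left[of "\<zero>\<^bsub>M\<^esub>" "\<zero>\<^bsub>M\<^esub>" y] assms tn_closed[of "\<zero>\<^bsub>M\<^esub>" y]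
    by (simp add: TG.add.l_cancel_one')
  then have 1: "tn (\<ominus>\<^bsub>M\<^esub> x) y \<oplus>\<^bsub>TG\<^esub> tn x y = \<zero>\<^bsub>TG\<^esub>"
    using tn_add_left[of "\<ominus>\<^bsub>M\<^esub> x" x y] assms by (simp add: M.l_neg)
  have f: "- frag_of (x, y) \<in> carrier free" "frag_of (x, y) \<in> carrier free"
    using assms by (auto simp: keys_frag_of)
  have 2: "(null #>\<^bsub>free\<^esub> (- frag_of (x, y))) \<oplus>\<^bsub>TG\<^esub> tn x y = \<zero>\<^bsub>TG\<^esub>"
    unfolding bal_tens_def coset_add[OF f]
    using free.coset_mult_one[of null] null.subset by (simp add: TG_simps)
  have 3: "null #>\<^bsub>free\<^esub> (- frag_of (x, y)) \<in> carrier TG"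
    unfolding TG_simps carrier_FactGroup using f by blast
  show ?thesis using 1 2 3 assms tn_closed
    by (metis M.a_inv_closed TG.add.right_cancel)
qed

lemma tensor_induct [consumes 1, case_names zero tens add]:
  assumes z: "z \<in> carrier TG"
    and P0: "P \<zero>\<^bsub>TG\<^esub>"
    and Pt: "\<And>x y. x \<in> carrier M \<Longrightarrow> y \<in> carrier N \<Longrightarrow> P (tn x y)"
    and Pa: "\<And>u v. u \<in> carrier TG \<Longrightarrow> v \<in> carrier TG \<Longrightarrow> P u \<Longrightarrow> P v \<Longrightarrow> P (u \<oplus>\<^bsub>TG\<^esub> v)"
  shows "P z"
proof -
  let ?c = "\<lambda>c. null #>\<^bsub>free\<^esub> c"
  have cl: "?c c \<in> carrier TG" if "Poly_Mapping.keys c \<subseteq> carrier M \<times> carrier N" for c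
    unfolding TG_simps carrier_FactGroup using that by (intro imageI) simp
  have *: "Poly_Mapping.keys c \<subseteq> carrier M \<times> carrier N \<and> P (?c c) \<and> P (?c (- c))"
    if "Poly_Mapping.keys c \<subseteq> carrier M \<times> carrier N" for c
    using that
  proof (induction rule: frag_induction)
    case zero
    then show ?case using P0 free.coset_mult_one[of null] null.subset by (simp add: TG_simps)
  next
    case (one p)
    obtain x y where p: "p = (x, y)" by force
    then have xy: "x \<in> carrier M" "y \<in> carrier N" using one by auto
    show ?case using Pt[OF xy] Pt[of "\<ominus>\<^bsub>M\<^esub> x" y] xy tn_minus[OF xy]
      by (simp add: p keys_frag_of bal_tens_def)
  next
    case (diff a b)
    have m: "Poly_Mapping.keys (- x) \<subseteq> carrier M \<times> carrier N"
      if "Poly_Mapping.keys x \<subseteq> carrier M \<times> carrier N" for x using that by simp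
    have "?c (a - b) = ?c a \<oplus>\<^bsub>TG\<^esub> ?c (- b)" "?c (- (a - b)) = ?c b \<oplus>\<^bsub>TG\<^esub> ?c (- a)"
      by (subst coset_add; use diff in \<open>simp\<close>)+
    then show ?case using diff Pa[OF cl cl] keys_diff_sub[of a _ b] by simp
  qed
  from z obtain c where "c \<in> carrier free" "z = ?c c" unfolding TG_simps carrier_FactGroup by auto
  then show ?thesis using * by simp
qed

definition balanced_biadditive :: "('g, 'z) ring_scheme \<Rightarrow> ('m \<Rightarrow> 'n \<Rightarrow> 'g) \<Rightarrow> bool" where
  "balanced_biadditive G f \<longleftrightarrow>
     (\<forall>x\<in>carrier M. \<forall>y\<in>carrier N. f x y \<in> carrier G) \<and>
     (\<forall>x\<in>carrier M. \<forall>x'\<in>carrier M. \<forall>y\<in>carrier N. f (x \<oplus>\<^bsub>M\<^esub> x') y = f x y \<oplus>\<^bsub>G\<^esub> f x' y) \<and>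
     (\<forall>x\<in>carrier M. \<forall>y\<in>carrier N. \<forall>y'\<in>carrier N. f x (y \<oplus>\<^bsub>N\<^esub> y') = f x y \<oplus>\<^bsub>G\<^esub> f x y') \<and>
     (\<forall>x\<in>carrier M. \<forall>t\<in>T. \<forall>y\<in>carrier N. f (ract x t) y = f x (lact t y))"

context
  fixes G :: "('g, 'z) ring_scheme" and f
  assumes G: "abelian_group G" and f: "balanced_biadditive G f"
begin

interpretation G: abelian_group G by (rule G)

lemma f_closed: "x \<in> carrier M \<Longrightarrow> y \<in> carrier N \<Longrightarrow> f x y \<in> carrier G"
  using f by (simp add: balanced_biadditive_def)

lemma f_keys: "c \<in> carrier free \<Longrightarrow> p \<in> Poly_Mapping.keys c \<Longrightarrow> f (fst p) (snd p) \<in> carrier G"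
  by (intro f_closed) (auto dest!: subsetD)

lemma fs_closed: "c \<in> carrier free \<Longrightarrow> frag_sum G f c \<in> carrier G"
  by (rule G.frag_sum_closed) (rule f_keys)

lemma fs_add: "c \<in> carrier free \<Longrightarrow> d \<in> carrier free \<Longrightarrow>
    frag_sum G f (c + d) = frag_sum G f c \<oplus>\<^bsub>G\<^esub> frag_sum G f d"
  by (rule G.frag_sum_add) (use f_keys in blast)

lemma fs_diff: "c \<in> carrier free \<Longrightarrow> d \<in> carrier free \<Longrightarrow>
    frag_sum G f (c - d) = frag_sum G f c \<ominus>\<^bsub>G\<^esub> frag_sum G f d"
  by (rule G.frag_sum_diff) (use f_keys in blast)

text \<open>
  The induced map on formal sums kills the defining relations, hence the subgroup generated by them
  (next lemma), so that it factors through the tensor product.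
\<close>

lemma frag_sum_rels:
  assumes "c \<in> rels" shows "frag_sum G f c = \<zero>\<^bsub>G\<^esub>"
proof -
  have *: "frag_sum G f (frag_of p - frag_of q - frag_of r) =
      f (fst p) (snd p) \<ominus>\<^bsub>G\<^esub> (f (fst q) (snd q)) \<ominus>\<^bsub>G\<^esub> (f (fst r) (snd r))"
    if "p \<in> carrier M \<times> carrier N" "q \<in> carrier M \<times> carrier N" "r \<in> carrier M \<times> carrier N" for p q r
    using that frag_free f_closed
    by (auto simp: fs_diff frag_free_diff G.frag_sum_of simp del: carrier_free_Abelian_group_iff)
  have **: "frag_sum G f (frag_of p - frag_of q) = f (fst p) (snd p) \<ominus>\<^bsub>G\<^esub> (f (fst q) (snd q))"
    if "p \<in> carrier M \<times> carrier N" "q \<in> carrier M \<times> carrier N" for p q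
    using that frag_free f_closed
    by (auto simp: fs_diff frag_free_diff G.frag_sum_of simp del: carrier_free_Abelian_group_iff)
  from assms show ?thesis
  proof (cases rule: rels_cases)
    case (left x x' y)
    then have "f (x \<oplus>\<^bsub>M\<^esub> x') y = f x y \<oplus>\<^bsub>G\<^esub> f x' y" using f by (simp add: balanced_biadditive_def)
    then show ?thesis using left by (simp add: * G.sum_diff_diff f_closed)
  next
    case (right x y y')
    then have "f x (y \<oplus>\<^bsub>N\<^esub> y') = f x y \<oplus>\<^bsub>G\<^esub> f x y'" using f by (simp add: balanced_biadditive_def)
    then show ?thesis using right by (simp add: * G.sum_diff_diff f_closed)
  next
    case (balanced x t y)
    then have "f (ract x t) y = f x (lact t y)" using f by (simp add: balanced_biadditive_def)
    then show ?thesis using balanced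
      by (simp add: ** ract_closed lact_closed f_closed G.minus_eq G.r_neg)
  qed
qed

lemma frag_sum_null:
  assumes "c \<in> null" shows "frag_sum G f c = \<zero>\<^bsub>G\<^esub>"
  using assms unfolding bal_null_def
proof (induction rule: generate.induct)
  case one then show ?case by (simp add: G.frag_sum_0)
next
  case (incl h) then show ?case by (rule frag_sum_rels)
next
  case (inv h)
  then have "h \<in> carrier free" using rels_carrier by blast
  then show ?case using f_keys[of h] frag_sum_rels[OF inv] by (simp add: G.frag_sum_minus)
next
  case (eng h1 h2)
  then have "h1 \<in> carrier free" "h2 \<in> carrier free"
    using free.generate_in_carrier[OF rels_carrier] by auto
  then show ?case using eng
    by (simp add: fs_add del: carrier_free_Abelian_group_iff)
qed

lemma tensor_lift_coset:
  assumes c: "c \<in> carrier free"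
  shows "tensor_lift G f (null #>\<^bsub>free\<^esub> c) = frag_sum G f c"
proof -
  have "c \<in> null #>\<^bsub>free\<^esub> c" by (rule free.rcos_self[OF c null_subgroup])
  then have "(SOME d. d \<in> null #>\<^bsub>free\<^esub> c) \<in> null #>\<^bsub>free\<^esub> c" by (rule someI)
  then obtain k where k: "k \<in> null" "(SOME d. d \<in> null #>\<^bsub>free\<^esub> c) = k + c"
    unfolding r_coset_def by auto
  have kf: "k \<in> carrier free" using k null.subset by blast
  show ?thesis unfolding tensor_lift_def Let_def k frag_sum_def[symmetric]
    using frag_sum_null[OF k(1)] fs_closed[OF c] by (simp only: fs_add[OF kf c] G.l_zero)
qed

lemma tensor_lift_tn:
  "x \<in> carrier M \<Longrightarrow> y \<in> carrier N \<Longrightarrow> tensor_lift G f (tn x y) = f x y"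
  unfolding bal_tens_def by (subst tensor_lift_coset) (auto simp: keys_frag_of G.frag_sum_of f_closed)

lemma tensor_lift_closed: "z \<in> carrier TG \<Longrightarrow> tensor_lift G f z \<in> carrier G"
  unfolding TG_simps carrier_FactGroup
  by (auto simp del: carrier_free_Abelian_group_iff simp: tensor_lift_coset fs_closed)

lemma tensor_lift_add:
  assumes "z \<in> carrier TG" "w \<in> carrier TG"
  shows "tensor_lift G f (z \<oplus>\<^bsub>TG\<^esub> w) = tensor_lift G f z \<oplus>\<^bsub>G\<^esub> tensor_lift G f w"
proof -
  obtain c d where cd: "c \<in> carrier free" "d \<in> carrier free"
    and z: "z = null #>\<^bsub>free\<^esub> c" "w = null #>\<^bsub>free\<^esub> d"
    using assms unfolding TG_simps carrier_FactGroup by blast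
  have "c + d \<in> carrier free" using free.m_closed[OF cd] by simp
  then show ?thesis unfolding z coset_add[OF cd] using cd
    by (simp add: tensor_lift_coset fs_add del: carrier_free_Abelian_group_iff)
qed

end

end

section \<open>Linear maps and tensor products of modules\<close>

lemma lin_closed: "f \<in> linear_maps R M N \<Longrightarrow> x \<in> carrier M \<Longrightarrow> f x \<in> carrier N"
  by (auto simp: linear_maps_def)

lemma lin_add: "f \<in> linear_maps R M N \<Longrightarrow> x \<in> carrier M \<Longrightarrow> y \<in> carrier M \<Longrightarrow>
    f (x \<oplus>\<^bsub>M\<^esub> y) = f x \<oplus>\<^bsub>N\<^esub> f y"
  by (auto simp: linear_maps_def)

lemma lin_smult: "f \<in> linear_maps R M N \<Longrightarrow> r \<in> carrier R \<Longrightarrow> x \<in> carrier M \<Longrightarrow>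
    f (r \<odot>\<^bsub>M\<^esub> x) = r \<odot>\<^bsub>N\<^esub> f x"
  by (auto simp: linear_maps_def)

lemma linI:
  assumes "\<And>x. x \<in> carrier M \<Longrightarrow> f x \<in> carrier N"
    "\<And>x y. x \<in> carrier M \<Longrightarrow> y \<in> carrier M \<Longrightarrow> f (x \<oplus>\<^bsub>M\<^esub> y) = f x \<oplus>\<^bsub>N\<^esub> f y"
    "\<And>r x. r \<in> carrier R \<Longrightarrow> x \<in> carrier M \<Longrightarrow> f (r \<odot>\<^bsub>M\<^esub> x) = r \<odot>\<^bsub>N\<^esub> f x"
  shows "f \<in> linear_maps R M N"
  using assms by (auto simp: linear_maps_def)

lemma lin_zero:
  assumes "module R M" "module R N" "f \<in> linear_maps R M N"
  shows "f \<zero>\<^bsub>M\<^esub> = \<zero>\<^bsub>N\<^esub>"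
proof -
  interpret M: module R M by fact
  interpret N: module R N by fact
  have "f \<zero>\<^bsub>M\<^esub> \<oplus>\<^bsub>N\<^esub> f \<zero>\<^bsub>M\<^esub> = f \<zero>\<^bsub>M\<^esub>" using lin_add[OF assms(3), of "\<zero>\<^bsub>M\<^esub>" "\<zero>\<^bsub>M\<^esub>"] by simp
  then show ?thesis using lin_closed[OF assms(3), of "\<zero>\<^bsub>M\<^esub>"] N.add.l_cancel_one by simp
qed

lemma lin_minus:
  assumes "module R M" "module R N" "f \<in> linear_maps R M N" "x \<in> carrier M"
  shows "f (\<ominus>\<^bsub>M\<^esub> x) = \<ominus>\<^bsub>N\<^esub> f x"
proof -
  interpret M: module R M by fact
  interpret N: module R N by fact
  have "f (\<ominus>\<^bsub>M\<^esub> x) \<oplus>\<^bsub>N\<^esub> f x = \<zero>\<^bsub>N\<^esub>"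
    using lin_add[OF assms(3), of "\<ominus>\<^bsub>M\<^esub> x" x] lin_zero[OF assms(1-3)] assms(4) by (simp add: M.l_neg)
  then show ?thesis using lin_closed[OF assms(3)] assms(4)
    by (metis M.a_inv_closed N.minus_equality)
qed

lemma lin_inj:
  assumes "module R M" "module R N" "f \<in> linear_maps R M N"
    "\<And>x. x \<in> carrier M \<Longrightarrow> f x = \<zero>\<^bsub>N\<^esub> \<Longrightarrow> x = \<zero>\<^bsub>M\<^esub>"
  shows "inj_on f (carrier M)"
proof (rule inj_onI)
  interpret M: module R M by fact
  interpret N: module R N by fact
  fix x y assume xy: "x \<in> carrier M" "y \<in> carrier M" "f x = f y"
  then have "f (x \<ominus>\<^bsub>M\<^esub> y) = \<zero>\<^bsub>N\<^esub>"
    using lin_add[OF assms(3), of x "\<ominus>\<^bsub>M\<^esub> y"] lin_minus[OF assms(1-3)] lin_closed[OF assms(3)]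
    by (simp add: M.minus_eq N.r_neg)
  then have "x \<ominus>\<^bsub>M\<^esub> y = \<zero>\<^bsub>M\<^esub>" using assms(4) xy by simp
  then show "x = y" using xy
    by (metis M.a_inv_closed M.minus_eq M.minus_equality M.minus_minus M.add.inv_closed)
qed

lemma lin_cong: "f \<in> linear_maps R M N \<Longrightarrow> module R M \<Longrightarrow> (\<And>x. x \<in> carrier M \<Longrightarrow> f x = g x) \<Longrightarrow>
   g \<in> linear_maps R M N"
  by (auto simp: linear_maps_def module.axioms abelian_group.axioms abelian_monoid.a_closed
     module.smult_closed Pi_iff)

lemma lin_id: "(\<lambda>x. x) \<in> linear_maps R M M"
  by (auto simp: linear_maps_def)

lemma lin_compose: "g \<in> linear_maps R N P \<Longrightarrow> f \<in> linear_maps R M N \<Longrightarrow> (\<lambda>x. g (f x)) \<in> linear_maps R M P"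
  by (auto simp: linear_maps_def Pi_iff)

lemma lin_smult_right:
  assumes "module R N" "f \<in> linear_maps R M N" "r \<in> carrier R"
  shows "(\<lambda>x. r \<odot>\<^bsub>N\<^esub> f x) \<in> linear_maps R M N"
proof -
  interpret module R N by fact
  show ?thesis using assms by (auto simp: linear_maps_def Pi_iff smult_r_distr smult_assoc1[symmetric] m_comm)
qed

lemma bilinI:
  "(\<And>x. x \<in> carrier M \<Longrightarrow> f x \<in> linear_maps R N P) \<Longrightarrow>
   (\<And>y. y \<in> carrier N \<Longrightarrow> (\<lambda>x. f x y) \<in> linear_maps R M P) \<Longrightarrow> f \<in> bilinear_maps R M N P"
  by (auto simp: bilinear_maps_def)

lemma bilin1: "f \<in> bilinear_maps R M N P \<Longrightarrow> x \<in> carrier M \<Longrightarrow> f x \<in> linear_maps R N P"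
  by (auto simp: bilinear_maps_def)

lemma bilin2: "f \<in> bilinear_maps R M N P \<Longrightarrow> y \<in> carrier N \<Longrightarrow> (\<lambda>x. f x y) \<in> linear_maps R M P"
  by (auto simp: bilinear_maps_def)

lemma bilin_closed: "f \<in> bilinear_maps R M N P \<Longrightarrow> x \<in> carrier M \<Longrightarrow> y \<in> carrier N \<Longrightarrow> f x y \<in> carrier P"
  using bilin1 lin_closed by metis

lemma bilin_app1:
  "f \<in> bilinear_maps R M N P \<Longrightarrow> g \<in> linear_maps R X M \<Longrightarrow> y \<in> carrier N \<Longrightarrow> (\<lambda>x. f (g x) y) \<in> linear_maps R X P"
  using lin_compose[OF bilin2] by metis

lemma bilin_app2:
  "f \<in> bilinear_maps R M N P \<Longrightarrow> g \<in> linear_maps R X N \<Longrightarrow> x \<in> carrier M \<Longrightarrow> (\<lambda>z. f x (g z)) \<in> linear_maps R X P"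
  using lin_compose[OF bilin1] by metis

text \<open>
  A balanced tensor product inherits the \<open>R\<close>-module structure of its left factor as soon as scalars
  commute with the balancing action.  This covers both \<open>M \<otimes>\<^sub>R N\<close> and \<open>S \<otimes>\<^sub>B A\<close>.
\<close>

locale tensor_module = M: module R M + balanced_pair T ract lact M N
  for R :: "('r, 'k) ring_scheme" and T :: "'t set" and ract :: "'m \<Rightarrow> 't \<Rightarrow> 'm" and lact :: "'t \<Rightarrow> 'n \<Rightarrow> 'n"
    and M :: "('r, 'm, 'x) module_scheme" and N :: "('n, 'y) ring_scheme" +
  assumes ract_smult: "\<lbrakk>r \<in> carrier R; x \<in> carrier M; t \<in> T\<rbrakk> \<Longrightarrow> ract (r \<odot>\<^bsub>M\<^esub> x) t = r \<odot>\<^bsub>M\<^esub> ract x t"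
begin

abbreviation "TM \<equiv> bal_tensor T ract lact M N"

lemma TM_simps: "carrier TM = carrier TG" "add TM = add TG" "\<zero>\<^bsub>TM\<^esub> = \<zero>\<^bsub>TG\<^esub>"
  by (simp_all add: bal_tensor_def Let_def)

lemma TM_abelian: "abelian_group TM"
  by (rule abelian_groupI) (auto simp: TM_simps TG.a_ac intro: TG.l_neg exI[of _ "\<ominus>\<^bsub>TG\<^esub> _"])

lemma smult_balanced: "r \<in> carrier R \<Longrightarrow> balanced_biadditive TG (\<lambda>x y. tn (r \<odot>\<^bsub>M\<^esub> x) y)"
  by (auto simp: balanced_biadditive_def tn_closed tn_add_left tn_add_right M.smult_r_distr
      simp flip: ract_smult tn_balanced)

lemma TM_smult: "r \<odot>\<^bsub>TM\<^esub> z = tensor_lift TG (\<lambda>x y. tn (r \<odot>\<^bsub>M\<^esub> x) y) z"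
  by (simp add: bal_tensor_def Let_def)

lemma TM_smult_closed: "r \<in> carrier R \<Longrightarrow> z \<in> carrier TM \<Longrightarrow> r \<odot>\<^bsub>TM\<^esub> z \<in> carrier TM"
  unfolding TM_smult using tensor_lift_closed[OF TG_abelian smult_balanced] by (simp add: TM_simps)

lemma TM_smult_add: "r \<in> carrier R \<Longrightarrow> z \<in> carrier TM \<Longrightarrow> w \<in> carrier TM \<Longrightarrow>
    r \<odot>\<^bsub>TM\<^esub> (z \<oplus>\<^bsub>TM\<^esub> w) = r \<odot>\<^bsub>TM\<^esub> z \<oplus>\<^bsub>TM\<^esub> r \<odot>\<^bsub>TM\<^esub> w"
  unfolding TM_smult using tensor_lift_add[OF TG_abelian smult_balanced] by (simp add: TM_simps)

lemma TM_smult_tn: "r \<in> carrier R \<Longrightarrow> x \<in> carrier M \<Longrightarrow> y \<in> carrier N \<Longrightarrow>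
    r \<odot>\<^bsub>TM\<^esub> tn x y = tn (r \<odot>\<^bsub>M\<^esub> x) y"
  unfolding TM_smult using tensor_lift_tn[OF TG_abelian smult_balanced] by simp

lemma TM_induct [consumes 1, case_names zero tens add]:
  assumes z: "z \<in> carrier TM"
    and P0: "P \<zero>\<^bsub>TM\<^esub>"
    and Pt: "\<And>x y. x \<in> carrier M \<Longrightarrow> y \<in> carrier N \<Longrightarrow> P (tn x y)"
    and Pa: "\<And>u v. u \<in> carrier TM \<Longrightarrow> v \<in> carrier TM \<Longrightarrow> P u \<Longrightarrow> P v \<Longrightarrow> P (u \<oplus>\<^bsub>TM\<^esub> v)"
  shows "P z"
  by (rule tensor_induct[of z P]) (use assms in \<open>auto simp: TM_simps\<close>)

lemma TM_module: "module R TM"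
proof -
  interpret TMg: abelian_group TM by (rule TM_abelian)
  note cl = TM_smult_closed tn_closed[folded TM_simps]
  have z: "r \<odot>\<^bsub>TM\<^esub> \<zero>\<^bsub>TM\<^esub> = \<zero>\<^bsub>TM\<^esub>" if "r \<in> carrier R" for r
    using TM_smult_add[OF that, of "\<zero>\<^bsub>TM\<^esub>" "\<zero>\<^bsub>TM\<^esub>"] TM_smult_closed[OF that, of "\<zero>\<^bsub>TM\<^esub>"]
      TMg.add.l_cancel_one[of "r \<odot>\<^bsub>TM\<^esub> \<zero>\<^bsub>TM\<^esub>" "r \<odot>\<^bsub>TM\<^esub> \<zero>\<^bsub>TM\<^esub>"] by simp
  show ?thesis
  proof (rule moduleI)
    show "cring R" by (rule M.is_cring)
    show "abelian_group TM" by (rule TM_abelian)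
    fix a x assume ax: "a \<in> carrier R" "x \<in> carrier TM"
    show "a \<odot>\<^bsub>TM\<^esub> x \<in> carrier TM" by (rule TM_smult_closed[OF ax])
    { fix y assume "y \<in> carrier TM"
      then show "a \<odot>\<^bsub>TM\<^esub> (x \<oplus>\<^bsub>TM\<^esub> y) = a \<odot>\<^bsub>TM\<^esub> x \<oplus>\<^bsub>TM\<^esub> a \<odot>\<^bsub>TM\<^esub> y" by (rule TM_smult_add[OF ax]) }
    { fix b assume b: "b \<in> carrier R"
      show "(a \<oplus>\<^bsub>R\<^esub> b) \<odot>\<^bsub>TM\<^esub> x = a \<odot>\<^bsub>TM\<^esub> x \<oplus>\<^bsub>TM\<^esub> b \<odot>\<^bsub>TM\<^esub> x"
        using ax(2)
      proof (induction rule: TM_induct)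
        case zero then show ?case using ax b by (simp add: z)
      next
        case (tens x y)
        then show ?case using ax b
          by (simp add: TM_smult_tn M.smult_l_distr tn_add_left TM_simps)
      next
        case (add u v)
        then show ?case using ax b by (simp add: TM_smult_add cl TMg.a_ac)
      qed
      show "(a \<otimes>\<^bsub>R\<^esub> b) \<odot>\<^bsub>TM\<^esub> x = a \<odot>\<^bsub>TM\<^esub> (b \<odot>\<^bsub>TM\<^esub> x)"
        using ax(2)
      proof (induction rule: TM_induct)
        case zero then show ?case using ax b by (simp add: z)
      next
        case (tens x y)
        then show ?case using ax b by (simp add: TM_smult_tn M.smult_assoc1)
      next
        case (add u v)
        then show ?case using ax b by (simp add: TM_smult_add cl)
      qed }
  next
    fix x assume "x \<in> carrier TM"
    then show "\<one>\<^bsub>R\<^esub> \<odot>\<^bsub>TM\<^esub> x = x"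
    proof (induction rule: TM_induct)
      case zero then show ?case by (simp add: z)
    next
      case (tens x y) then show ?case by (simp add: TM_smult_tn)
    next
      case (add u v) then show ?case by (simp add: TM_smult_add)
    qed
  qed
qed

lemma TM_lift_linear:
  assumes G: "module R G" and f: "balanced_biadditive G f"
    and fs: "\<And>r x y. r \<in> carrier R \<Longrightarrow> x \<in> carrier M \<Longrightarrow> y \<in> carrier N \<Longrightarrow> f (r \<odot>\<^bsub>M\<^esub> x) y = r \<odot>\<^bsub>G\<^esub> f x y"
  shows "tensor_lift G f \<in> linear_maps R TM G"
proof (rule linI)
  interpret G: module R G by fact
  interpret TMm: module R TM by (rule TM_module)
  note lift = tensor_lift_closed[OF G.abelian_group_axioms f] tensor_lift_tn[OF G.abelian_group_axioms f]
    tensor_lift_add[OF G.abelian_group_axioms f]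
  note lift' = lift[folded TM_simps]
  show "\<And>x. x \<in> carrier TM \<Longrightarrow> tensor_lift G f x \<in> carrier G" by (rule lift')
  show add: "\<And>x y. x \<in> carrier TM \<Longrightarrow> y \<in> carrier TM \<Longrightarrow>
     tensor_lift G f (x \<oplus>\<^bsub>TM\<^esub> y) = tensor_lift G f x \<oplus>\<^bsub>G\<^esub> tensor_lift G f y" by (rule lift')
  have z: "tensor_lift G f \<zero>\<^bsub>TM\<^esub> = \<zero>\<^bsub>G\<^esub>"
    using add[of "\<zero>\<^bsub>TM\<^esub>" "\<zero>\<^bsub>TM\<^esub>"] lift'(1)[of "\<zero>\<^bsub>TM\<^esub>"] G.add.l_cancel_one by simp
  fix r x assume r: "r \<in> carrier R" and "x \<in> carrier TM"
  from this(2) show "tensor_lift G f (r \<odot>\<^bsub>TM\<^esub> x) = r \<odot>\<^bsub>G\<^esub> tensor_lift G f x"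
  proof (induction rule: TM_induct)
    case zero then show ?case using r z by simp
  next
    case (tens x y) then show ?case using r by (simp add: TM_smult_tn lift' fs)
  next
    case (add u v) then show ?case using r by (simp add: TM_smult_add lift' G.smult_r_distr)
  qed
qed

end

subsection \<open>Tensor products over the base ring\<close>

lemma tensor_module_base:
  assumes "module R M" "module R N"
  shows "tensor_module R (carrier R) (\<lambda>x r. r \<odot>\<^bsub>M\<^esub> x) (\<lambda>r y. r \<odot>\<^bsub>N\<^esub> y) M N"
proof -
  interpret M: module R M by fact
  interpret N: module R N by fact
  show ?thesis by unfold_locales (simp_all add: M.smult_assoc1[symmetric] M.m_comm)
qed

context
  fixes R :: "('r, 'k) ring_scheme" and M :: "('r, 'm, 'x) module_scheme" and N :: "('r, 'n, 'y) module_scheme"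
  assumes M: "module R M" and N: "module R N"
begin

interpretation tensor_module R "carrier R" "\<lambda>x r. r \<odot>\<^bsub>M\<^esub> x" "\<lambda>r y. r \<odot>\<^bsub>N\<^esub> y" M N
  by (rule tensor_module_base[OF M N])

lemma tensor_is_module: "module R (tensor R M N)"
  unfolding tensor_def by (rule TM_module)

lemma tens_closed: "x \<in> carrier M \<Longrightarrow> y \<in> carrier N \<Longrightarrow> tens R M N x y \<in> carrier (tensor R M N)"
  unfolding tensor_def tens_def TM_simps by (rule tn_closed)

lemma tens_smult_left:
  "r \<in> carrier R \<Longrightarrow> x \<in> carrier M \<Longrightarrow> y \<in> carrier N \<Longrightarrow>
   tens R M N (r \<odot>\<^bsub>M\<^esub> x) y = r \<odot>\<^bsub>tensor R M N\<^esub> tens R M N x y"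
  by (simp add: tensor_def tens_def TM_smult_tn)

lemma tens_smult_right:
  "r \<in> carrier R \<Longrightarrow> x \<in> carrier M \<Longrightarrow> y \<in> carrier N \<Longrightarrow>
   tens R M N x (r \<odot>\<^bsub>N\<^esub> y) = r \<odot>\<^bsub>tensor R M N\<^esub> tens R M N x y"
  using tn_balanced[of x r y] by (simp add: tensor_def tens_def TM_smult_tn)

lemma tens_bilinear: "tens R M N \<in> bilinear_maps R M N (tensor R M N)"
  by (intro bilinI linI tens_closed tens_smult_left tens_smult_right)
    (auto simp: tensor_def tens_def TM_simps tn_add_left tn_add_right)

lemma tens_induct [consumes -3, case_names zero tens add]:
  assumes z: "z \<in> carrier (tensor R M N)"
    and P0: "P \<zero>\<^bsub>tensor R M N\<^esub>"
    and Pt: "\<And>x y. x \<in> carrier M \<Longrightarrow> y \<in> carrier N \<Longrightarrow> P (tens R M N x y)"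
    and Pa: "\<And>u v. u \<in> carrier (tensor R M N) \<Longrightarrow> v \<in> carrier (tensor R M N) \<Longrightarrow> P u \<Longrightarrow> P v \<Longrightarrow>
      P (u \<oplus>\<^bsub>tensor R M N\<^esub> v)"
  shows "P z"
  using z by (rule TM_induct[folded tensor_def tens_def]) (use P0 Pt Pa in auto)

lemma bilinear_balanced: "f \<in> bilinear_maps R M N G \<Longrightarrow> balanced_biadditive G f"
  unfolding balanced_biadditive_def bilinear_maps_def linear_maps_def by auto

lemma lift_linear:
  assumes "module R G" "f \<in> bilinear_maps R M N G"
  shows "tensor_lift G f \<in> linear_maps R (tensor R M N) G"
  unfolding tensor_def
  by (rule TM_lift_linear[OF assms(1) bilinear_balanced[OF assms(2)]])
    (use assms(2) in \<open>auto simp: bilinear_maps_def linear_maps_def\<close>)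

lemma lift_tens:
  assumes "module R G" "f \<in> bilinear_maps R M N G" "x \<in> carrier M" "y \<in> carrier N"
  shows "tensor_lift G f (tens R M N x y) = f x y"
proof -
  interpret G: module R G by fact
  show ?thesis unfolding tens_def
    by (rule tensor_lift_tn[OF G.abelian_group_axioms bilinear_balanced[OF assms(2)] assms(3,4)])
qed

lemma lin_ext:
  assumes "module R G"
    "f \<in> linear_maps R (tensor R M N) G" "g \<in> linear_maps R (tensor R M N) G"
    "\<And>x y. x \<in> carrier M \<Longrightarrow> y \<in> carrier N \<Longrightarrow> f (tens R M N x y) = g (tens R M N x y)"
    "z \<in> carrier (tensor R M N)"
  shows "f z = g z"
  using assms(5)
proof (induction rule: tens_induct)
  case zero
  then show ?case using lin_zero[OF tensor_is_module] assms by metis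
next
  case (tens x y) then show ?case by (rule assms)
next
  case (add u v) then show ?case using lin_add[OF assms(2)] lin_add[OF assms(3)] by simp
qed

end

lemma bilin_cong:
  assumes "f \<in> bilinear_maps R M N G" "module R M" "module R N"
    "\<And>x y. x \<in> carrier M \<Longrightarrow> y \<in> carrier N \<Longrightarrow> f x y = g x y"
  shows "g \<in> bilinear_maps R M N G"
proof (rule bilinI)
  show "g x \<in> linear_maps R N G" if "x \<in> carrier M" for x
    by (rule lin_cong[OF bilin1[OF assms(1) that] assms(3)]) (use assms(4) that in auto)
  show "(\<lambda>x. g x y) \<in> linear_maps R M G" if "y \<in> carrier N" for y
    by (rule lin_cong[OF bilin2[OF assms(1) that] assms(2)]) (use assms(4) that in auto)
qed

lemma lift_cong:
  assumes "module R M" "module R N" "module R G" "f \<in> bilinear_maps R M N G"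
    "\<And>x y. x \<in> carrier M \<Longrightarrow> y \<in> carrier N \<Longrightarrow> f x y = g x y" "z \<in> carrier (tensor R M N)"
  shows "tensor_lift G f z = tensor_lift G g z"
proof -
  have g: "g \<in> bilinear_maps R M N G" by (rule bilin_cong[OF assms(4,1,2,5)])
  show ?thesis
    by (rule lin_ext[OF assms(1-3) lift_linear[OF assms(1-4)] lift_linear[OF assms(1-3) g] _ assms(6)])
      (simp add: lift_tens[OF assms(1-4)] lift_tens[OF assms(1-3) g] assms(5))
qed

text \<open>
  A lift is linear in its argument and also in the bilinear map.  With this second kind of linearity
  nested lifts, and hence nested Sweedler sums, can be recognised as multilinear by rules that follow
  the syntax of the term.
\<close>

lemma lift_lin_fun:
  assumes "module R M" "module R N" "module R G" "module R P"
    "\<And>x. x \<in> carrier P \<Longrightarrow> F x \<in> bilinear_maps R M N G"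
    "\<And>m n. m \<in> carrier M \<Longrightarrow> n \<in> carrier N \<Longrightarrow> (\<lambda>x. F x m n) \<in> linear_maps R P G"
    "z \<in> carrier (tensor R M N)"
  shows "(\<lambda>x. tensor_lift G (F x) z) \<in> linear_maps R P G"
proof -
  interpret G: module R G by fact
  interpret P: module R P by fact
  interpret T: module R "tensor R M N" by (rule tensor_is_module; fact)
  note l = lift_linear[OF assms(1-3) assms(5)]
  show ?thesis
    using assms(1,2,7)
  proof (induction rule: tens_induct)
    case zero
    have "tensor_lift G (F x) \<zero>\<^bsub>tensor R M N\<^esub> = \<zero>\<^bsub>G\<^esub>" if "x \<in> carrier P" for x
      by (rule lin_zero[OF T.module_axioms assms(3) l[OF that]])
    then show ?case by (intro linI) auto
  next
    case (tens m n)
    show ?case by (rule lin_cong[OF assms(6)[OF tens] assms(4)])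
      (simp add: lift_tens[OF assms(1-3) assms(5) tens])
  next
    case (add u v)
    have "(\<lambda>x. tensor_lift G (F x) u \<oplus>\<^bsub>G\<^esub> tensor_lift G (F x) v) \<in> linear_maps R P G"
      using lin_closed[OF add(3)] lin_closed[OF add(4)] lin_add[OF add(3)] lin_add[OF add(4)]
        lin_smult[OF add(3)] lin_smult[OF add(4)]
      by (intro linI) (simp_all add: G.a_ac G.smult_r_distr)
    then show ?case
      by (rule lin_cong[OF _ assms(4)]) (simp add: lin_add[OF l add(1,2)])
  qed
qed

lemma lift_comp:
  assumes "module R M" "module R N" "module R G" "module R G'" "f \<in> bilinear_maps R M N G"
    "L \<in> linear_maps R G G'" "z \<in> carrier (tensor R M N)"
  shows "L (tensor_lift G f z) = tensor_lift G' (\<lambda>x y. L (f x y)) z"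
proof -
  have b: "(\<lambda>x y. L (f x y)) \<in> bilinear_maps R M N G'"
    by (intro bilinI lin_compose[OF assms(6)] bilin1[OF assms(5)] bilin2[OF assms(5)])
  show ?thesis
    by (rule lin_ext[OF assms(1,2,4) lin_compose[OF assms(6) lift_linear[OF assms(1-3,5)]]
      lift_linear[OF assms(1,2,4) b] _ assms(7)])
      (simp add: lift_tens[OF assms(1-3,5)] lift_tens[OF assms(1,2,4) b])
qed

text \<open>
  Both sides are linear in \<open>z\<close>, so it suffices to compare them on pure tensors.
\<close>

lemma lift_swap:
  assumes "module R M" "module R N" "module R P" "module R Q" "module R G"
    "\<And>u v. u \<in> carrier P \<Longrightarrow> v \<in> carrier Q \<Longrightarrow> (\<lambda>x y. F x y u v) \<in> bilinear_maps R M N G"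
    "\<And>x y. x \<in> carrier M \<Longrightarrow> y \<in> carrier N \<Longrightarrow> F x y \<in> bilinear_maps R P Q G"
    "z \<in> carrier (tensor R M N)" "w \<in> carrier (tensor R P Q)"
  shows "tensor_lift G (\<lambda>x y. tensor_lift G (F x y) w) z =
    tensor_lift G (\<lambda>u v. tensor_lift G (\<lambda>x y. F x y u v) z) w"
proof -
  note T = tensor_is_module[OF assms(1,2)]
  have b: "(\<lambda>x y. tensor_lift G (F x y) w) \<in> bilinear_maps R M N G"
    by (intro bilinI lift_lin_fun[OF assms(3,4,5) _ assms(7) _ assms(9)] assms(1,2)
      bilin1[OF assms(6)] bilin2[OF assms(6)])
  show ?thesis
  proof (rule lin_ext[OF assms(1,2,5) lift_linear[OF assms(1,2,5) b] _ _ assms(8)])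
    show "(\<lambda>z. tensor_lift G (\<lambda>u v. tensor_lift G (\<lambda>x y. F x y u v) z) w) \<in> linear_maps R (tensor R M N) G"
    proof (rule lift_lin_fun[OF assms(3-5) T _ _ assms(9)])
      fix z assume "z \<in> carrier (tensor R M N)"
      then show "(\<lambda>u v. tensor_lift G (\<lambda>x y. F x y u v) z) \<in> bilinear_maps R P Q G"
        by (intro bilinI lift_lin_fun[OF assms(1,2,5)] assms(3,4) assms(6)
          bilin1[OF assms(7)] bilin2[OF assms(7)])
    qed (rule lift_linear[OF assms(1,2,5) assms(6)])
    fix x y assume xy: "x \<in> carrier M" "y \<in> carrier N"
    show "tensor_lift G (\<lambda>x y. tensor_lift G (F x y) w) (tens R M N x y) =
       tensor_lift G (\<lambda>u v. tensor_lift G (\<lambda>x y. F x y u v) (tens R M N x y)) w"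
      unfolding lift_tens[OF assms(1,2,5) b xy]
      by (rule lift_cong[OF assms(3-5) assms(7)[OF xy] _ assms(9)])
        (simp add: lift_tens[OF assms(1,2,5) assms(6) xy])
  qed
qed

lemma tensor_map_linear:
  assumes "module R M" "module R N" "module R P" "f \<in> linear_maps R N P"
  shows "tensor_map R M N P f \<in> linear_maps R (tensor R M N) (tensor R M P)"
  unfolding tensor_map_def
  by (intro lift_linear tensor_is_module assms bilinI bilin_app2[OF tens_bilinear]
     bilin_app1[OF tens_bilinear] lin_id lin_closed[OF assms(4)])

lemma tensor_map_tens:
  assumes "module R M" "module R N" "module R P" "f \<in> linear_maps R N P" "x \<in> carrier M" "y \<in> carrier N"
  shows "tensor_map R M N P f (tens R M N x y) = tens R M P x (f y)"
  unfolding tensor_map_def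
  by (intro lift_tens tensor_is_module assms bilinI bilin_app2[OF tens_bilinear]
     bilin_app1[OF tens_bilinear] lin_id lin_closed[OF assms(4)])

section \<open>Sweedler calculus\<close>

lemma tens_lin1:
  "module R M \<Longrightarrow> module R N \<Longrightarrow> g \<in> linear_maps R X M \<Longrightarrow> y \<in> carrier N \<Longrightarrow>
   (\<lambda>x. tens R M N (g x) y) \<in> linear_maps R X (tensor R M N)"
  by (rule bilin_app1[OF tens_bilinear])

lemma tens_lin2:
  "module R M \<Longrightarrow> module R N \<Longrightarrow> g \<in> linear_maps R X N \<Longrightarrow> y \<in> carrier M \<Longrightarrow>
   (\<lambda>x. tens R M N y (g x)) \<in> linear_maps R X (tensor R M N)"
  by (rule bilin_app2[OF tens_bilinear])

lemma lift_lin_arg: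
  "module R M \<Longrightarrow> module R N \<Longrightarrow> module R G \<Longrightarrow> f \<in> bilinear_maps R M N G \<Longrightarrow>
   g \<in> linear_maps R X (tensor R M N) \<Longrightarrow> (\<lambda>x. tensor_lift G f (g x)) \<in> linear_maps R X G"
  by (rule lin_compose[OF lift_linear])

lemma lift_closed:
  "module R M \<Longrightarrow> module R N \<Longrightarrow> module R G \<Longrightarrow> f \<in> bilinear_maps R M N G \<Longrightarrow>
   z \<in> carrier (tensor R M N) \<Longrightarrow> tensor_lift G f z \<in> carrier G"
  by (rule lin_closed[OF lift_linear])

context hopf_algebra
begin

lemma modH: "module R H" ..

lemma comult_closed: "h \<in> carrier H \<Longrightarrow> comult H h \<in> carrier (tensor R H H)"
  by (rule lin_closed[OF comult_linear])

text \<open>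
  A Sweedler sum is a lift evaluated at a coproduct.  The following rules restate the calculus of
  lifts in this notation; together they allow computations with \<^const>\<open>sw\<close> that never choose
  representatives of the coproduct.
\<close>

lemma sw_lin_arg:
  "module R G \<Longrightarrow> f \<in> bilinear_maps R H H G \<Longrightarrow> g \<in> linear_maps R X H \<Longrightarrow>
   (\<lambda>x. sw H G (g x) f) \<in> linear_maps R X G"
  unfolding sw_def by (rule lift_lin_arg[OF modH modH _ _ lin_compose[OF comult_linear]])

lemma sw_lin_fun:
  "module R G \<Longrightarrow> module R P \<Longrightarrow> (\<And>x. x \<in> carrier P \<Longrightarrow> F x \<in> bilinear_maps R H H G) \<Longrightarrow>
   (\<And>a b. a \<in> carrier H \<Longrightarrow> b \<in> carrier H \<Longrightarrow> (\<lambda>x. F x a b) \<in> linear_maps R P G) \<Longrightarrow>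
   h \<in> carrier H \<Longrightarrow> (\<lambda>x. sw H G h (F x)) \<in> linear_maps R P G"
  unfolding sw_def by (rule lift_lin_fun[OF modH modH _ _ _ _ comult_closed])

lemma sw_closed:
  "module R G \<Longrightarrow> f \<in> bilinear_maps R H H G \<Longrightarrow> h \<in> carrier H \<Longrightarrow> sw H G h f \<in> carrier G"
  unfolding sw_def by (rule lift_closed[OF modH modH _ _ comult_closed])

lemma sw_lin:
  "module R G \<Longrightarrow> module R G' \<Longrightarrow> f \<in> bilinear_maps R H H G \<Longrightarrow> L \<in> linear_maps R G G' \<Longrightarrow>
   h \<in> carrier H \<Longrightarrow> L (sw H G h f) = sw H G' h (\<lambda>a b. L (f a b))"
  unfolding sw_def by (rule lift_comp[OF modH modH _ _ _ _ comult_closed])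

lemma sw_cong:
  "module R G \<Longrightarrow> f \<in> bilinear_maps R H H G \<Longrightarrow> (\<And>a b. a \<in> carrier H \<Longrightarrow> b \<in> carrier H \<Longrightarrow> f a b = g a b) \<Longrightarrow>
   h \<in> carrier H \<Longrightarrow> sw H G h f = sw H G h g"
  unfolding sw_def by (rule lift_cong[OF modH modH _ _ _ comult_closed])

lemma sw_swap:
  "module R G \<Longrightarrow>
   (\<And>u v. u \<in> carrier H \<Longrightarrow> v \<in> carrier H \<Longrightarrow> (\<lambda>a b. F a b u v) \<in> bilinear_maps R H H G) \<Longrightarrow>
   (\<And>a b. a \<in> carrier H \<Longrightarrow> b \<in> carrier H \<Longrightarrow> F a b \<in> bilinear_maps R H H G) \<Longrightarrow>
   h \<in> carrier H \<Longrightarrow> k \<in> carrier H \<Longrightarrow>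
   sw H G h (\<lambda>a b. sw H G k (F a b)) = sw H G k (\<lambda>u v. sw H G h (\<lambda>a b. F a b u v))"
  unfolding sw_def by (rule lift_swap[OF modH modH modH modH _ _ _ comult_closed comult_closed])

lemma counit_closed: "h \<in> carrier H \<Longrightarrow> counit H h \<in> carrier R"
  using counit_hom by (auto simp: ring_hom_def)

lemma counit_one: "counit H \<one>\<^bsub>H\<^esub> = \<one>\<^bsub>R\<^esub>"
  using counit_hom by (auto simp: ring_hom_def)

lemma counit_lin:
  assumes "module R M" "g \<in> linear_maps R X H" "y \<in> carrier M"
  shows "(\<lambda>x. counit H (g x) \<odot>\<^bsub>M\<^esub> y) \<in> linear_maps R X M"
proof -
  interpret M': module R M by fact
  have "(\<lambda>h. counit H h \<odot>\<^bsub>M\<^esub> y) \<in> linear_maps R H M"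
    using assms(3) counit_hom
    by (intro linI) (auto simp: counit_closed ring_hom_def counit_smult M'.smult_l_distr M'.smult_assoc1)
  then show ?thesis by (rule lin_compose[OF _ assms(2)])
qed

lemma H_mult_closed: "h \<in> carrier H \<Longrightarrow> k \<in> carrier H \<Longrightarrow> h \<otimes>\<^bsub>H\<^esub> k \<in> carrier H"
  by (rule m_closed)

lemma mult_bilinear: "(\<lambda>h k. h \<otimes>\<^bsub>H\<^esub> k) \<in> bilinear_maps R H H H"
  by (intro bilinI linI) (auto simp: smult_mult_left smult_mult_right l_distr r_distr)

lemma antipode_closed: "h \<in> carrier H \<Longrightarrow> antipode H h \<in> carrier H"
  by (rule lin_closed[OF antipode_linear])

text \<open>
  Applied exhaustively, these rules discharge the linearity and closure side conditions of Sweedler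
  computations.
\<close>

lemmas lins = tens_lin1 tens_lin2 sw_lin_arg sw_lin_fun counit_lin lift_lin_arg
  bilin_app1[OF mult_bilinear] bilin_app2[OF mult_bilinear] lin_compose[OF antipode_linear]
  lin_smult_right bilinI lin_id tens_closed sw_closed H_mult_closed
  antipode_closed counit_closed smult_closed tensor_is_module modH lift_closed

lemma sw_mult:
  assumes G: "module R G" and f: "f \<in> bilinear_maps R H H G" and hk: "h \<in> carrier H" "k \<in> carrier H"
  shows "sw H G (h \<otimes>\<^bsub>H\<^esub> k) f = sw H G h (\<lambda>h1 h2. sw H G k (\<lambda>k1 k2. f (h1 \<otimes>\<^bsub>H\<^esub> k1) (h2 \<otimes>\<^bsub>H\<^esub> k2)))"
proof -
  let ?T = "tensor R H H"
  let ?t = "tens R H H"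
  note T = tensor_is_module[OF modH modH]
  note L = lift_linear[OF modH modH G f]
  have "sw H G (h \<otimes>\<^bsub>H\<^esub> k) f = tensor_lift G f (sw H ?T h (\<lambda>h1 h2. sw H ?T k (\<lambda>k1 k2.
           ?t (h1 \<otimes>\<^bsub>H\<^esub> k1) (h2 \<otimes>\<^bsub>H\<^esub> k2))))"
    unfolding sw_def[of H G "h \<otimes>\<^bsub>H\<^esub> k"] comult_mult[OF hk] ..
  also have "\<dots> = sw H G h (\<lambda>h1 h2. tensor_lift G f (sw H ?T k (\<lambda>k1 k2.
           ?t (h1 \<otimes>\<^bsub>H\<^esub> k1) (h2 \<otimes>\<^bsub>H\<^esub> k2))))"
    by (rule sw_lin[OF T G _ L hk(1)]) (insert hk T, (assumption | rule lins)+)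
  also have "\<dots> = sw H G h (\<lambda>h1 h2. sw H G k (\<lambda>k1 k2. f (h1 \<otimes>\<^bsub>H\<^esub> k1) (h2 \<otimes>\<^bsub>H\<^esub> k2)))"
  proof (rule sw_cong[OF G _ _ hk(1)])
    show "(\<lambda>h1 h2. tensor_lift G f (sw H ?T k (\<lambda>k1 k2. ?t (h1 \<otimes>\<^bsub>H\<^esub> k1) (h2 \<otimes>\<^bsub>H\<^esub> k2)))) \<in> bilinear_maps R H H G"
      by (insert hk G T f, (assumption | rule lins)+)
    fix h1 h2 assume h12: "h1 \<in> carrier H" "h2 \<in> carrier H"
    have "tensor_lift G f (sw H ?T k (\<lambda>k1 k2. ?t (h1 \<otimes>\<^bsub>H\<^esub> k1) (h2 \<otimes>\<^bsub>H\<^esub> k2))) =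
       sw H G k (\<lambda>k1 k2. tensor_lift G f (?t (h1 \<otimes>\<^bsub>H\<^esub> k1) (h2 \<otimes>\<^bsub>H\<^esub> k2)))"
      by (rule sw_lin[OF T G _ L hk(2)]) (insert hk T h12, (assumption | rule lins)+)
    also have "\<dots> = sw H G k (\<lambda>k1 k2. f (h1 \<otimes>\<^bsub>H\<^esub> k1) (h2 \<otimes>\<^bsub>H\<^esub> k2))"
      by (rule sw_cong[OF G _ _ hk(2)], insert hk T h12 f G)
        ((assumption | rule lins)+, simp add: lift_tens[OF modH modH])
    finally show "tensor_lift G f (sw H ?T k (\<lambda>k1 k2. ?t (h1 \<otimes>\<^bsub>H\<^esub> k1) (h2 \<otimes>\<^bsub>H\<^esub> k2))) =
       sw H G k (\<lambda>k1 k2. f (h1 \<otimes>\<^bsub>H\<^esub> k1) (h2 \<otimes>\<^bsub>H\<^esub> k2))" .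
  qed
  finally show ?thesis .
qed

lemma sw_one: "module R G \<Longrightarrow> f \<in> bilinear_maps R H H G \<Longrightarrow> sw H G \<one>\<^bsub>H\<^esub> f = f \<one>\<^bsub>H\<^esub> \<one>\<^bsub>H\<^esub>"
  by (simp add: sw_def comult_one lift_tens[OF modH modH])

text \<open>
  The coassociativity axiom is the case of the universal trilinear map; the general case follows by
  applying to it the linear map on \<open>(H \<otimes> H) \<otimes> H\<close> that \<open>F\<close> induces.
\<close>

lemma sw_coassoc:
  assumes G: "module R G"
    and F1: "\<And>b c. b \<in> carrier H \<Longrightarrow> c \<in> carrier H \<Longrightarrow> (\<lambda>a. F a b c) \<in> linear_maps R H G"
    and F2: "\<And>a c. a \<in> carrier H \<Longrightarrow> c \<in> carrier H \<Longrightarrow> (\<lambda>b. F a b c) \<in> linear_maps R H G"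
    and F3: "\<And>a b. a \<in> carrier H \<Longrightarrow> b \<in> carrier H \<Longrightarrow> (\<lambda>c. F a b c) \<in> linear_maps R H G"
    and h: "h \<in> carrier H"
  shows "sw H G h (\<lambda>x c. sw H G x (\<lambda>a b. F a b c)) = sw H G h (\<lambda>a x. sw H G x (\<lambda>b c. F a b c))"
proof -
  let ?T = "tensor R H H" and ?TT = "tensor R (tensor R H H) H"
  let ?t = "tens R H H" and ?tt = "tens R (tensor R H H) H"
  note T = tensor_is_module[OF modH modH]
  note TT = tensor_is_module[OF T modH]
  have Fb: "(\<lambda>a b. F a b c) \<in> bilinear_maps R H H G" if "c \<in> carrier H" for c
    using that F1 F2 by (intro bilinI)
  have Fb2: "F a \<in> bilinear_maps R H H G" if "a \<in> carrier H" for a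
    using that F3 F2 by (intro bilinI)
  have Fl: "(\<lambda>X c. tensor_lift G (\<lambda>a b. F a b c) X) \<in> bilinear_maps R ?T H G"
    by (insert G T, (assumption | rule Fb F3 lift_lin_fun lift_linear modH bilinI)+)
  let ?L = "tensor_lift G (\<lambda>X c. tensor_lift G (\<lambda>a b. F a b c) X)"
  note L = lift_linear[OF T modH G Fl]
  have L_tt: "?L (?tt (?t a b) c) = F a b c" if "a \<in> carrier H" "b \<in> carrier H" "c \<in> carrier H" for a b c
    using that by (simp add: lift_tens[OF T modH G Fl] lift_tens[OF modH modH G Fb] tens_closed modH)
  note rules = lins F1 F2 F3 Fb Fb2 lin_compose[OF L] lin_closed[OF L]
  have b1: "(\<lambda>a b. ?tt (?t a b) c) \<in> bilinear_maps R H H ?TT" if "c \<in> carrier H" for c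
    by (insert that T TT, (assumption | rule lins)+)
  have b2: "(\<lambda>b c. ?tt (?t a b) c) \<in> bilinear_maps R H H ?TT" if "a \<in> carrier H" for a
    by (insert that T TT, (assumption | rule lins)+)
  have "?L (sw H ?TT h (\<lambda>x c. sw H ?TT x (\<lambda>a b. ?tt (?t a b) c))) =
    sw H G h (\<lambda>x c. ?L (sw H ?TT x (\<lambda>a b. ?tt (?t a b) c)))"
    by (rule sw_lin[OF TT G _ L h]) (insert h T TT, (assumption | rule lins)+)
  also have "\<dots> = sw H G h (\<lambda>x c. sw H G x (\<lambda>a b. F a b c))"
  proof (rule sw_cong[OF G _ _ h])
    show "(\<lambda>x c. ?L (sw H ?TT x (\<lambda>a b. ?tt (?t a b) c))) \<in> bilinear_maps R H H G"
      by (insert h T TT G Fl, (assumption | rule lins)+)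
    fix x c assume xc: "x \<in> carrier H" "c \<in> carrier H"
    have "?L (sw H ?TT x (\<lambda>a b. ?tt (?t a b) c)) = sw H G x (\<lambda>a b. ?L (?tt (?t a b) c))"
      by (rule sw_lin[OF TT G b1 L]) fact+
    also have "\<dots> = sw H G x (\<lambda>a b. F a b c)"
      by (rule sw_cong[OF G _ L_tt])
        (insert xc, auto intro!: bilin_cong[OF Fb[of c] modH modH] simp: L_tt)
    finally show "?L (sw H ?TT x (\<lambda>a b. ?tt (?t a b) c)) = sw H G x (\<lambda>a b. F a b c)" .
  qed
  finally have 1: "?L (sw H ?TT h (\<lambda>x c. sw H ?TT x (\<lambda>a b. ?tt (?t a b) c))) = \<dots>" .
  have "?L (sw H ?TT h (\<lambda>a x. sw H ?TT x (\<lambda>b c. ?tt (?t a b) c))) =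
    sw H G h (\<lambda>a x. ?L (sw H ?TT x (\<lambda>b c. ?tt (?t a b) c)))"
    by (rule sw_lin[OF TT G _ L h]) (insert h T TT, (assumption | rule lins)+)
  also have "\<dots> = sw H G h (\<lambda>a x. sw H G x (\<lambda>b c. F a b c))"
  proof (rule sw_cong[OF G _ _ h])
    show "(\<lambda>a x. ?L (sw H ?TT x (\<lambda>b c. ?tt (?t a b) c))) \<in> bilinear_maps R H H G"
      by (insert h T TT G Fl, (assumption | rule lins)+)
    fix a x assume xa: "a \<in> carrier H" "x \<in> carrier H"
    have "?L (sw H ?TT x (\<lambda>b c. ?tt (?t a b) c)) = sw H G x (\<lambda>b c. ?L (?tt (?t a b) c))"
      by (rule sw_lin[OF TT G b2 L]) fact+
    also have "\<dots> = sw H G x (\<lambda>b c. F a b c)"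
      by (rule sw_cong[OF G _ L_tt])
        (insert xa, auto intro!: bilin_cong[OF Fb2[of a] modH modH] simp: L_tt)
    finally show "?L (sw H ?TT x (\<lambda>b c. ?tt (?t a b) c)) = sw H G x (\<lambda>b c. F a b c)" .
  qed
  finally have 2: "?L (sw H ?TT h (\<lambda>a x. sw H ?TT x (\<lambda>b c. ?tt (?t a b) c))) = \<dots>" .
  show ?thesis using 1 2 coassoc[OF h] by simp
qed

lemma sw_counit_left:
  assumes G: "module R G" and L: "L \<in> linear_maps R H G" and h: "h \<in> carrier H"
  shows "sw H G h (\<lambda>a b. counit H a \<odot>\<^bsub>G\<^esub> L b) = L h"
proof -
  have "L (sw H H h (\<lambda>a b. counit H a \<odot>\<^bsub>H\<^esub> b)) = sw H G h (\<lambda>a b. L (counit H a \<odot>\<^bsub>H\<^esub> b))"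
    by (rule sw_lin[OF modH G _ L h]) (insert h, (assumption | rule lins)+)
  also have "\<dots> = sw H G h (\<lambda>a b. counit H a \<odot>\<^bsub>G\<^esub> L b)"
    by (rule sw_cong[OF G _ _ h], insert h)
      ((assumption | rule lins lin_compose[OF L])+, simp add: lin_smult[OF L] counit_closed)
  finally show ?thesis by (simp add: counit_left h)
qed

lemma sw_counit_right:
  assumes G: "module R G" and L: "L \<in> linear_maps R H G" and h: "h \<in> carrier H"
  shows "sw H G h (\<lambda>a b. counit H b \<odot>\<^bsub>G\<^esub> L a) = L h"
proof -
  have "L (sw H H h (\<lambda>a b. counit H b \<odot>\<^bsub>H\<^esub> a)) = sw H G h (\<lambda>a b. L (counit H b \<odot>\<^bsub>H\<^esub> a))"
    by (rule sw_lin[OF modH G _ L h]) (insert h, (assumption | rule lins)+)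
  also have "\<dots> = sw H G h (\<lambda>a b. counit H b \<odot>\<^bsub>G\<^esub> L a)"
    by (rule sw_cong[OF G _ _ h], insert h)
      ((assumption | rule lins lin_compose[OF L])+, simp add: lin_smult[OF L] counit_closed)
  finally show ?thesis by (simp add: counit_right h)
qed

section \<open>Operators indexed by the Hopf algebra\<close>

text \<open>
  A bilinear map \<open>m : M \<times> H \<rightarrow> M\<close> is regarded as an element of the convolution algebra of maps from
  \<open>H\<close> to the endomorphisms of \<open>M\<close>.  It acts on \<open>M \<otimes> H\<close> by \<open>x \<otimes> h \<mapsto> m x h\<^sub>(\<^sub>1\<^sub>) \<otimes> h\<^sub>(\<^sub>2\<^sub>)\<close>.
\<close>

definition twist :: "('r, 'm, 'y) module_scheme \<Rightarrow> ('m \<Rightarrow> 'h \<Rightarrow> 'm) \<Rightarrow>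
    ('m \<times> 'h \<Rightarrow>\<^sub>0 int) set \<Rightarrow> ('m \<times> 'h \<Rightarrow>\<^sub>0 int) set" where
  "twist M m = tensor_lift (tensor R M H) (\<lambda>x h. sw H (tensor R M H) h (\<lambda>a b. tens R M H (m x a) b))"

definition op_conv :: "('r, 'm, 'y) module_scheme \<Rightarrow> ('m \<Rightarrow> 'h \<Rightarrow> 'm) \<Rightarrow> ('m \<Rightarrow> 'h \<Rightarrow> 'm) \<Rightarrow> 'm \<Rightarrow> 'h \<Rightarrow> 'm" where
  "op_conv M m n x h = sw H M h (\<lambda>a b. n (m x a) b)"

context
  fixes M :: "('r, 'm, 'y) module_scheme" and m :: "'m \<Rightarrow> 'h \<Rightarrow> 'm"
  assumes M: "module R M" and m: "m \<in> bilinear_maps R M H M"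
begin

lemma twist_bilinear:
  "(\<lambda>x h. sw H (tensor R M H) h (\<lambda>a b. tens R M H (m x a) b)) \<in> bilinear_maps R M H (tensor R M H)"
  by (insert M m, (assumption | rule lins bilin_app1[OF m] bilin_app2[OF m] bilin_closed[OF m])+)

lemma twist_linear: "twist M m \<in> linear_maps R (tensor R M H) (tensor R M H)"
  unfolding twist_def by (rule lift_linear[OF M modH tensor_is_module[OF M modH] twist_bilinear])

lemma twist_tens: "x \<in> carrier M \<Longrightarrow> h \<in> carrier H \<Longrightarrow>
    twist M m (tens R M H x h) = sw H (tensor R M H) h (\<lambda>a b. tens R M H (m x a) b)"
  unfolding twist_def by (rule lift_tens[OF M modH tensor_is_module[OF M modH] twist_bilinear])

end

lemma op_conv_bilinear:
  assumes M: "module R M" and m: "m \<in> bilinear_maps R M H M" and n: "n \<in> bilinear_maps R M H M"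
  shows "op_conv M m n \<in> bilinear_maps R M H M"
  unfolding op_conv_def
  by (insert M m, (assumption | rule lins bilin_app1[OF m] bilin_app2[OF m] bilin_closed[OF m]
     bilin_app1[OF n] bilin_app2[OF n] bilin_closed[OF n])+)

text \<open>
  This is coassociativity.  It turns invertibility of twisting maps into convolution invertibility
  of the operators, which can be checked one factor at a time.
\<close>

lemma twist_op_conv:
  assumes M: "module R M" and m: "m \<in> bilinear_maps R M H M" and n: "n \<in> bilinear_maps R M H M"
    and z: "z \<in> carrier (tensor R M H)"
  shows "twist M (op_conv M m n) z = twist M n (twist M m z)"
proof -
  let ?T = "tensor R M H" and ?t = "tens R M H"
  note T = tensor_is_module[OF M modH]
  note mn = op_conv_bilinear[OF M m n]
  note rules = lins bilin_app1[OF m] bilin_app2[OF m] bilin_closed[OF m]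
     bilin_app1[OF n] bilin_app2[OF n] bilin_closed[OF n] lin_compose[OF twist_linear[OF M n]]
  show ?thesis
  proof (rule lin_ext[OF M modH T twist_linear[OF M mn]
        lin_compose[OF twist_linear[OF M n] twist_linear[OF M m]] _ z])
    fix x h assume xh: "x \<in> carrier M" "h \<in> carrier H"
    have "twist M n (twist M m (?t x h)) = sw H ?T h (\<lambda>a b. twist M n (?t (m x a) b))"
      unfolding twist_tens[OF M m xh]
      by (rule sw_lin[OF T T _ twist_linear[OF M n] xh(2)]) (insert M xh, (assumption | rule rules)+)
    also have "\<dots> = sw H ?T h (\<lambda>a x'. sw H ?T x' (\<lambda>b c. ?t (n (m x a) b) c))"
      by (rule sw_cong[OF T _ _ xh(2)], insert M xh T)
        ((assumption | rule rules)+, simp add: twist_tens[OF M n] bilin_closed[OF m])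
    also have "\<dots> = sw H ?T h (\<lambda>x' c. sw H ?T x' (\<lambda>a b. ?t (n (m x a) b) c))"
      by (rule sw_coassoc[symmetric]; insert M xh T) ((assumption | rule rules)+)
    also have "\<dots> = sw H ?T h (\<lambda>x' c. ?t (op_conv M m n x x') c)"
    proof (rule sw_cong[OF T _ _ xh(2)])
      show "(\<lambda>x' c. sw H ?T x' (\<lambda>a b. ?t (n (m x a) b) c)) \<in> bilinear_maps R H H ?T"
        by (insert M xh T, (assumption | rule rules)+)
      fix a b assume ab: "a \<in> carrier H" "b \<in> carrier H"
      show "sw H ?T a (\<lambda>a c. ?t (n (m x a) c) b) = ?t (op_conv M m n x a) b"
        unfolding op_conv_def
        by (rule sw_lin[symmetric, where L = "\<lambda>y. ?t y b"]; insert M xh T ab)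
         (assumption | rule rules)+
    qed
    also have "\<dots> = twist M (op_conv M m n) (?t x h)"
      by (rule twist_tens[OF M mn xh, symmetric])
    finally show "twist M (op_conv M m n) (?t x h) = twist M n (twist M m (?t x h))" ..
  qed
qed

lemma twist_counit:
  assumes M: "module R M" and m: "m \<in> bilinear_maps R M H M"
    and eps: "\<And>x h. x \<in> carrier M \<Longrightarrow> h \<in> carrier H \<Longrightarrow> m x h = counit H h \<odot>\<^bsub>M\<^esub> x"
    and z: "z \<in> carrier (tensor R M H)"
  shows "twist M m z = z"
proof -
  let ?T = "tensor R M H" and ?t = "tens R M H"
  note T = tensor_is_module[OF M modH]
  interpret M': module R M by fact
  show ?thesis
  proof (rule lin_ext[OF M modH T twist_linear[OF M m] lin_id _ z])
    fix x h assume xh: "x \<in> carrier M" "h \<in> carrier H"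
    have "twist M m (?t x h) = sw H ?T h (\<lambda>a b. ?t (m x a) b)"
      by (rule twist_tens[OF M m xh])
    also have "\<dots> = sw H ?T h (\<lambda>a b. counit H a \<odot>\<^bsub>?T\<^esub> ?t x b)"
      by (rule sw_cong[OF T _ _ xh(2)], insert M xh T)
       ((assumption | rule lins bilin_app2[OF m] bilin_closed[OF m])+,
        simp add: eps tens_smult_left[OF M modH] counit_closed)
    also have "\<dots> = ?t x h"
      by (rule sw_counit_left[OF T _ xh(2)], insert M xh) (assumption | rule lins)+
    finally show "twist M m (?t x h) = ?t x h" .
  qed
qed

lemma twist_inverse:
  assumes M: "module R M" and m: "m \<in> bilinear_maps R M H M" and n: "n \<in> bilinear_maps R M H M"
    and inv: "\<And>x h. x \<in> carrier M \<Longrightarrow> h \<in> carrier H \<Longrightarrow> op_conv M m n x h = counit H h \<odot>\<^bsub>M\<^esub> x"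
    and z: "z \<in> carrier (tensor R M H)"
  shows "twist M n (twist M m z) = z"
  using twist_counit[OF M op_conv_bilinear[OF M m n] inv z] twist_op_conv[OF M m n z] by simp

text \<open>
  Equivariance only has to be checked before tensoring with \<open>H\<close>; this is how identities in
  \<open>A \<otimes> Q \<otimes> H\<close> are reduced to identities in \<open>A \<otimes> Q\<close>.
\<close>

lemma twist_intertwine:
  assumes M: "module R M" and m: "m \<in> bilinear_maps R M H M"
    and N: "module R N" and n: "n \<in> bilinear_maps R N H N"
    and D: "D \<in> linear_maps R M N"
    and Dm: "\<And>x h. x \<in> carrier M \<Longrightarrow> h \<in> carrier H \<Longrightarrow> D (m x h) = n (D x) h"
    and z: "z \<in> carrier (tensor R M H)"
  shows "tensor_lift (tensor R N H) (\<lambda>x h. tens R N H (D x) h) (twist M m z) =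
    twist N n (tensor_lift (tensor R N H) (\<lambda>x h. tens R N H (D x) h) z)"
proof -
  let ?T = "tensor R M H" and ?t = "tens R M H" and ?T' = "tensor R N H" and ?t' = "tens R N H"
  note T = tensor_is_module[OF M modH]
  note T' = tensor_is_module[OF N modH]
  have b: "(\<lambda>x h. ?t' (D x) h) \<in> bilinear_maps R M H ?T'"
    by (insert N, (assumption | rule lins lin_compose[OF D] D lin_closed[OF D])+)
  note L = lift_linear[OF M modH T' b]
  note rules = lins bilin_app2[OF m] bilin_closed[OF m] bilin_app2[OF n] bilin_closed[OF n]
     lin_compose[OF D] lin_closed[OF D] lin_compose[OF L]
  show ?thesis
  proof (rule lin_ext[OF M modH T' lin_compose[OF L twist_linear[OF M m]]
        lin_compose[OF twist_linear[OF N n] L] _ z])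
    fix x h assume xh: "x \<in> carrier M" "h \<in> carrier H"
    let ?L = "tensor_lift ?T' (\<lambda>x h. ?t' (D x) h)"
    have "?L (twist M m (?t x h)) = sw H ?T' h (\<lambda>a b. ?L (?t (m x a) b))"
      unfolding twist_tens[OF M m xh]
      by (rule sw_lin[OF T T' _ L xh(2)]) (insert M xh T, (assumption | rule rules)+)
    also have "\<dots> = sw H ?T' h (\<lambda>a b. ?t' (n (D x) a) b)"
      by (rule sw_cong[OF T' _ _ xh(2)], insert M N T xh T' )
        ((assumption | rule rules)+, simp add: lift_tens[OF M modH T' b] bilin_closed[OF m] Dm)
    also have "\<dots> = twist N n (?L (?t x h))"
      using xh by (simp add: lift_tens[OF M modH T' b] twist_tens[OF N n] lin_closed[OF D])
    finally show "?L (twist M m (?t x h)) = twist N n (?L (?t x h))" .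
  qed
qed

end

section \<open>Quotient modules\<close>

lemma (in abelian_group) diff_zero_iff:
  assumes "x \<in> carrier G" "y \<in> carrier G" shows "x \<ominus> y = \<zero> \<longleftrightarrow> x = y"
proof
  assume "x \<ominus> y = \<zero>"
  then have "\<ominus> (\<ominus> y) = x" using assms by (intro minus_equality) (auto simp: minus_eq)
  then show "x = y" using assms by simp
qed (use assms in \<open>simp add: minus_eq r_neg\<close>)

context
  fixes R :: "('r, 'k) ring_scheme" and M :: "('r, 'm, 'x) module_scheme" and I
  assumes M: "module R M" and I: "submodule I R M"
begin

interpretation M: module R M by (rule M)

lemma quot_abelian_subgroup: "abelian_subgroup I M"
  using submodule.axioms(1)[OF I] M.abelian_group_axioms
  by (intro abelian_subgroupI3 additive_subgroupI)

interpretation I: abelian_subgroup I M by (rule quot_abelian_subgroup)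

lemma quot_carrier: "carrier (quot_module M I) = (\<lambda>x. I +>\<^bsub>M\<^esub> x) ` carrier M"
  by (auto simp: quot_module_def A_RCOSETS_def')

lemma quot_add: "x \<in> carrier M \<Longrightarrow> y \<in> carrier M \<Longrightarrow>
    (I +>\<^bsub>M\<^esub> x) \<oplus>\<^bsub>quot_module M I\<^esub> (I +>\<^bsub>M\<^esub> y) = I +>\<^bsub>M\<^esub> (x \<oplus>\<^bsub>M\<^esub> y)"
  by (simp add: quot_module_def I.a_rcos_sum)

lemma quot_eq_iff:
  assumes "x \<in> carrier M" "y \<in> carrier M"
  shows "I +>\<^bsub>M\<^esub> x = I +>\<^bsub>M\<^esub> y \<longleftrightarrow> x \<ominus>\<^bsub>M\<^esub> y \<in> I"
  using I.a_rcos_module[of y x] I.a_rcos_self[of x] I.a_repr_independence'[of x y] assms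
  by (auto simp: M.minus_eq)

lemma quot_zero: "\<zero>\<^bsub>quot_module M I\<^esub> = I +>\<^bsub>M\<^esub> \<zero>\<^bsub>M\<^esub>"
  using M.a_coset_add_zero[OF I.a_subset] by (simp add: quot_module_def)

lemma quot_smult:
  assumes r: "r \<in> carrier R" and x: "x \<in> carrier M"
  shows "r \<odot>\<^bsub>quot_module M I\<^esub> (I +>\<^bsub>M\<^esub> x) = I +>\<^bsub>M\<^esub> (r \<odot>\<^bsub>M\<^esub> x)"
proof -
  have "I +>\<^bsub>M\<^esub> (r \<odot>\<^bsub>M\<^esub> y) = I +>\<^bsub>M\<^esub> (r \<odot>\<^bsub>M\<^esub> x)" if y: "y \<in> I +>\<^bsub>M\<^esub> x" for y
  proof -
    obtain i where i: "i \<in> I" "y = i \<oplus>\<^bsub>M\<^esub> x" using y by (auto simp: a_r_coset_def')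
    have iM: "i \<in> carrier M" using i I.a_subset by auto
    have "r \<odot>\<^bsub>M\<^esub> y \<ominus>\<^bsub>M\<^esub> r \<odot>\<^bsub>M\<^esub> x = r \<odot>\<^bsub>M\<^esub> i"
      using r x iM by (simp add: i M.smult_r_distr M.minus_eq M.a_assoc M.r_neg)
    then show ?thesis using submodule.smult_closed[OF I r i(1)] i iM r x by (subst quot_eq_iff) auto
  qed
  moreover have "I +>\<^bsub>M\<^esub> x \<noteq> {}" using I.a_rcos_self[OF x] by blast
  ultimately have "(\<Union>y\<in>I +>\<^bsub>M\<^esub> x. I +>\<^bsub>M\<^esub> (r \<odot>\<^bsub>M\<^esub> y)) = I +>\<^bsub>M\<^esub> (r \<odot>\<^bsub>M\<^esub> x)"
    by (rule SUP_eq_const[rotated])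
  then show ?thesis by (simp add: quot_module_def)
qed

lemma quot_is_module: "module R (quot_module M I)"
proof (rule moduleI)
  let ?Q = "quot_module M I"
  show "abelian_group ?Q"
  proof (rule abelian_groupI)
    show "\<exists>y\<in>carrier ?Q. y \<oplus>\<^bsub>?Q\<^esub> x = \<zero>\<^bsub>?Q\<^esub>" if "x \<in> carrier ?Q" for x
    proof -
      obtain m where "m \<in> carrier M" "x = I +>\<^bsub>M\<^esub> m" using \<open>x \<in> carrier ?Q\<close> by (auto simp: quot_carrier)
      then show ?thesis by (intro bexI[of _ "I +>\<^bsub>M\<^esub> (\<ominus>\<^bsub>M\<^esub> m)"])
        (auto simp: quot_add quot_zero M.l_neg quot_carrier)
    qed
  qed (auto simp: quot_carrier quot_add quot_zero M.a_ac)
qed (auto simp: quot_carrier quot_add quot_smult M.smult_l_distr M.smult_r_distr M.smult_assoc1 M.is_cring)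

lemma quot_proj_linear: "(\<lambda>x. I +>\<^bsub>M\<^esub> x) \<in> linear_maps R M (quot_module M I)"
  by (intro linI) (auto simp: quot_carrier quot_add quot_smult)

end

lemma lin_sum:
  assumes "module R M" "module R N" "f \<in> linear_maps R M N" "finite I" "\<And>i. i \<in> I \<Longrightarrow> x i \<in> carrier M"
  shows "f (\<Oplus>\<^bsub>M\<^esub>i\<in>I. x i) = (\<Oplus>\<^bsub>N\<^esub>i\<in>I. f (x i))"
proof -
  interpret M: module R M by fact
  interpret N: module R N by fact
  show ?thesis using assms(4,5)
  proof (induction I rule: finite_induct)
    case empty
    then show ?case using lin_zero[OF assms(1-3)] by simp
  next
    case (insert i I)
    then show ?case using lin_closed[OF assms(3)] lin_add[OF assms(3)]
      by (subst M.finsum_insert N.finsum_insert; (subst N.finsum_insert)?) (auto simp: Pi_iff)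
  qed
qed

lemma lin_sum_fun:
  assumes "module R N" "module R M" "finite I" "\<And>i. i \<in> I \<Longrightarrow> f i \<in> linear_maps R M N"
  shows "(\<lambda>x. \<Oplus>\<^bsub>N\<^esub>i\<in>I. f i x) \<in> linear_maps R M N"
proof -
  interpret N: module R N by fact
  interpret M: module R M by fact
  show ?thesis
  proof (rule linI)
    show "(\<Oplus>\<^bsub>N\<^esub>i\<in>I. f i x) \<in> carrier N" if "x \<in> carrier M" for x
      using lin_closed[OF assms(4)] that by (intro N.finsum_closed) auto
    show "(\<Oplus>\<^bsub>N\<^esub>i\<in>I. f i (x \<oplus>\<^bsub>M\<^esub> y)) = (\<Oplus>\<^bsub>N\<^esub>i\<in>I. f i x) \<oplus>\<^bsub>N\<^esub> (\<Oplus>\<^bsub>N\<^esub>i\<in>I. f i y)"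
      if "x \<in> carrier M" "y \<in> carrier M" for x y
    proof -
      have "(\<Oplus>\<^bsub>N\<^esub>i\<in>I. f i (x \<oplus>\<^bsub>M\<^esub> y)) = (\<Oplus>\<^bsub>N\<^esub>i\<in>I. f i x \<oplus>\<^bsub>N\<^esub> f i y)"
        using lin_closed[OF assms(4)] that by (intro N.finsum_cong') (auto simp: lin_add[OF assms(4)])
      also have "\<dots> = (\<Oplus>\<^bsub>N\<^esub>i\<in>I. f i x) \<oplus>\<^bsub>N\<^esub> (\<Oplus>\<^bsub>N\<^esub>i\<in>I. f i y)"
        using lin_closed[OF assms(4)] that by (intro N.finsum_addf) auto
      finally show ?thesis .
    qed
    show "(\<Oplus>\<^bsub>N\<^esub>i\<in>I. f i (r \<odot>\<^bsub>M\<^esub> x)) = r \<odot>\<^bsub>N\<^esub> (\<Oplus>\<^bsub>N\<^esub>i\<in>I. f i x)" if "r \<in> carrier R" "x \<in> carrier M" for r x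
    proof -
      have "r \<odot>\<^bsub>N\<^esub> (\<Oplus>\<^bsub>N\<^esub>i\<in>I. f i x) = (\<Oplus>\<^bsub>N\<^esub>i\<in>I. r \<odot>\<^bsub>N\<^esub> f i x)"
        using lin_closed[OF assms(4)] that
        by (intro lin_sum[OF assms(1,1) lin_smult_right[OF assms(1) lin_id] assms(3)]) auto
      also have "\<dots> = (\<Oplus>\<^bsub>N\<^esub>i\<in>I. f i (r \<odot>\<^bsub>M\<^esub> x))"
        using lin_closed[OF assms(4)] that by (intro N.finsum_cong') (auto simp: lin_smult[OF assms(4)])
      finally show ?thesis ..
    qed
  qed
qed

section \<open>Finitely generated test modules\<close>

definition free_module :: "('r, 'k) ring_scheme \<Rightarrow> nat \<Rightarrow> ('r, nat \<Rightarrow> 'r) module" where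
  "free_module R n = \<lparr>carrier = {f. (\<forall>i<n. f i \<in> carrier R) \<and> (\<forall>i\<ge>n. f i = \<zero>\<^bsub>R\<^esub>)},
     monoid.mult = undefined, monoid.one = undefined, ring.zero = (\<lambda>i. \<zero>\<^bsub>R\<^esub>),
     ring.add = (\<lambda>f g i. f i \<oplus>\<^bsub>R\<^esub> g i), smult = (\<lambda>r f i. r \<otimes>\<^bsub>R\<^esub> f i)\<rparr>"

definition unit_vec :: "('r, 'k) ring_scheme \<Rightarrow> nat \<Rightarrow> nat \<Rightarrow> 'r" where
  "unit_vec R i = (\<lambda>j. if j = i then \<one>\<^bsub>R\<^esub> else \<zero>\<^bsub>R\<^esub>)"

definition lin_comb :: "('r, 'm, 'x) module_scheme \<Rightarrow> nat \<Rightarrow> (nat \<Rightarrow> 'm) \<Rightarrow> (nat \<Rightarrow> 'r) \<Rightarrow> 'm" where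
  "lin_comb M n x \<alpha> = (\<Oplus>\<^bsub>M\<^esub>i\<in>{..<n}. \<alpha> i \<odot>\<^bsub>M\<^esub> x i)"

lemma free_module_coord: "cring R \<Longrightarrow> f \<in> carrier (free_module R n) \<Longrightarrow> f i \<in> carrier R"
  by (cases "i < n") (auto simp: free_module_def cring_def ring.ring_simprules)

lemma free_module_module:
  assumes "cring R" shows "module R (free_module R n)"
proof -
  let ?F = "free_module R n"
  interpret R: cring R by fact
  show ?thesis
  proof (rule moduleI)
    show "abelian_group ?F"
    proof (rule abelian_groupI)
      fix x assume x: "x \<in> carrier ?F"
      show "\<exists>y\<in>carrier ?F. y \<oplus>\<^bsub>?F\<^esub> x = \<zero>\<^bsub>?F\<^esub>"
        using x free_module_coord[OF assms x]
        by (intro bexI[of _ "\<lambda>i. \<ominus>\<^bsub>R\<^esub> x i"]) (auto simp: free_module_def R.l_neg)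
    next
      fix x y z assume x: "x \<in> carrier ?F" "y \<in> carrier ?F"
        "z \<in> carrier ?F"
      then show "x \<oplus>\<^bsub>?F\<^esub> y \<oplus>\<^bsub>?F\<^esub> z = x \<oplus>\<^bsub>?F\<^esub> (y \<oplus>\<^bsub>?F\<^esub> z)"
        using free_module_coord[OF assms x(1)] free_module_coord[OF assms x(2)] free_module_coord[OF assms x(3)]
        by (auto simp: free_module_def R.a_assoc)
    next
      fix x y assume x: "x \<in> carrier ?F" "y \<in> carrier ?F"
      then show "x \<oplus>\<^bsub>?F\<^esub> y = y \<oplus>\<^bsub>?F\<^esub> x"
        using free_module_coord[OF assms x(1)] free_module_coord[OF assms x(2)]
        by (auto simp: free_module_def R.a_comm)
    next
      fix x assume x: "x \<in> carrier ?F"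
      then show "\<zero>\<^bsub>?F\<^esub> \<oplus>\<^bsub>?F\<^esub> x = x"
        using free_module_coord[OF assms x(1)] by (auto simp: free_module_def)
    qed (auto simp: free_module_def)
    fix a b x y assume a: "a \<in> carrier R" "b \<in> carrier R" and x: "x \<in> carrier ?F" "y \<in> carrier ?F"
    show "(a \<oplus>\<^bsub>R\<^esub> b) \<odot>\<^bsub>?F\<^esub> x = a \<odot>\<^bsub>?F\<^esub> x \<oplus>\<^bsub>?F\<^esub> b \<odot>\<^bsub>?F\<^esub> x"
      using a free_module_coord[OF assms x(1)] by (auto simp: free_module_def R.l_distr)
    show "a \<odot>\<^bsub>?F\<^esub> (x \<oplus>\<^bsub>?F\<^esub> y) = a \<odot>\<^bsub>?F\<^esub> x \<oplus>\<^bsub>?F\<^esub> a \<odot>\<^bsub>?F\<^esub> y"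
      using a free_module_coord[OF assms x(1)] free_module_coord[OF assms x(2)] by (auto simp: free_module_def R.r_distr)
    show "(a \<otimes>\<^bsub>R\<^esub> b) \<odot>\<^bsub>?F\<^esub> x = a \<odot>\<^bsub>?F\<^esub> (b \<odot>\<^bsub>?F\<^esub> x)"
      using a free_module_coord[OF assms x(1)] by (auto simp: free_module_def R.m_assoc)
  next
    fix x assume x: "x \<in> carrier ?F"
    then show "\<one>\<^bsub>R\<^esub> \<odot>\<^bsub>?F\<^esub> x = x"
      using free_module_coord[OF assms x] by (auto simp: free_module_def)
  qed (auto simp: free_module_def assms)
qed

lemma unit_vec_closed: "cring R \<Longrightarrow> i < n \<Longrightarrow> unit_vec R i \<in> carrier (free_module R n)"
  by (auto simp: unit_vec_def free_module_def cring_def ring.ring_simprules)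

lemma lin_comb_linear:
  assumes "module R M" "\<And>i. i < n \<Longrightarrow> x i \<in> carrier M"
  shows "lin_comb M n x \<in> linear_maps R (free_module R n) M"
proof -
  interpret M: module R M by fact
  have "(\<lambda>\<alpha>. \<Oplus>\<^bsub>M\<^esub>i\<in>{..<n}. \<alpha> i \<odot>\<^bsub>M\<^esub> x i) \<in> linear_maps R (free_module R n) M"
    by (rule lin_sum_fun[OF assms(1) free_module_module[OF M.is_cring]])
     (auto intro!: linI simp: assms free_module_def M.smult_l_distr M.smult_assoc1)
  then show ?thesis by (simp add: lin_comb_def[abs_def])
qed

lemma lin_comb_unit_vec:
  assumes "module R M" "\<And>i. i < n \<Longrightarrow> x i \<in> carrier M" "i < n"
  shows "lin_comb M n x (unit_vec R i) = x i"
proof -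
  interpret M: module R M by fact
  have "lin_comb M n x (unit_vec R i) = (\<Oplus>\<^bsub>M\<^esub>j\<in>{..<n}. if i = j then x j else \<zero>\<^bsub>M\<^esub>)"
    unfolding lin_comb_def using assms
    by (intro M.finsum_cong') (auto simp: unit_vec_def M.smult_l_null)
  also have "\<dots> = x i"
    using M.finsum_singleton[of i "{..<n}" x] assms by auto
  finally show ?thesis .
qed

lemma kernel_submodule:
  assumes "module R M" "module R N" "f \<in> linear_maps R M N"
  shows "submodule {x \<in> carrier M. f x = \<zero>\<^bsub>N\<^esub>} R M"
proof -
  interpret M: module R M by fact
  interpret N: module R N by fact
  show ?thesis
    by (rule M.submoduleI) (auto simp: lin_zero[OF assms] lin_minus[OF assms] lin_add[OF assms(3)] lin_smult[OF assms(3)])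
qed

lemma submodule_module: "module R M \<Longrightarrow> submodule S R M \<Longrightarrow> module R (M\<lparr>carrier := S\<rparr>)"
  by (rule submodule.submodule_is_module)

text \<open>
  Flatness speaks only about modules whose elements are sets of functions \<open>nat \<Rightarrow> 'r\<close>.  A submodule
  of \<open>N\<close> generated by finitely many elements \<open>x\<^sub>0, \<dots>, x\<^sub>n\<^sub>-\<^sub>1\<close> is the quotient of \<open>R\<^sup>n\<close> by the relations
  between them, and the elements of that quotient are cosets, hence of the required type.
\<close>

lemma fg_test_copy:
  fixes R :: "('r, 'k) ring_scheme" and N :: "('r, 'n, 'x) module_scheme"
  assumes N: "module R N" and X: "finite X" "X \<subseteq> carrier N"
  shows "\<exists>(N' :: ('r, 'r test) module) e. module R N' \<and> e \<in> linear_maps R N' N \<and>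
     inj_on e (carrier N') \<and> X \<subseteq> e ` carrier N'"
proof -
  interpret N: module R N by fact
  obtain n x where X': "X = x ` {..<n::nat}" using X(1) finite_imp_nat_seg_image_inj_on[of X]
    by (auto simp: lessThan_def)
  let ?F = "free_module R n" and ?f = "lin_comb N n x"
  note F = free_module_module[OF N.is_cring, of n]
  have x: "\<And>i. i < n \<Longrightarrow> x i \<in> carrier N" using X X' by auto
  note f = lin_comb_linear[of R N n x, OF N x]
  define K where "K = {\<alpha> \<in> carrier ?F. ?f \<alpha> = \<zero>\<^bsub>N\<^esub>}"
  have K: "submodule K R ?F" unfolding K_def by (rule kernel_submodule[OF F N f])
  let ?Q = "quot_module ?F K"
  note Q = quot_is_module[OF F K]
  define e where "e X = ?f (SOME \<alpha>. \<alpha> \<in> carrier ?F \<and> X = K +>\<^bsub>?F\<^esub> \<alpha>)" for X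
  interpret F: module R ?F by (rule F)
  have eq: "K +>\<^bsub>?F\<^esub> \<alpha> = K +>\<^bsub>?F\<^esub> \<beta> \<longleftrightarrow> ?f \<alpha> = ?f \<beta>"
    if "\<alpha> \<in> carrier ?F" "\<beta> \<in> carrier ?F" for \<alpha> \<beta>
  proof -
    have "?f (\<alpha> \<ominus>\<^bsub>?F\<^esub> \<beta>) = ?f \<alpha> \<ominus>\<^bsub>N\<^esub> ?f \<beta>"
      using that by (simp add: F.minus_eq N.minus_eq lin_add[OF f] lin_minus[OF F N f])
    then have "\<alpha> \<ominus>\<^bsub>?F\<^esub> \<beta> \<in> K \<longleftrightarrow> ?f \<alpha> = ?f \<beta>"
      using that lin_closed[OF f] by (simp add: K_def N.diff_zero_iff)
    then show ?thesis using quot_eq_iff[OF F K that] by simp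
  qed
  have e: "e (K +>\<^bsub>?F\<^esub> \<alpha>) = ?f \<alpha>" if "\<alpha> \<in> carrier ?F" for \<alpha>
    unfolding e_def by (rule someI2[of _ \<alpha>]) (use that eq in auto)
  have "e \<in> linear_maps R ?Q N"
    by (rule linI) (auto simp: quot_carrier[OF F K] quot_add[OF F K] quot_smult[OF F K] e lin_closed[OF f]
      lin_add[OF f] lin_smult[OF f])
  moreover have "inj_on e (carrier ?Q)"
    by (auto simp: inj_on_def quot_carrier[OF F K] e eq)
  moreover have "X \<subseteq> e ` carrier ?Q"
  proof
    fix y assume "y \<in> X"
    then obtain i where i: "i < n" "y = x i" using X' by auto
    then have "y = e (K +>\<^bsub>?F\<^esub> unit_vec R i)"
      using lin_comb_unit_vec[OF N x] unit_vec_closed[OF N.is_cring] by (simp add: e)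
    then show "y \<in> e ` carrier ?Q" using i unit_vec_closed[OF N.is_cring] by (auto simp: quot_carrier[OF F K])
  qed
  ultimately show ?thesis using Q by blast
qed

section \<open>Vanishing of a tensor is a finite condition\<close>

definition pull_back :: "('n, 'y) ring_scheme \<Rightarrow> ('n \<Rightarrow> 'm) \<Rightarrow> 'm \<Rightarrow> 'n" where
  "pull_back N e x = (if x \<in> e ` carrier N then inv_into (carrier N) e x else \<zero>\<^bsub>N\<^esub>)"


text \<open>
  Here \<open>N'\<close> is a copy of a submodule of \<open>N\<close>, embedded by \<open>e\<close>.  Pulling back along \<open>e\<close> is meaningful
  on the image only; the value \<open>\<zero>\<close> elsewhere merely keeps the map total.  A defining relation of
  \<open>N \<otimes> H\<close> is therefore carried to a true relation as soon as the elements of \<open>N\<close> that occur in it lie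
  in the image.
\<close>

locale pulled_back = N: module R N + H: module R H + N': module R N'
  for R :: "('r, 'k) ring_scheme" and N :: "('r, 'n, 'x) module_scheme" and H :: "('r, 'h, 'y) module_scheme"
    and N' :: "('r, 'p, 'z) module_scheme" and e +
  assumes e: "e \<in> linear_maps R N' N" and e_inj: "inj_on e (carrier N')"
begin

sublocale tensor_module R "carrier R" "\<lambda>x r. r \<odot>\<^bsub>N\<^esub> x" "\<lambda>r y. r \<odot>\<^bsub>H\<^esub> y" N H
  by (rule tensor_module_base) unfold_locales

sublocale T: module R "tensor R H N'"
  by (rule tensor_is_module) unfold_locales

abbreviation "HN \<equiv> tensor R H N'"

definition "pull x h = tens R H N' h (pull_back N' e x)"

lemma pull_back_closed: "pull_back N' e x \<in> carrier N'"
  by (auto simp: pull_back_def inv_into_into)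

lemma pull_closed: "h \<in> carrier H \<Longrightarrow> pull x h \<in> carrier HN"
  unfolding pull_def by (rule tens_closed[OF H.module_axioms N'.module_axioms _ pull_back_closed])

lemma pull_keys: "d \<in> carrier free \<Longrightarrow> p \<in> Poly_Mapping.keys d \<Longrightarrow> pull (fst p) (snd p) \<in> carrier HN"
  by (rule pull_closed) (auto dest!: subsetD)

lemma e_pull_back: "x \<in> e ` carrier N' \<Longrightarrow> e (pull_back N' e x) = x"
  by (simp add: pull_back_def f_inv_into_f)

lemma pull_sum_add: "a \<in> carrier free \<Longrightarrow> b \<in> carrier free \<Longrightarrow>
    frag_sum HN pull (a + b) =
    frag_sum HN pull a \<oplus>\<^bsub>HN\<^esub> frag_sum HN pull b"
  by (rule T.frag_sum_add) (use pull_keys in blast)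

lemma pull_sum_diff: "a \<in> carrier free \<Longrightarrow> b \<in> carrier free \<Longrightarrow>
    frag_sum HN pull (a - b) =
    frag_sum HN pull a \<ominus>\<^bsub>HN\<^esub> frag_sum HN pull b"
  by (rule T.frag_sum_diff) (use pull_keys in blast)

lemma pull_sum_minus: "a \<in> carrier free \<Longrightarrow>
    frag_sum HN pull (- a) = \<ominus>\<^bsub>HN\<^esub> frag_sum HN pull a"
  by (rule T.frag_sum_minus) (use pull_keys in blast)

lemma pull_sum_of: "h \<in> carrier H \<Longrightarrow> frag_sum HN pull (frag_of (x, h)) = pull x h"
  by (rule T.frag_sum_of) (rule pull_closed)

lemma pull_sum_0: "frag_sum HN pull 0 = \<zero>\<^bsub>HN\<^esub>"
  by (rule T.frag_sum_0)

lemmas pull_sums = pull_sum_diff pull_sum_of frag_free frag_free_diff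

lemma pull_rel_left:
  assumes "x \<in> carrier N" "x' \<in> carrier N" "y \<in> carrier H" "{x, x', x \<oplus>\<^bsub>N\<^esub> x'} \<subseteq> e ` carrier N'"
  shows "frag_sum HN pull (frag_of (x \<oplus>\<^bsub>N\<^esub> x', y) - frag_of (x, y) - frag_of (x', y)) = \<zero>\<^bsub>HN\<^esub>"
proof -
  have "pull_back N' e (x \<oplus>\<^bsub>N\<^esub> x') = pull_back N' e x \<oplus>\<^bsub>N'\<^esub> pull_back N' e x'"
    by (rule inj_onD[OF e_inj]) (use assms in \<open>auto simp: e_pull_back lin_add[OF e] pull_back_closed\<close>)
  then have "pull (x \<oplus>\<^bsub>N\<^esub> x') y = pull x y \<oplus>\<^bsub>HN\<^esub> pull x' y"
    unfolding pull_def
    using lin_add[OF bilin1[OF tens_bilinear[OF H.module_axioms N'.module_axioms] assms(3)]] pull_back_closed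
    by simp
  then show ?thesis using assms by (simp add: pull_sums T.sum_diff_diff pull_closed del: carrier_free_Abelian_group_iff)
qed

lemma pull_rel_right:
  assumes "x \<in> carrier N" "y \<in> carrier H" "y' \<in> carrier H"
  shows "frag_sum HN pull (frag_of (x, y \<oplus>\<^bsub>H\<^esub> y') - frag_of (x, y) - frag_of (x, y')) = \<zero>\<^bsub>HN\<^esub>"
proof -
  have "pull x (y \<oplus>\<^bsub>H\<^esub> y') = pull x y \<oplus>\<^bsub>HN\<^esub> pull x y'"
    unfolding pull_def
    using lin_add[OF bilin2[OF tens_bilinear[OF H.module_axioms N'.module_axioms] pull_back_closed]] assms
    by simp
  then show ?thesis using assms by (simp add: pull_sums T.sum_diff_diff pull_closed del: carrier_free_Abelian_group_iff)
qed

lemma pull_rel_balanced: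
  assumes "x \<in> carrier N" "t \<in> carrier R" "y \<in> carrier H" "{x, t \<odot>\<^bsub>N\<^esub> x} \<subseteq> e ` carrier N'"
  shows "frag_sum HN pull (frag_of (t \<odot>\<^bsub>N\<^esub> x, y) - frag_of (x, t \<odot>\<^bsub>H\<^esub> y)) = \<zero>\<^bsub>HN\<^esub>"
proof -
  have "pull_back N' e (t \<odot>\<^bsub>N\<^esub> x) = t \<odot>\<^bsub>N'\<^esub> pull_back N' e x"
    by (rule inj_onD[OF e_inj]) (use assms in \<open>auto simp: e_pull_back lin_smult[OF e] pull_back_closed\<close>)
  then have "pull (t \<odot>\<^bsub>N\<^esub> x) y = pull x (t \<odot>\<^bsub>H\<^esub> y)"
    unfolding pull_def using assms pull_back_closed
    by (simp add: tens_smult_left[OF H.module_axioms N'.module_axioms] tens_smult_right[OF H.module_axioms N'.module_axioms])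
  then show ?thesis using assms by (simp add: pull_sums T.diff_zero_iff pull_closed del: carrier_free_Abelian_group_iff)
qed

end

text \<open>
  A formal sum that represents zero is a finite combination of defining relations.  These mention
  only finitely many elements of \<open>N\<close>, and the sum already represents zero over every submodule that
  contains them.
\<close>

lemma tensor_vanishes_finitely:
  fixes R :: "('r, 'k) ring_scheme" and N :: "('r, 'n, 'x) module_scheme" and H :: "('r, 'h, 'y) module_scheme"
  assumes N: "module R N" and H: "module R H"
    and c: "c \<in> bal_null (carrier R) (\<lambda>x r. r \<odot>\<^bsub>N\<^esub> x) (\<lambda>r y. r \<odot>\<^bsub>H\<^esub> y) N H"
  shows "\<exists>X. finite X \<and> X \<subseteq> carrier N \<and> (\<forall>(N' :: ('r, 'r test) module) e. pulled_back R N H N' e \<longrightarrow>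
     X \<subseteq> e ` carrier N' \<longrightarrow>
     frag_sum (tensor R H N') (pulled_back.pull R H N' e) c = \<zero>\<^bsub>tensor R H N'\<^esub>)"
    (is "\<exists>X. finite X \<and> X \<subseteq> carrier N \<and> ?P X c")
proof -
  interpret N: module R N by fact
  interpret H: module R H by fact
  interpret tensor_module R "carrier R" "\<lambda>x r. r \<odot>\<^bsub>N\<^esub> x" "\<lambda>r y. r \<odot>\<^bsub>H\<^esub> y" N H
    by (rule tensor_module_base; fact)
  have rel: "\<exists>X. finite X \<and> X \<subseteq> carrier N \<and> ?P X c" if "c \<in> rels" for c
  proof -
    from that show ?thesis
    proof (cases rule: rels_cases)
      case (left x x' y)
      then show ?thesis
        by (intro exI[of _ "{x, x', x \<oplus>\<^bsub>N\<^esub> x'}"]) (simp add: pulled_back.pull_rel_left)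
    next
      case (right x y y')
      then show ?thesis
        by (intro exI[of _ "{}"]) (simp add: pulled_back.pull_rel_right)
    next
      case (balanced x t y)
      then show ?thesis
        by (intro exI[of _ "{x, t \<odot>\<^bsub>N\<^esub> x}"]) (simp add: pulled_back.pull_rel_balanced)
    qed
  qed
  show ?thesis
    using c unfolding bal_null_def
  proof (induction rule: generate.induct)
    case one
    show ?case by (intro exI[of _ "{}"]) (simp add: pulled_back.pull_sum_0)
  next
    case (incl h) then show ?case by (rule rel)
  next
    case (inv h)
    from rel[OF inv] obtain X where X: "finite X" "X \<subseteq> carrier N" "?P X h" by (elim exE conjE) (rule that)
    have h: "h \<in> carrier free" using inv rels_carrier by blast
    have "?P X (- h)"
    proof (intro allI impI)
      fix N' :: "('r, 'r test) module" and e
      assume "pulled_back R N H N' e" and X': "X \<subseteq> e ` carrier N'"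
      then interpret P: pulled_back R N H N' e by simp
      show "frag_sum (tensor R H N') P.pull (- h) = \<zero>\<^bsub>tensor R H N'\<^esub>"
        using X(3)[rule_format, OF P.pulled_back_axioms X'] by (simp add: P.pull_sum_minus[OF h])
    qed
    then show ?case using X h by (intro exI[of _ X]) (simp add: inv_free_Abelian_group)
  next
    case (eng h1 h2)
    then have h: "h1 \<in> carrier free" "h2 \<in> carrier free"
      using free.generate_in_carrier[OF rels_carrier] by auto
    from eng.IH(1) obtain X where X: "finite X" "X \<subseteq> carrier N" "?P X h1" by (elim exE conjE) (rule that)
    from eng.IH(2) obtain Y where Y: "finite Y" "Y \<subseteq> carrier N" "?P Y h2" by (elim exE conjE) (rule that)
    have "?P (X \<union> Y) (h1 + h2)"
    proof (intro allI impI)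
      fix N' :: "('r, 'r test) module" and e
      assume "pulled_back R N H N' e" and X': "X \<union> Y \<subseteq> e ` carrier N'"
      then interpret P: pulled_back R N H N' e by simp
      show "frag_sum (tensor R H N') P.pull (h1 + h2) = \<zero>\<^bsub>tensor R H N'\<^esub>"
        using X(3)[rule_format, OF P.pulled_back_axioms] Y(3)[rule_format, OF P.pulled_back_axioms] X'
        by (simp add: P.pull_sum_add[OF h])
    qed
    then show ?case using X Y by (intro exI[of _ "X \<union> Y"]) simp
  qed
qed

lemma (in abelian_group) finsum_lessThan_Suc:
  assumes "\<And>i. i \<le> n \<Longrightarrow> f i \<in> carrier G"
  shows "(\<Oplus>i\<in>{..<Suc n}. f i) = (\<Oplus>i\<in>{..<n}. f i) \<oplus> f n"
  using assms by (simp add: lessThan_Suc a_comm)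

lemma tensor_sum_rep:
  assumes M: "module R M" and N: "module R N" and z: "z \<in> carrier (tensor R M N)"
  shows "\<exists>n x y. (\<forall>i<n::nat. x i \<in> carrier M \<and> y i \<in> carrier N) \<and>
     z = (\<Oplus>\<^bsub>tensor R M N\<^esub>i\<in>{..<n}. tens R M N (x i) (y i))"
proof -
  let ?T = "tensor R M N"
  interpret T: module R "?T" by (rule tensor_is_module[OF M N])
  define S where "S l = (\<Oplus>\<^bsub>?T\<^esub>i\<in>{..<length l}. tens R M N (fst (l ! i)) (snd (l ! i)))" for l
  have cl: "tens R M N (fst p) (snd p) \<in> carrier ?T" if "p \<in> carrier M \<times> carrier N" for p
    using that by (auto intro: tens_closed[OF M N])
  have Scl: "S l \<in> carrier ?T" if "set l \<subseteq> carrier M \<times> carrier N" for l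
    unfolding S_def using that by (intro T.finsum_closed) (auto intro!: cl dest!: subsetD[OF _ nth_mem])
  have S_snoc: "S (l @ [p]) = S l \<oplus>\<^bsub>?T\<^esub> tens R M N (fst p) (snd p)"
    if "set l \<subseteq> carrier M \<times> carrier N" "p \<in> carrier M \<times> carrier N" for l p
  proof -
    let ?f = "\<lambda>l i. tens R M N (fst (l ! i)) (snd (l ! i))"
    have f: "?f (l @ [p]) i \<in> carrier ?T" if "i \<le> length l" for i
      using that \<open>set l \<subseteq> _\<close> \<open>p \<in> _\<close> by (intro cl) (auto simp: nth_append dest!: subsetD[OF _ nth_mem])
    have "S (l @ [p]) = (\<Oplus>\<^bsub>?T\<^esub>i\<in>{..<length l}. ?f (l @ [p]) i) \<oplus>\<^bsub>?T\<^esub> ?f (l @ [p]) (length l)"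
      unfolding S_def using T.finsum_lessThan_Suc[OF f] by simp
    also have "(\<Oplus>\<^bsub>?T\<^esub>i\<in>{..<length l}. ?f (l @ [p]) i) = S l"
      unfolding S_def using that(1)
      by (intro T.finsum_cong') (auto simp: nth_append intro!: cl dest!: subsetD[OF _ nth_mem])
    finally show ?thesis by simp
  qed
  have app: "S (l @ l') = S l \<oplus>\<^bsub>?T\<^esub> S l'"
    if "set l \<subseteq> carrier M \<times> carrier N" "set l' \<subseteq> carrier M \<times> carrier N" for l l'
    using that(2)
  proof (induction l' rule: rev_induct)
    case Nil
    then show ?case using Scl[OF that(1)] by (simp add: S_def[of "[]"])
  next
    case (snoc p l')
    then have "S (l @ l' @ [p]) = S (l @ l') \<oplus>\<^bsub>?T\<^esub> tens R M N (fst p) (snd p)"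
      using S_snoc[of "l @ l'" p] that(1) by simp
    then show ?case using snoc S_snoc[of l' p] Scl[OF that(1)] Scl[of l'] cl[of p]
      by (simp add: T.a_assoc)
  qed
  have "\<exists>l. set l \<subseteq> carrier M \<times> carrier N \<and> z = S l"
    using M N z
  proof (induction rule: tens_induct)
    case zero
    show ?case by (intro exI[of _ "[]"]) (simp add: S_def)
  next
    case (tens x y)
    have "S ([] @ [(x, y)]) = S [] \<oplus>\<^bsub>?T\<^esub> tens R M N x y"
      by (subst S_snoc) (use tens in auto)
    then have "S [(x, y)] = tens R M N x y"
      using cl[of "(x, y)"] tens by (simp add: S_def[of "[]"])
    then show ?case using tens by (intro exI[of _ "[(x, y)]"]) auto
  next
    case (add u v)
    then obtain l l' where "set l \<subseteq> carrier M \<times> carrier N" "u = S l" "set l' \<subseteq> carrier M \<times> carrier N" "v = S l'"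
      by blast
    then show ?case using app by (intro exI[of _ "l @ l'"]) auto
  qed
  then obtain l where l: "set l \<subseteq> carrier M \<times> carrier N" "z = S l" by blast
  then show ?thesis
    by (intro exI[of _ "length l"] exI[of _ "\<lambda>i. fst (l ! i)"] exI[of _ "\<lambda>i. snd (l ! i)"])
      (auto simp: S_def dest!: subsetD[OF _ nth_mem])
qed

lemma tensor_sum_vanishes_finitely:
  fixes R :: "('r, 'k) ring_scheme" and N :: "('r, 'n, 'x) module_scheme" and H :: "('r, 'h, 'y) module_scheme"
  assumes N: "module R N" and H: "module R H"
    and xh: "\<And>i. i < n \<Longrightarrow> x i \<in> carrier N" "\<And>i. i < n \<Longrightarrow> h i \<in> carrier H"
    and 0: "(\<Oplus>\<^bsub>tensor R N H\<^esub>i\<in>{..<n::nat}. tens R N H (x i) (h i)) = \<zero>\<^bsub>tensor R N H\<^esub>"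
  shows "\<exists>(N' :: ('r, 'r test) module) e u. module R N' \<and> e \<in> linear_maps R N' N \<and>
     (\<forall>i<n. u i \<in> carrier N' \<and> e (u i) = x i) \<and>
     (\<Oplus>\<^bsub>tensor R H N'\<^esub>i\<in>{..<n}. tens R H N' (h i) (u i)) = \<zero>\<^bsub>tensor R H N'\<^esub>"
proof -
  let ?T = "tensor R N H"
  interpret tensor_module R "carrier R" "\<lambda>x r. r \<odot>\<^bsub>N\<^esub> x" "\<lambda>r y. r \<odot>\<^bsub>H\<^esub> y" N H
    by (rule tensor_module_base; fact)
  define c where "c = (\<Sum>i<n. frag_of (x i, h i))"
  have ck: "(\<Sum>i<m. frag_of (x i, h i)) \<in> carrier free" if "m \<le> n" for m
    using that
  proof (induction m)
    case (Suc m)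
    then show ?case using frag_free_add[OF Suc.IH frag_free, of "x m" "h m"] xh by auto
  qed simp
  have sum: "(\<Oplus>\<^bsub>?T\<^esub>i\<in>{..<m}. tens R N H (x i) (h i)) = null #>\<^bsub>free\<^esub> (\<Sum>i<m. frag_of (x i, h i))"
    if "m \<le> n" for m
    using that
  proof (induction m)
    case 0
    interpret T: module R "?T" by (rule tensor_is_module; fact)
    show ?case using free.coset_mult_one[of null] null.subset
      unfolding lessThan_0 T.finsum_empty by (simp add: tensor_def TM_simps TG_simps)
  next
    case (Suc m)
    interpret T: module R "?T" by (rule tensor_is_module; fact)
    have "(\<Oplus>\<^bsub>?T\<^esub>i\<in>{..<Suc m}. tens R N H (x i) (h i)) =
       (null #>\<^bsub>free\<^esub> (\<Sum>i<m. frag_of (x i, h i))) \<oplus>\<^bsub>?T\<^esub> tens R N H (x m) (h m)"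
      by (subst T.finsum_lessThan_Suc) (use Suc xh in \<open>auto intro: tens_closed[OF N H]\<close>)
    also have "\<dots> = null #>\<^bsub>free\<^esub> (\<Sum>i<Suc m. frag_of (x i, h i))"
      using coset_add[OF ck frag_free, of m "x m" "h m"] Suc.prems xh
      by (simp add: tensor_def TM_simps tens_def bal_tens_def)
    finally show ?case .
  qed
  have "null #>\<^bsub>free\<^esub> c = null" using sum[of n] 0 by (simp add: c_def tensor_def TM_simps TG_simps)
  then have "c \<in> null" using free.rcos_self[OF ck null_subgroup, of n] by (simp add: c_def)
  from tensor_vanishes_finitely[OF N H this] obtain X where X: "finite X" "X \<subseteq> carrier N" and
    XP: "\<forall>(N' :: ('r, 'r test) module) e. pulled_back R N H N' e \<longrightarrow> X \<subseteq> e ` carrier N' \<longrightarrow>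
     frag_sum (tensor R H N') (pulled_back.pull R H N' e) c = \<zero>\<^bsub>tensor R H N'\<^esub>"
    by (elim exE conjE) (rule that)
  have "finite (X \<union> x ` {..<n})" "X \<union> x ` {..<n} \<subseteq> carrier N" using X xh(1) by auto
  from fg_test_copy[OF N this] obtain N' :: "('r, 'r test) module" and e
    where N': "module R N'" "e \<in> linear_maps R N' N"
    "inj_on e (carrier N')" "X \<union> x ` {..<n} \<subseteq> e ` carrier N'"
    by (elim exE conjE) (rule that)
  interpret P: pulled_back R N H N' e
    using N H N' by (simp add: pulled_back_def pulled_back_axioms_def)
  define u where "u i = pull_back N' e (x i)" for i
  have u: "u i \<in> carrier N'" "e (u i) = x i" if "i < n" for i
    using that N'(4) P.e_pull_back[of "x i"] by (auto simp: u_def P.pull_back_closed)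
  have "frag_sum (tensor R H N') P.pull (\<Sum>i<m. frag_of (x i, h i)) =
     (\<Oplus>\<^bsub>tensor R H N'\<^esub>i\<in>{..<m}. tens R H N' (h i) (u i))" if "m \<le> n" for m
    using that
  proof (induction m)
    case 0 then show ?case by (simp add: P.T.frag_sum_0)
  next
    case (Suc m)
    have "frag_sum (tensor R H N') P.pull (\<Sum>i<Suc m. frag_of (x i, h i)) =
      frag_sum (tensor R H N') P.pull (\<Sum>i<m. frag_of (x i, h i)) \<oplus>\<^bsub>tensor R H N'\<^esub>
      frag_sum (tensor R H N') P.pull (frag_of (x m, h m))"
      unfolding sum.lessThan_Suc
      by (rule P.pull_sum_add[OF ck frag_free]) (use Suc.prems xh in auto)
    also have "frag_sum (tensor R H N') P.pull (frag_of (x m, h m)) = tens R H N' (h m) (u m)"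
      using Suc.prems xh(2)[of m] by (simp add: P.pull_sum_of P.pull_def u_def)
    finally show ?case using Suc xh u
      by (subst P.T.finsum_lessThan_Suc) (auto intro: tens_closed[OF H N'(1)])
  qed
  from this[of n] have "(\<Oplus>\<^bsub>tensor R H N'\<^esub>i\<in>{..<n}. tens R H N' (h i) (u i)) = \<zero>\<^bsub>tensor R H N'\<^esub>"
    using XP[rule_format, OF P.pulled_back_axioms] N'(4) by (simp add: c_def)
  then show ?thesis using N' u by blast
qed

section \<open>Flatness and kernels\<close>

abbreviation map_left where
  "map_left R N H D \<equiv> tensor_lift (tensor R N H) (\<lambda>x h. tens R N H (D x) h)"

lemma map_left_bilinear:
  "module R N \<Longrightarrow> module R H \<Longrightarrow> D \<in> linear_maps R M N \<Longrightarrow>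
    (\<lambda>x h. tens R N H (D x) h) \<in> bilinear_maps R M H (tensor R N H)"
  by (intro bilinI tens_lin1 tens_lin2 lin_id) (auto dest: lin_closed)

lemma map_left_linear:
  "module R M \<Longrightarrow> module R N \<Longrightarrow> module R H \<Longrightarrow> D \<in> linear_maps R M N \<Longrightarrow>
    map_left R N H D \<in> linear_maps R (tensor R M H) (tensor R N H)"
  by (intro lift_linear map_left_bilinear tensor_is_module)

lemma map_left_tens:
  "module R M \<Longrightarrow> module R N \<Longrightarrow> module R H \<Longrightarrow> D \<in> linear_maps R M N \<Longrightarrow> x \<in> carrier M \<Longrightarrow> h \<in> carrier H \<Longrightarrow>
    map_left R N H D (tens R M H x h) = tens R N H (D x) h"
  by (subst lift_tens) (auto intro: map_left_bilinear tensor_is_module)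

text \<open>
  If \<open>z = \<Sum> a\<^sub>i \<otimes> h\<^sub>i\<close> and \<open>\<Sum> D a\<^sub>i \<otimes> h\<^sub>i\<close> vanishes, then it vanishes already over a finitely
  generated copy \<open>N'\<close> of a submodule of \<open>N\<close>.  Let \<open>F'\<close> be a copy of \<open>R\<^sup>n\<close> and \<open>g : F' \<rightarrow> N'\<close> the map that
  sends the \<open>i\<close>-th unit vector to \<open>D a\<^sub>i\<close>.  All modules in \<open>ker g \<rightarrow> F' \<rightarrow> N'\<close> are test modules, so
  flatness moves \<open>\<Sum> h\<^sub>i \<otimes> v\<^sub>i\<close> into \<open>H \<otimes> ker g\<close>.  Replacing the unit vectors \<open>v\<^sub>i\<close> by the \<open>a\<^sub>i\<close> sends
  \<open>ker g\<close> into \<open>ker D\<close> and the tensor to \<open>z\<close>.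
\<close>

theorem flat_kernel:
  fixes R :: "('r, 'k) ring_scheme" and M :: "('r, 'm, 'w) module_scheme" and N :: "('r, 'n, 'x) module_scheme"
    and H :: "('r, 'h, 'y) module_scheme"
  assumes H: "flat R H" and M: "module R M" and N: "module R N" and D: "D \<in> linear_maps R M N"
    and z: "z \<in> carrier (tensor R M H)" and z0: "map_left R N H D z = \<zero>\<^bsub>tensor R N H\<^esub>"
  defines "K \<equiv> M\<lparr>carrier := {x \<in> carrier M. D x = \<zero>\<^bsub>N\<^esub>}\<rparr>"
  shows "z \<in> map_left R M H (\<lambda>x. x) ` carrier (tensor R K H)"
proof -
  let ?NH = "tensor R N H" and ?MH = "tensor R M H" and ?KH = "tensor R K H"
  let ?incl = "map_left R M H (\<lambda>x. x)"
  have mH: "module R H" using H by (simp add: flat_def)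
  interpret M: module R M by fact
  interpret N: module R N by fact
  have K: "module R K" unfolding K_def by (rule submodule_module[OF M kernel_submodule[OF M N D]])
  have i: "(\<lambda>x. x) \<in> linear_maps R K M" by (auto simp: K_def linear_maps_def)
  note TM = tensor_is_module[OF M mH]
  note TN = tensor_is_module[OF N mH]
  note TK = tensor_is_module[OF K mH]
  interpret TM: module R "?MH" by (rule TM)
  obtain n a h where ah: "\<And>i. i < n \<Longrightarrow> a i \<in> carrier M" "\<And>i. i < n \<Longrightarrow> h i \<in> carrier H"
    and z_eq: "z = (\<Oplus>\<^bsub>?MH\<^esub>i\<in>{..<n::nat}. tens R M H (a i) (h i))"
    using tensor_sum_rep[OF M mH z] by blast
  have "map_left R N H D z = (\<Oplus>\<^bsub>?NH\<^esub>i\<in>{..<n}. map_left R N H D (tens R M H (a i) (h i)))"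
    unfolding z_eq by (rule lin_sum[OF TM TN map_left_linear[OF M N mH D]])
      (auto intro: tens_closed[OF M mH] ah)
  also have "\<dots> = (\<Oplus>\<^bsub>?NH\<^esub>i\<in>{..<n}. tens R N H (D (a i)) (h i))"
  proof -
    interpret TN: module R "?NH" by (rule TN)
    show ?thesis by (intro TN.finsum_cong') (auto simp: map_left_tens[OF M N mH D] ah
      intro!: tens_closed[OF N mH] lin_closed[OF D])
  qed
  finally have "(\<Oplus>\<^bsub>?NH\<^esub>i\<in>{..<n}. tens R N H (D (a i)) (h i)) = \<zero>\<^bsub>?NH\<^esub>"
    using z0 by simp
  then have "\<exists>(N' :: ('r, 'r test) module) e u. module R N' \<and> e \<in> linear_maps R N' N \<and>
     (\<forall>i<n. u i \<in> carrier N' \<and> e (u i) = D (a i)) \<and>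
     (\<Oplus>\<^bsub>tensor R H N'\<^esub>i\<in>{..<n}. tens R H N' (h i) (u i)) = \<zero>\<^bsub>tensor R H N'\<^esub>"
    by (intro tensor_sum_vanishes_finitely[OF N mH] lin_closed[OF D] ah)
  then obtain N' :: "('r, 'r test) module" and e u where N': "module R N'" and e: "e \<in> linear_maps R N' N"
    and u': "\<forall>i<n. u i \<in> carrier N' \<and> e (u i) = D (a i)"
    and u0: "(\<Oplus>\<^bsub>tensor R H N'\<^esub>i\<in>{..<n}. tens R H N' (h i) (u i)) = \<zero>\<^bsub>tensor R H N'\<^esub>"
    by (elim exE conjE) (rule that)
  let ?HN' = "tensor R H N'"
  have u: "\<And>i. i < n \<Longrightarrow> u i \<in> carrier N'" "\<And>i. i < n \<Longrightarrow> e (u i) = D (a i)" using u' by auto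
  let ?F = "free_module R n"
  note F = free_module_module[OF M.is_cring, of n]
  have "finite (unit_vec R ` {..<n})" "unit_vec R ` {..<n} \<subseteq> carrier ?F"
    using unit_vec_closed[OF M.is_cring] by auto
  from fg_test_copy[OF F this] obtain F' :: "('r, 'r test) module" and q
    where F': "module R F'" and q: "q \<in> linear_maps R F' ?F"
    and ran: "unit_vec R ` {..<n} \<subseteq> q ` carrier F'"
    by (elim exE conjE) (rule that)
  have "\<forall>i. \<exists>v. i < n \<longrightarrow> v \<in> carrier F' \<and> q v = unit_vec R i"
  proof
    fix i show "\<exists>v. i < n \<longrightarrow> v \<in> carrier F' \<and> q v = unit_vec R i"
      using subsetD[OF ran, of "unit_vec R i"] by (cases "i < n") auto
  qed
  then obtain v where v: "\<And>i. i < n \<Longrightarrow> v i \<in> carrier F'" "\<And>i. i < n \<Longrightarrow> q (v i) = unit_vec R i"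
    by metis
  define g where "g = (\<lambda>X. lin_comb N' n u (q X))"
  define b where "b = (\<lambda>X. lin_comb M n a (q X))"
  have g: "g \<in> linear_maps R F' N'" unfolding g_def
    by (rule lin_compose[OF lin_comb_linear[of R N' n u, OF N'] q]) (rule u)
  have b: "b \<in> linear_maps R F' M" unfolding b_def
    by (rule lin_compose[OF lin_comb_linear[of R M n a, OF M] q]) (rule ah)
  have gv: "g (v i) = u i" "b (v i) = a i" if "i < n" for i
    unfolding g_def b_def v(2)[OF that]
    by (rule lin_comb_unit_vec[OF N' u(1) that] lin_comb_unit_vec[OF M ah(1) that]; assumption)+
  have eg: "e (g X) = D (b X)" if "X \<in> carrier F'" for X
  proof -
    interpret N': module R N' by fact
    note qX = free_module_coord[OF M.is_cring lin_closed[OF q that]]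
    have "e (g X) = (\<Oplus>\<^bsub>N\<^esub>i\<in>{..<n}. e (q X i \<odot>\<^bsub>N'\<^esub> u i))"
      unfolding g_def lin_comb_def by (rule lin_sum[OF N' N e]) (use qX u in auto)
    also have "\<dots> = (\<Oplus>\<^bsub>N\<^esub>i\<in>{..<n}. D (q X i \<odot>\<^bsub>M\<^esub> a i))"
      using qX u ah lin_closed[OF D]
      by (intro N.finsum_cong') (auto simp: lin_smult[OF e] lin_smult[OF D])
    also have "\<dots> = D (b X)"
      unfolding b_def lin_comb_def by (rule lin_sum[OF M N D, symmetric]) (use qX ah in auto)
    finally show ?thesis .
  qed
  let ?HF' = "tensor R H F'"
  define K' where "K' = F'\<lparr>carrier := {X \<in> carrier F'. g X = \<zero>\<^bsub>N'\<^esub>}\<rparr>"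
  let ?HK' = "tensor R H K'"
  have K': "module R K'" unfolding K'_def by (rule submodule_module[OF F' kernel_submodule[OF F' N' g]])
  have i': "(\<lambda>x. x) \<in> linear_maps R K' F'" by (auto simp: K'_def linear_maps_def)
  have "exact_at K' (\<lambda>x. x) F' g N'" by (auto simp: exact_at_def a_kernel_def' K'_def)
  then have ex: "exact_at ?HK' (tensor_map R H K' F' (\<lambda>x. x)) ?HF'
      (tensor_map R H F' N' g) ?HN'"
    using H K' F' N' i' g unfolding flat_def by blast
  note TF' = tensor_is_module[OF mH F']
  note TN' = tensor_is_module[OF mH N']
  note TK' = tensor_is_module[OF mH K']
  interpret TF': module R "?HF'" by (rule TF')
  interpret TN': module R "?HN'" by (rule TN')
  define w where "w = (\<Oplus>\<^bsub>?HF'\<^esub>i\<in>{..<n}. tens R H F' (h i) (v i))"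
  have w: "w \<in> carrier ?HF'" unfolding w_def
    by (rule TF'.finsum_closed) (auto intro: tens_closed[OF mH F'] ah v)
  have "tensor_map R H F' N' g w = (\<Oplus>\<^bsub>?HN'\<^esub>i\<in>{..<n}. tensor_map R H F' N' g (tens R H F' (h i) (v i)))"
    unfolding w_def by (rule lin_sum[OF TF' TN' tensor_map_linear[OF mH F' N' g]])
      (auto intro: tens_closed[OF mH F'] ah v)
  also have "\<dots> = (\<Oplus>\<^bsub>?HN'\<^esub>i\<in>{..<n}. tens R H N' (h i) (u i))"
    by (intro TN'.finsum_cong') (auto simp: tensor_map_tens[OF mH F' N' g] ah v gv u intro!: tens_closed[OF mH N'])
  finally have "w \<in> a_kernel ?HF' ?HN' (tensor_map R H F' N' g)"
    using w u0 by (simp add: a_kernel_def')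
  then obtain w' where w': "w' \<in> carrier ?HK'" "w = tensor_map R H K' F' (\<lambda>x. x) w'"
    using ex unfolding exact_at_def by blast
  let ?L = "tensor_lift ?MH (\<lambda>h X. tens R M H (b X) h)"
  have Lb: "(\<lambda>h X. tens R M H (b X) h) \<in> bilinear_maps R H F' ?MH"
    by (intro bilinI tens_lin1 tens_lin2 lin_id M mH b) (auto intro: lin_closed[OF b])
  note L = lift_linear[OF mH F' TM Lb]
  \<comment> \<open>Replacing unit vectors by the elements \<open>a i\<close> recovers \<open>z\<close>; the factors change places because
    flatness is stated for tensor products with the flat module on the left.\<close>
  have Lw: "?L w = z"
  proof -
    have "?L w = (\<Oplus>\<^bsub>?MH\<^esub>i\<in>{..<n}. ?L (tens R H F' (h i) (v i)))"
      unfolding w_def by (rule lin_sum[OF TF' TM L]) (auto intro: tens_closed[OF mH F'] ah v)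
    also have "\<dots> = z" unfolding z_eq
      by (intro TM.finsum_cong') (auto simp: lift_tens[OF mH F' TM Lb] ah v gv intro!: tens_closed[OF M mH])
    finally show ?thesis .
  qed
  note I = map_left_linear[OF K M mH i]
  have "?L (tensor_map R H K' F' (\<lambda>x. x) w') \<in> ?incl ` carrier ?KH"
    using mH K' w'(1)
  proof (induction rule: tens_induct)
    case zero
    interpret TK: module R "?KH" by (rule TK)
    have "?L (tensor_map R H K' F' (\<lambda>x. x) \<zero>\<^bsub>?HK'\<^esub>) = \<zero>\<^bsub>?MH\<^esub>"
      by (simp add: lin_zero[OF TK' TF' tensor_map_linear[OF mH K' F' i']] lin_zero[OF TF' TM L])
    also have "\<dots> = ?incl \<zero>\<^bsub>?KH\<^esub>"
      by (rule lin_zero[OF TK TM I, symmetric])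
    finally show ?case by auto
  next
    case (tens h X)
    then have X: "X \<in> carrier F'" "g X = \<zero>\<^bsub>N'\<^esub>" by (auto simp: K'_def)
    have "D (b X) = \<zero>\<^bsub>N\<^esub>" using eg[OF X(1)] X(2) lin_zero[OF N' N e] by simp
    then have bX: "b X \<in> carrier K" using lin_closed[OF b X(1)] by (simp add: K_def)
    have "?L (tensor_map R H K' F' (\<lambda>x. x) (tens R H K' h X)) = tens R M H (b X) h"
      using tens X by (simp add: tensor_map_tens[OF mH K' F' i'] lift_tens[OF mH F' TM Lb])
    also have "\<dots> = ?incl (tens R K H (b X) h)"
      by (rule map_left_tens[OF K M mH i bX tens(1), symmetric])
    finally show ?case using tens_closed[OF K mH bX tens(1)] by auto
  next
    case (add x y)
    interpret TK: module R "?KH" by (rule TK)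
    from add(3,4) obtain x' y' where xy: "x' \<in> carrier ?KH" "y' \<in> carrier ?KH"
      "?L (tensor_map R H K' F' (\<lambda>x. x) x) = ?incl x'"
      "?L (tensor_map R H K' F' (\<lambda>x. x) y) = ?incl y'" by blast
    have "?L (tensor_map R H K' F' (\<lambda>x. x) (x \<oplus>\<^bsub>?HK'\<^esub> y)) =
      ?incl (x' \<oplus>\<^bsub>?KH\<^esub> y')"
      using add(1,2) xy lin_closed[OF tensor_map_linear[OF mH K' F' i']]
      by (simp add: lin_add[OF tensor_map_linear[OF mH K' F' i']] lin_add[OF L] lin_add[OF I])
    then show ?case using xy by auto
  qed
  then show ?thesis using Lw w'(2) by simp
qed

text \<open>
  The kernel of an injective map is zero, and \<open>0 \<otimes> H = 0\<close>.
\<close>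

corollary flat_injective:
  fixes R :: "('r, 'k) ring_scheme" and M :: "('r, 'm, 'w) module_scheme" and N :: "('r, 'n, 'x) module_scheme"
    and H :: "('r, 'h, 'y) module_scheme"
  assumes H: "flat R H" and M: "module R M" and N: "module R N" and D: "D \<in> linear_maps R M N"
    and inj: "inj_on D (carrier M)"
  shows "inj_on (map_left R N H D) (carrier (tensor R M H))"
proof (rule lin_inj)
  have mH: "module R H" using H by (simp add: flat_def)
  interpret M: module R M by fact
  interpret T: module R "tensor R M H" by (rule tensor_is_module[OF M mH])
  show "module R (tensor R M H)" "module R (tensor R N H)"
    by (rule tensor_is_module[OF M mH] tensor_is_module[OF N mH])+
  show "map_left R N H D \<in> linear_maps R (tensor R M H) (tensor R N H)"
    by (rule map_left_linear[OF M N mH D])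
  fix z assume z: "z \<in> carrier (tensor R M H)" "map_left R N H D z = \<zero>\<^bsub>tensor R N H\<^esub>"
  define K where "K = M\<lparr>carrier := {x \<in> carrier M. D x = \<zero>\<^bsub>N\<^esub>}\<rparr>"
  have K0: "x = \<zero>\<^bsub>M\<^esub>" if "x \<in> carrier K" for x
    using that inj lin_zero[OF M N D] by (auto simp: K_def inj_on_def)
  have K: "module R K" unfolding K_def by (rule submodule_module[OF M kernel_submodule[OF M N D]])
  have i: "(\<lambda>x. x) \<in> linear_maps R K M" by (auto simp: K_def linear_maps_def)
  note I = map_left_linear[OF K M mH i]
  obtain w where w: "w \<in> carrier (tensor R K H)" "z = map_left R M H (\<lambda>x. x) w"
    using flat_kernel[OF H M N D z] unfolding K_def by blast
  have "map_left R M H (\<lambda>x. x) w = \<zero>\<^bsub>tensor R M H\<^esub>"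
    using K mH w(1)
  proof (induction rule: tens_induct)
    case zero
    show ?case by (rule lin_zero[OF tensor_is_module[OF K mH] T.module_axioms I])
  next
    case (tens x h)
    have "map_left R M H (\<lambda>x. x) (tens R K H x h) = tens R M H \<zero>\<^bsub>M\<^esub> h"
      using map_left_tens[OF K M mH i tens] K0[OF tens(1)] by simp
    then show ?case using lin_zero[OF M T.module_axioms bilin2[OF tens_bilinear[OF M mH] tens(2)]] by simp
  next
    case (add u v)
    then show ?case by (simp add: lin_add[OF I])
  qed
  then show "z = \<zero>\<^bsub>tensor R M H\<^esub>" using w by simp
qed

section \<open>Operators on tensor products\<close>

context hopf_algebra
begin

definition op_left :: "('r, 'm, 'y) module_scheme \<Rightarrow> ('r, 'q, 'z) module_scheme \<Rightarrow> ('m \<Rightarrow> 'h \<Rightarrow> 'm)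
    \<Rightarrow> ('m \<times> 'q \<Rightarrow>\<^sub>0 int) set \<Rightarrow> 'h \<Rightarrow> ('m \<times> 'q \<Rightarrow>\<^sub>0 int) set" where
  "op_left M Q m z h = tensor_lift (tensor R M Q) (\<lambda>x q. tens R M Q (m x h) q) z"

definition op_right :: "('r, 'm, 'y) module_scheme \<Rightarrow> ('r, 'q, 'z) module_scheme \<Rightarrow> ('q \<Rightarrow> 'h \<Rightarrow> 'q)
    \<Rightarrow> ('m \<times> 'q \<Rightarrow>\<^sub>0 int) set \<Rightarrow> 'h \<Rightarrow> ('m \<times> 'q \<Rightarrow>\<^sub>0 int) set" where
  "op_right M Q n z h = tensor_lift (tensor R M Q) (\<lambda>x q. tens R M Q x (n q h)) z"

lemma lift_fun_arg_bilinear: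
  assumes "module R M" "module R Q" "module R G" "module R X"
    "\<And>h. h \<in> carrier X \<Longrightarrow> f h \<in> bilinear_maps R M Q G"
    "\<And>x q. x \<in> carrier M \<Longrightarrow> q \<in> carrier Q \<Longrightarrow> (\<lambda>h. f h x q) \<in> linear_maps R X G"
  shows "(\<lambda>z h. tensor_lift G (f h) z) \<in> bilinear_maps R (tensor R M Q) X G"
  by (intro bilinI lift_linear[OF assms(1-3,5)] lift_lin_fun[OF assms(1-4) assms(5,6)])

context
  fixes M :: "('r, 'm, 'y) module_scheme" and Q :: "('r, 'q, 'z) module_scheme"
  assumes M: "module R M" and Q: "module R Q"
begin

lemma MQ: "module R (tensor R M Q)"
  by (rule tensor_is_module[OF M Q])

context
  fixes m :: "'m \<Rightarrow> 'h \<Rightarrow> 'm" assumes m: "m \<in> bilinear_maps R M H M"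
begin

lemma op_left_bilinear: "op_left M Q m \<in> bilinear_maps R (tensor R M Q) H (tensor R M Q)"
  unfolding op_left_def
  by (rule lift_fun_arg_bilinear[OF M Q MQ modH], insert M Q)
    (assumption | rule lins bilin_app1[OF m] bilin_app2[OF m] bilin_closed[OF m])+

lemma op_left_tens:
  "x \<in> carrier M \<Longrightarrow> q \<in> carrier Q \<Longrightarrow> h \<in> carrier H \<Longrightarrow> op_left M Q m (tens R M Q x q) h = tens R M Q (m x h) q"
  unfolding op_left_def
  by (rule lift_tens[OF M Q MQ], insert M Q)
    (assumption | rule lins bilin_app1[OF m] bilin_app2[OF m] bilin_closed[OF m])+

end

context
  fixes n :: "'q \<Rightarrow> 'h \<Rightarrow> 'q" assumes n: "n \<in> bilinear_maps R Q H Q"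
begin

lemma op_right_bilinear: "op_right M Q n \<in> bilinear_maps R (tensor R M Q) H (tensor R M Q)"
  unfolding op_right_def
  by (rule lift_fun_arg_bilinear[OF M Q MQ modH], insert M Q)
    (assumption | rule lins bilin_app1[OF n] bilin_app2[OF n] bilin_closed[OF n])+

lemma op_right_tens:
  "x \<in> carrier M \<Longrightarrow> q \<in> carrier Q \<Longrightarrow> h \<in> carrier H \<Longrightarrow> op_right M Q n (tens R M Q x q) h = tens R M Q x (n q h)"
  unfolding op_right_def
  by (rule lift_tens[OF M Q MQ], insert M Q)
    (assumption | rule lins bilin_app1[OF n] bilin_app2[OF n] bilin_closed[OF n])+

end

end

lemma op_conv_lin1:
  assumes "module R M" "m \<in> bilinear_maps R M H M" "n \<in> bilinear_maps R M H M" "h \<in> carrier H"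
  shows "(\<lambda>x. op_conv M m n x h) \<in> linear_maps R M M"
  using op_conv_bilinear[OF assms(1-3)] assms(4) by (rule bilin2)

text \<open>
  An inverse in the convolution algebra needs to be verified on pure tensors only.
\<close>

lemma op_conv_counit_ext:
  assumes M: "module R M" and Q: "module R Q"
    and m: "m \<in> bilinear_maps R (tensor R M Q) H (tensor R M Q)" and n: "n \<in> bilinear_maps R (tensor R M Q) H (tensor R M Q)"
    and eq: "\<And>x q. x \<in> carrier M \<Longrightarrow> q \<in> carrier Q \<Longrightarrow>
      op_conv (tensor R M Q) m n (tens R M Q x q) h = counit H h \<odot>\<^bsub>tensor R M Q\<^esub> tens R M Q x q"
    and z: "z \<in> carrier (tensor R M Q)" and h: "h \<in> carrier H"
  shows "op_conv (tensor R M Q) m n z h = counit H h \<odot>\<^bsub>tensor R M Q\<^esub> z"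
  by (rule lin_ext[OF M Q MQ[OF M Q] op_conv_lin1[OF MQ[OF M Q] m n h]
     lin_smult_right[OF MQ[OF M Q] lin_id counit_closed[OF h]] eq z])

lemma op_left_inverse:
  assumes M: "module R M" and Q: "module R Q" and m: "m \<in> bilinear_maps R M H M" and n: "n \<in> bilinear_maps R M H M"
    and inv: "\<And>x h. x \<in> carrier M \<Longrightarrow> h \<in> carrier H \<Longrightarrow> op_conv M m n x h = counit H h \<odot>\<^bsub>M\<^esub> x"
    and z: "z \<in> carrier (tensor R M Q)" and h: "h \<in> carrier H"
  shows "op_conv (tensor R M Q) (op_left M Q m) (op_left M Q n) z h = counit H h \<odot>\<^bsub>tensor R M Q\<^esub> z"
proof (rule op_conv_counit_ext[OF M Q op_left_bilinear[OF M Q m] op_left_bilinear[OF M Q n] _ z h])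
  let ?T = "tensor R M Q"
  note T = MQ[OF M Q]
  fix x q assume xq: "x \<in> carrier M" "q \<in> carrier Q"
  note rules = lins bilin_app1[OF n] bilin_app2[OF n] bilin_closed[OF n] bilin_app2[OF m] bilin_closed[OF m]
    bilin_app1[OF op_left_bilinear[OF M Q n]] bilin_app2[OF op_left_bilinear[OF M Q n]]
    bilin_app2[OF op_left_bilinear[OF M Q m]]
    bilin_closed[OF op_left_bilinear[OF M Q m]]
  have "op_conv ?T (op_left M Q m) (op_left M Q n) (tens R M Q x q) h =
    sw H ?T h (\<lambda>a b. tens R M Q (n (m x a) b) q)"
    unfolding op_conv_def
    by (rule sw_cong[OF T _ _ h], insert M Q xq T)
      ((assumption | rule rules)+, simp add: op_left_tens[OF M Q m] op_left_tens[OF M Q n] bilin_closed[OF m])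
  also have "\<dots> = tens R M Q (op_conv M m n x h) q"
    unfolding op_conv_def
    by (rule sw_lin[OF M T _ _ h, where L = "\<lambda>x. tens R M Q x q", symmetric], insert M Q xq T)
      (assumption | rule rules)+
  also have "\<dots> = counit H h \<odot>\<^bsub>?T\<^esub> tens R M Q x q"
    using xq h by (simp add: inv tens_smult_left[OF M Q] counit_closed)
  finally show "op_conv ?T (op_left M Q m) (op_left M Q n) (tens R M Q x q) h = counit H h \<odot>\<^bsub>?T\<^esub> tens R M Q x q" .
qed

lemma op_right_inverse:
  assumes M: "module R M" and Q: "module R Q" and m: "m \<in> bilinear_maps R Q H Q" and n: "n \<in> bilinear_maps R Q H Q"
    and inv: "\<And>x h. x \<in> carrier Q \<Longrightarrow> h \<in> carrier H \<Longrightarrow> op_conv Q m n x h = counit H h \<odot>\<^bsub>Q\<^esub> x"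
    and z: "z \<in> carrier (tensor R M Q)" and h: "h \<in> carrier H"
  shows "op_conv (tensor R M Q) (op_right M Q m) (op_right M Q n) z h = counit H h \<odot>\<^bsub>tensor R M Q\<^esub> z"
proof (rule op_conv_counit_ext[OF M Q op_right_bilinear[OF M Q m] op_right_bilinear[OF M Q n] _ z h])
  let ?T = "tensor R M Q"
  note T = MQ[OF M Q]
  fix x q assume xq: "x \<in> carrier M" "q \<in> carrier Q"
  note rules = lins bilin_app1[OF n] bilin_app2[OF n] bilin_closed[OF n] bilin_app2[OF m] bilin_closed[OF m]
    bilin_app1[OF op_right_bilinear[OF M Q n]] bilin_app2[OF op_right_bilinear[OF M Q n]]
    bilin_app2[OF op_right_bilinear[OF M Q m]]
    bilin_closed[OF op_right_bilinear[OF M Q m]]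
  have "op_conv ?T (op_right M Q m) (op_right M Q n) (tens R M Q x q) h =
    sw H ?T h (\<lambda>a b. tens R M Q x (n (m q a) b))"
    unfolding op_conv_def
    by (rule sw_cong[OF T _ _ h], insert M Q xq T)
      ((assumption | rule rules)+, simp add: op_right_tens[OF M Q m] op_right_tens[OF M Q n] bilin_closed[OF m])
  also have "\<dots> = tens R M Q x (op_conv Q m n q h)"
    unfolding op_conv_def
    by (rule sw_lin[OF Q T _ _ h, where L = "\<lambda>q. tens R M Q x q", symmetric], insert M Q xq T)
      (assumption | rule rules)+
  also have "\<dots> = counit H h \<odot>\<^bsub>?T\<^esub> tens R M Q x q"
    using xq h by (simp add: inv tens_smult_right[OF M Q] counit_closed)
  finally show "op_conv ?T (op_right M Q m) (op_right M Q n) (tens R M Q x q) h = counit H h \<odot>\<^bsub>?T\<^esub> tens R M Q x q" .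
qed

lemma twist_bij:
  assumes M: "module R M" and m: "m \<in> bilinear_maps R M H M" and n: "n \<in> bilinear_maps R M H M"
    and inv: "\<And>x h. x \<in> carrier M \<Longrightarrow> h \<in> carrier H \<Longrightarrow> op_conv M m n x h = counit H h \<odot>\<^bsub>M\<^esub> x"
    and inv': "\<And>x h. x \<in> carrier M \<Longrightarrow> h \<in> carrier H \<Longrightarrow> op_conv M n m x h = counit H h \<odot>\<^bsub>M\<^esub> x"
  shows "bij_betw (twist M m) (carrier (tensor R M H)) (carrier (tensor R M H))"
  by (rule bij_betw_byWitness[where f' = "twist M n"])
    (auto simp: twist_inverse[OF M m n inv] twist_inverse[OF M n m inv']
      lin_closed[OF twist_linear[OF M m]] lin_closed[OF twist_linear[OF M n]])

lemma twist_inj: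
  assumes M: "module R M" and m: "m \<in> bilinear_maps R M H M" and n: "n \<in> bilinear_maps R M H M"
    and inv: "\<And>x h. x \<in> carrier M \<Longrightarrow> h \<in> carrier H \<Longrightarrow> op_conv M m n x h = counit H h \<odot>\<^bsub>M\<^esub> x"
  shows "inj_on (twist M m) (carrier (tensor R M H))"
  by (rule inj_on_inverseI[where g = "twist M n"]) (rule twist_inverse[OF M m n inv])

definition "mul_op k h = k \<otimes>\<^bsub>H\<^esub> h"
definition "mul_antipode_op k h = k \<otimes>\<^bsub>H\<^esub> antipode H h"

lemma mul_op_bilinear: "mul_op \<in> bilinear_maps R H H H" "mul_antipode_op \<in> bilinear_maps R H H H"
  unfolding mul_op_def[abs_def] mul_antipode_op_def[abs_def] by ((assumption | rule lins)+)

lemma H_smult_one: "k \<in> carrier H \<Longrightarrow> r \<in> carrier R \<Longrightarrow> k \<otimes>\<^bsub>H\<^esub> (r \<odot>\<^bsub>H\<^esub> \<one>\<^bsub>H\<^esub>) = r \<odot>\<^bsub>H\<^esub> k"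
  by (simp add: smult_mult_right)

lemma mul_op_inverse:
  assumes k: "k \<in> carrier H" and h: "h \<in> carrier H"
  shows "op_conv H mul_op mul_antipode_op k h = counit H h \<odot>\<^bsub>H\<^esub> k"
    "op_conv H mul_antipode_op mul_op k h = counit H h \<odot>\<^bsub>H\<^esub> k"
proof -
  have "op_conv H mul_op mul_antipode_op k h = sw H H h (\<lambda>a b. k \<otimes>\<^bsub>H\<^esub> (a \<otimes>\<^bsub>H\<^esub> antipode H b))"
    unfolding op_conv_def mul_op_def mul_antipode_op_def
    by (rule sw_cong[OF modH _ _ h], insert k) ((assumption | rule lins)+, simp add: m_assoc antipode_closed)
  also have "\<dots> = k \<otimes>\<^bsub>H\<^esub> sw H H h (\<lambda>a b. a \<otimes>\<^bsub>H\<^esub> antipode H b)"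
    by (rule sw_lin[OF modH modH _ _ h, symmetric, where L = "\<lambda>x. k \<otimes>\<^bsub>H\<^esub> x"], insert k) ((assumption | rule lins)+)
  finally show "op_conv H mul_op mul_antipode_op k h = counit H h \<odot>\<^bsub>H\<^esub> k"
    using k h by (simp add: antipode_right H_smult_one counit_closed)
  have "op_conv H mul_antipode_op mul_op k h = sw H H h (\<lambda>a b. k \<otimes>\<^bsub>H\<^esub> (antipode H a \<otimes>\<^bsub>H\<^esub> b))"
    unfolding op_conv_def mul_op_def mul_antipode_op_def
    by (rule sw_cong[OF modH _ _ h], insert k) ((assumption | rule lins)+, simp add: m_assoc antipode_closed)
  also have "\<dots> = k \<otimes>\<^bsub>H\<^esub> sw H H h (\<lambda>a b. antipode H a \<otimes>\<^bsub>H\<^esub> b)"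
    by (rule sw_lin[OF modH modH _ _ h, symmetric, where L = "\<lambda>x. k \<otimes>\<^bsub>H\<^esub> x"], insert k) ((assumption | rule lins)+)
  finally show "op_conv H mul_antipode_op mul_op k h = counit H h \<odot>\<^bsub>H\<^esub> k"
    using k h by (simp add: antipode_left H_smult_one counit_closed)
qed

end

section \<open>Quotients by right ideals\<close>

text \<open>
  Right multiplication by elements of \<open>H\<close> descends to operators on \<open>Q = H/I\<close> because \<open>I\<close> is a right
  ideal.
\<close>

locale right_ideal_quotient = hopf_algebra R H
  for R (structure) and H :: "('r, 'h, 'x) hopf_scheme" (structure) +
  fixes I :: "'h set"
  assumes I_sub: "submodule I R H"
    and I_right: "\<And>x h. x \<in> I \<Longrightarrow> h \<in> carrier H \<Longrightarrow> x \<otimes>\<^bsub>H\<^esub> h \<in> I"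
begin

definition "Q = quot_module H I"
definition "pr h = I +>\<^bsub>H\<^esub> h"

lemma modQ: "module R Q"
  unfolding Q_def by (rule quot_is_module[OF modH I_sub])

lemma pr_linear: "pr \<in> linear_maps R H Q"
  unfolding Q_def pr_def[abs_def] by (rule quot_proj_linear[OF modH I_sub])

lemma Q_cases: assumes "X \<in> carrier Q" obtains k where "k \<in> carrier H" "X = pr k"
  using assms by (auto simp: Q_def pr_def quot_carrier[OF modH I_sub])

definition "quot_op X h = pr ((SOME k. k \<in> carrier H \<and> X = pr k) \<otimes>\<^bsub>H\<^esub> h)"

lemma quot_op_pr:
  assumes k: "k \<in> carrier H" and h: "h \<in> carrier H"
  shows "quot_op (pr k) h = pr (k \<otimes>\<^bsub>H\<^esub> h)"
  unfolding quot_op_def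
proof (rule someI2[of _ k])
  fix k' assume k': "k' \<in> carrier H \<and> pr k = pr k'"
  then have "k \<ominus>\<^bsub>H\<^esub> k' \<in> I"
    using quot_eq_iff[OF modH I_sub k, of k'] by (simp add: pr_def)
  then have "(k \<ominus>\<^bsub>H\<^esub> k') \<otimes>\<^bsub>H\<^esub> h \<in> I" using h by (rule I_right)
  moreover have "(k \<ominus>\<^bsub>H\<^esub> k') \<otimes>\<^bsub>H\<^esub> h = k \<otimes>\<^bsub>H\<^esub> h \<ominus>\<^bsub>H\<^esub> k' \<otimes>\<^bsub>H\<^esub> h"
    using k k' h by (simp add: minus_eq l_distr l_minus)
  ultimately show "pr (k' \<otimes>\<^bsub>H\<^esub> h) = pr (k \<otimes>\<^bsub>H\<^esub> h)"
    using k k' h by (simp add: pr_def quot_eq_iff[OF modH I_sub, symmetric])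
qed (use k in auto)

lemma quot_op_bilinear: "quot_op \<in> bilinear_maps R Q H Q"
proof (intro bilinI)
  fix X assume "X \<in> carrier Q"
  then obtain k where k: "k \<in> carrier H" "X = pr k" by (rule Q_cases)
  have "(\<lambda>h. pr (k \<otimes>\<^bsub>H\<^esub> h)) \<in> linear_maps R H Q"
    by (rule lin_compose[OF pr_linear], insert k) (assumption | rule lins)+
  then show "quot_op X \<in> linear_maps R H Q"
    by (rule lin_cong[OF _ modH]) (simp add: k quot_op_pr)
next
  interpret Q: module R Q by (rule modQ)
  fix h assume h: "h \<in> carrier H"
  show "(\<lambda>X. quot_op X h) \<in> linear_maps R Q Q"
  proof (rule linI)
    show "quot_op X h \<in> carrier Q" if "X \<in> carrier Q" for X
      using that by (rule Q_cases) (use h in \<open>simp add: quot_op_pr lin_closed[OF pr_linear]\<close>)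
    show "quot_op (X \<oplus>\<^bsub>Q\<^esub> Y) h = quot_op X h \<oplus>\<^bsub>Q\<^esub> quot_op Y h" if "X \<in> carrier Q" "Y \<in> carrier Q" for X Y
    proof -
      from that obtain k l where "k \<in> carrier H" "X = pr k" "l \<in> carrier H" "Y = pr l" by (metis Q_cases)
      then show ?thesis using h by (simp add: quot_op_pr l_distr flip: lin_add[OF pr_linear])
    qed
    show "quot_op (r \<odot>\<^bsub>Q\<^esub> X) h = r \<odot>\<^bsub>Q\<^esub> quot_op X h" if "r \<in> carrier R" "X \<in> carrier Q" for r X
    proof -
      from that obtain k where "k \<in> carrier H" "X = pr k" by (metis Q_cases)
      then show ?thesis using h that by (simp add: quot_op_pr smult_mult_left flip: lin_smult[OF pr_linear])
    qed
  qed
qed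

definition "quot_antipode_op X h = quot_op X (antipode H h)"

lemma quot_antipode_op_bilinear: "quot_antipode_op \<in> bilinear_maps R Q H Q"
  unfolding quot_antipode_op_def[abs_def]
  by (assumption | rule bilinI bilin_app1[OF quot_op_bilinear] bilin_app2[OF quot_op_bilinear] lin_id antipode_linear antipode_closed)+

lemma quot_op_inverse:
  assumes X: "X \<in> carrier Q" and h: "h \<in> carrier H"
  shows "op_conv Q quot_op quot_antipode_op X h = counit H h \<odot>\<^bsub>Q\<^esub> X"
proof -
  obtain k where k: "k \<in> carrier H" "X = pr k" using X by (rule Q_cases)
  note rules = lins mul_op_bilinear bilin_app1[OF mul_op_bilinear(2)] bilin_app2[OF mul_op_bilinear(2)]
    bilin_app2[OF mul_op_bilinear(1)] bilin_closed[OF mul_op_bilinear(1)] lin_compose[OF pr_linear]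
  have "op_conv Q quot_op quot_antipode_op X h = sw H Q h (\<lambda>a b. pr (mul_antipode_op (mul_op k a) b))"
    unfolding op_conv_def
    by (rule sw_cong[OF modQ _ _ h, symmetric], insert k)
      ((assumption | rule rules)+, simp add: quot_op_pr quot_antipode_op_def mul_op_def mul_antipode_op_def antipode_closed)
  also have "\<dots> = pr (op_conv H mul_op mul_antipode_op k h)"
    unfolding op_conv_def
    by (rule sw_lin[OF modH modQ _ pr_linear h, symmetric], insert k) (assumption | rule rules)+
  finally show ?thesis using k h by (simp add: mul_op_inverse lin_smult[OF pr_linear] counit_closed)
qed

end

section \<open>Crossed products\<close>

context crossed_product
begin

abbreviation "BH \<equiv> tensor R B H"
abbreviation "bh \<equiv> tens R B H"

lemma modB: "module R B" ..

lemma modBH: "module R BH"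
  by (rule tensor_is_module[OF modB modH])

lemma B_mult_closed: "a \<in> carrier B \<Longrightarrow> b \<in> carrier B \<Longrightarrow> a \<otimes>\<^bsub>B\<^esub> b \<in> carrier B"
  by (rule B.m_closed)

lemma B_mult_bilinear: "(\<lambda>a b. a \<otimes>\<^bsub>B\<^esub> b) \<in> bilinear_maps R B B B"
  by (intro bilinI linI) (auto simp: B.smult_mult_left B.smult_mult_right B.l_distr B.r_distr)

lemmas B_lins = lins bilin_app1[OF B_mult_bilinear] bilin_app2[OF B_mult_bilinear] B_mult_closed
  bilin_app1[OF act_bilinear] bilin_app2[OF act_bilinear] bilin_closed[OF act_bilinear] modB modBH

text \<open>
  The operators \<open>b # k \<mapsto> b f(k\<^sub>(\<^sub>1\<^sub>), h) # k\<^sub>(\<^sub>2\<^sub>)\<close>.  For \<open>f = \<sigma>\<close> they are the cocycle part of right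
  multiplication by \<open>1 # h\<close>.
\<close>

definition cocycle_op :: "('h \<Rightarrow> 'h \<Rightarrow> 'b) \<Rightarrow> ('b \<times> 'h \<Rightarrow>\<^sub>0 int) set \<Rightarrow> 'h \<Rightarrow> ('b \<times> 'h \<Rightarrow>\<^sub>0 int) set" where
  "cocycle_op f z h = tensor_lift BH (\<lambda>b k. sw H BH k (\<lambda>k1 k2. bh (b \<otimes>\<^bsub>B\<^esub> f k1 h) k2)) z"

context
  fixes f assumes f: "f \<in> bilinear_maps R H H B"
begin

lemma cocycle_op_bilinear: "cocycle_op f \<in> bilinear_maps R BH H BH"
  unfolding cocycle_op_def[abs_def]
  by (rule lift_fun_arg_bilinear[OF modB modH modBH modH])
    (assumption | rule B_lins bilin_app1[OF f] bilin_app2[OF f] bilin_closed[OF f])+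

lemma cocycle_op_tens: "b \<in> carrier B \<Longrightarrow> k \<in> carrier H \<Longrightarrow> h \<in> carrier H \<Longrightarrow>
    cocycle_op f (bh b k) h = sw H BH k (\<lambda>k1 k2. bh (b \<otimes>\<^bsub>B\<^esub> f k1 h) k2)"
  unfolding cocycle_op_def
  by (rule lift_tens[OF modB modH modBH])
    (assumption | rule B_lins bilin_app1[OF f] bilin_app2[OF f] bilin_closed[OF f])+

end

text \<open>
  Convolution inverses of bilinear maps \<open>H \<times> H \<rightarrow> B\<close> give convolution inverses of the operators:
  after one use of coassociativity in \<open>k\<close> the two coefficients meet as
  \<open>f(k\<^sub>(\<^sub>1\<^sub>), h\<^sub>(\<^sub>1\<^sub>)) g(k\<^sub>(\<^sub>2\<^sub>), h\<^sub>(\<^sub>2\<^sub>))\<close>, which collapses to \<open>\<epsilon>(k) \<epsilon>(h)\<close>.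
\<close>

lemma cocycle_op_inverse:
  assumes f: "f \<in> bilinear_maps R H H B" and g: "g \<in> bilinear_maps R H H B"
    and inv: "\<And>h k. h \<in> carrier H \<Longrightarrow> k \<in> carrier H \<Longrightarrow>
      sw H B h (\<lambda>h1 h2. sw H B k (\<lambda>k1 k2. f h1 k1 \<otimes>\<^bsub>B\<^esub> g h2 k2)) = (counit H h \<otimes>\<^bsub>R\<^esub> counit H k) \<odot>\<^bsub>B\<^esub> \<one>\<^bsub>B\<^esub>"
    and z: "z \<in> carrier BH" and h: "h \<in> carrier H"
  shows "op_conv BH (cocycle_op f) (cocycle_op g) z h = counit H h \<odot>\<^bsub>BH\<^esub> z"
proof (rule op_conv_counit_ext[OF modB modH cocycle_op_bilinear[OF f] cocycle_op_bilinear[OF g] _ z h])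
  fix b k assume b: "b \<in> carrier B" and k: "k \<in> carrier H"
  note F = cocycle_op_bilinear[OF f] and G = cocycle_op_bilinear[OF g]
  note rules = B_lins bilin_app1[OF f] bilin_app2[OF f] bilin_closed[OF f]
    bilin_app1[OF g] bilin_app2[OF g] bilin_closed[OF g]
    bilin_app1[OF F] bilin_app2[OF F] bilin_closed[OF F] bilin_app1[OF G] bilin_app2[OF G] bilin_closed[OF G]
  note ins = b k h
  have 1: "cocycle_op g (cocycle_op f (bh b k) h1) h2 =
    sw H BH k (\<lambda>k' k3. sw H BH k' (\<lambda>k1 k2. bh (b \<otimes>\<^bsub>B\<^esub> (f k1 h1 \<otimes>\<^bsub>B\<^esub> g k2 h2)) k3))"
    if h12: "h1 \<in> carrier H" "h2 \<in> carrier H" for h1 h2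
  proof -
    have "cocycle_op g (cocycle_op f (bh b k) h1) h2 =
      sw H BH k (\<lambda>k1 k'. cocycle_op g (bh (b \<otimes>\<^bsub>B\<^esub> f k1 h1) k') h2)"
      unfolding cocycle_op_tens[OF f b k h12(1)]
      by (rule sw_lin[OF modBH modBH _ _ k, where L = "\<lambda>z. cocycle_op g z h2"], insert ins h12)
        (assumption | rule rules)+
    also have "\<dots> = sw H BH k (\<lambda>k1 k'. sw H BH k' (\<lambda>k2 k3. bh (b \<otimes>\<^bsub>B\<^esub> (f k1 h1 \<otimes>\<^bsub>B\<^esub> g k2 h2)) k3))"
    proof (rule sw_cong[OF modBH _ _ k])
      show "(\<lambda>k1 k'. cocycle_op g (bh (b \<otimes>\<^bsub>B\<^esub> f k1 h1) k') h2) \<in> bilinear_maps R H H BH"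
        by (insert ins h12, (assumption | rule rules)+)
      fix k1 k' assume "k1 \<in> carrier H" "k' \<in> carrier H"
      note ins' = ins h12 this
      have "cocycle_op g (bh (b \<otimes>\<^bsub>B\<^esub> f k1 h1) k') h2 = sw H BH k' (\<lambda>k2 k3. bh (b \<otimes>\<^bsub>B\<^esub> f k1 h1 \<otimes>\<^bsub>B\<^esub> g k2 h2) k3)"
        by (rule cocycle_op_tens[OF g], insert ins') (assumption | rule rules)+
      also have "\<dots> = sw H BH k' (\<lambda>k2 k3. bh (b \<otimes>\<^bsub>B\<^esub> (f k1 h1 \<otimes>\<^bsub>B\<^esub> g k2 h2)) k3)"
        by (rule sw_cong[OF modBH], insert ins')
          ((assumption | rule rules)+, simp add: B.m_assoc bilin_closed[OF f] bilin_closed[OF g])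
      finally show "cocycle_op g (bh (b \<otimes>\<^bsub>B\<^esub> f k1 h1) k') h2 = \<dots>" .
    qed
    also have "\<dots> = sw H BH k (\<lambda>k' k3. sw H BH k' (\<lambda>k1 k2. bh (b \<otimes>\<^bsub>B\<^esub> (f k1 h1 \<otimes>\<^bsub>B\<^esub> g k2 h2)) k3))"
      by (rule sw_coassoc[OF modBH _ _ _ k, symmetric], insert ins h12) (assumption | rule rules)+
    finally show ?thesis .
  qed
  have "op_conv BH (cocycle_op f) (cocycle_op g) (bh b k) h =
    sw H BH h (\<lambda>h1 h2. sw H BH k (\<lambda>k' k3. sw H BH k' (\<lambda>k1 k2. bh (b \<otimes>\<^bsub>B\<^esub> (f k1 h1 \<otimes>\<^bsub>B\<^esub> g k2 h2)) k3)))"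
    unfolding op_conv_def
    by (rule sw_cong[OF modBH _ 1 h], insert ins) (assumption | rule rules)+
  also have "\<dots> = sw H BH k (\<lambda>k' k3. sw H BH h (\<lambda>h1 h2. sw H BH k' (\<lambda>k1 k2. bh (b \<otimes>\<^bsub>B\<^esub> (f k1 h1 \<otimes>\<^bsub>B\<^esub> g k2 h2)) k3)))"
    by (rule sw_swap[OF modBH _ _ h k], insert ins) (assumption | rule rules)+
  also have "\<dots> = sw H BH k (\<lambda>k' k3. counit H k' \<odot>\<^bsub>BH\<^esub> (counit H h \<odot>\<^bsub>BH\<^esub> bh b k3))"
  proof (rule sw_cong[OF modBH _ _ k])
    show "(\<lambda>k' k3. sw H BH h (\<lambda>h1 h2. sw H BH k' (\<lambda>k1 k2. bh (b \<otimes>\<^bsub>B\<^esub> (f k1 h1 \<otimes>\<^bsub>B\<^esub> g k2 h2)) k3))) \<in> bilinear_maps R H H BH"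
      by (insert ins, (assumption | rule rules)+)
    fix k' k3 assume k': "k' \<in> carrier H" and k3: "k3 \<in> carrier H"
    note ins' = ins k' k3
    have L: "(\<lambda>x. bh (b \<otimes>\<^bsub>B\<^esub> x) k3) \<in> linear_maps R B BH"
      by (insert ins', (assumption | rule rules)+)
    have "sw H BH h (\<lambda>h1 h2. sw H BH k' (\<lambda>k1 k2. bh (b \<otimes>\<^bsub>B\<^esub> (f k1 h1 \<otimes>\<^bsub>B\<^esub> g k2 h2)) k3)) =
      sw H BH k' (\<lambda>k1 k2. sw H BH h (\<lambda>h1 h2. bh (b \<otimes>\<^bsub>B\<^esub> (f k1 h1 \<otimes>\<^bsub>B\<^esub> g k2 h2)) k3))"
      by (rule sw_swap[OF modBH _ _ h k'], insert ins') (assumption | rule rules)+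
    also have "\<dots> = sw H BH k' (\<lambda>k1 k2. bh (b \<otimes>\<^bsub>B\<^esub> sw H B h (\<lambda>h1 h2. f k1 h1 \<otimes>\<^bsub>B\<^esub> g k2 h2)) k3)"
      by (rule sw_cong[OF modBH _ _ k'], insert ins')
        ((assumption | rule rules)+, rule sw_lin[OF modB modBH _ L h, symmetric], (assumption | rule rules)+)
    also have "\<dots> = bh (b \<otimes>\<^bsub>B\<^esub> sw H B k' (\<lambda>k1 k2. sw H B h (\<lambda>h1 h2. f k1 h1 \<otimes>\<^bsub>B\<^esub> g k2 h2))) k3"
      by (rule sw_lin[OF modB modBH _ L k', symmetric], insert ins') (assumption | rule rules)+
    also have "\<dots> = bh ((counit H k' \<otimes>\<^bsub>R\<^esub> counit H h) \<odot>\<^bsub>B\<^esub> b) k3"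
      using ins' by (simp add: inv B.smult_mult_right counit_closed)
    also have "\<dots> = counit H k' \<odot>\<^bsub>BH\<^esub> (counit H h \<odot>\<^bsub>BH\<^esub> bh b k3)"
    proof -
      interpret BHm: module R BH by (rule modBH)
      show ?thesis using ins'
        by (simp add: tens_smult_left[OF modB modH] counit_closed BHm.smult_assoc1 tens_closed[OF modB modH])
    qed
    finally show "sw H BH h (\<lambda>h1 h2. sw H BH k' (\<lambda>k1 k2. bh (b \<otimes>\<^bsub>B\<^esub> (f k1 h1 \<otimes>\<^bsub>B\<^esub> g k2 h2)) k3)) = \<dots>" .
  qed
  also have "\<dots> = counit H h \<odot>\<^bsub>BH\<^esub> bh b k"
    by (rule sw_counit_left[OF modBH _ k], insert ins) (assumption | rule rules)+
  finally show "op_conv BH (cocycle_op f) (cocycle_op g) (bh b k) h = counit H h \<odot>\<^bsub>BH\<^esub> bh b k" .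
qed

abbreviation "A \<equiv> crossed_prod R H B act \<sigma>"
abbreviation "cmult \<equiv> crossed_mult R H B act \<sigma>"

lemma A_simps: "carrier A = carrier BH" "add A = add BH" "\<zero>\<^bsub>A\<^esub> = \<zero>\<^bsub>BH\<^esub>" "smult A = smult BH"
    "monoid.mult A = cmult" "\<one>\<^bsub>A\<^esub> = bh \<one>\<^bsub>B\<^esub> \<one>\<^bsub>H\<^esub>"
  by (simp_all add: crossed_prod_def)

text \<open>
  The product \<open>(a # k)(1 # h)\<close>; the lemma \<open>cmult_one_left\<close> below identifies it.
\<close>

definition "cocycle_mult a k h = sw H BH k (\<lambda>k1 k2. sw H BH h (\<lambda>h1 h2. bh (a \<otimes>\<^bsub>B\<^esub> \<sigma> k1 h1) (k2 \<otimes>\<^bsub>H\<^esub> h2)))"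

lemmas c_lins = B_lins bilin_app1[OF cocycle_bilinear] bilin_app2[OF cocycle_bilinear] bilin_closed[OF cocycle_bilinear]

lemma cocycle_mult_lins:
  "k \<in> carrier H \<Longrightarrow> h \<in> carrier H \<Longrightarrow> g \<in> linear_maps R X B \<Longrightarrow> module R X \<Longrightarrow> (\<lambda>x. cocycle_mult (g x) k h) \<in> linear_maps R X BH"
  "a \<in> carrier B \<Longrightarrow> h \<in> carrier H \<Longrightarrow> g' \<in> linear_maps R X H \<Longrightarrow> (\<lambda>x. cocycle_mult a (g' x) h) \<in> linear_maps R X BH"
  "a \<in> carrier B \<Longrightarrow> k \<in> carrier H \<Longrightarrow> g' \<in> linear_maps R X H \<Longrightarrow> module R X \<Longrightarrow> (\<lambda>x. cocycle_mult a k (g' x)) \<in> linear_maps R X BH"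
  unfolding cocycle_mult_def
  subgoal by (rule lin_compose[of _ R B BH g X]) (assumption | rule c_lins)+
  subgoal by (rule lin_compose[of _ R H BH g' X]) (assumption | rule c_lins)+
  subgoal by (rule lin_compose[of _ R H BH g' X]) (assumption | rule c_lins)+
  done

lemma cocycle_mult_closed:
  "a \<in> carrier B \<Longrightarrow> k \<in> carrier H \<Longrightarrow> h \<in> carrier H \<Longrightarrow> cocycle_mult a k h \<in> carrier BH"
  unfolding cocycle_mult_def by (assumption | rule c_lins)+

lemma cmult_eq:
  "cmult X Y = tensor_lift BH (\<lambda>a k. tensor_lift BH (\<lambda>b h. sw H BH k (\<lambda>k1 k'. cocycle_mult (a \<otimes>\<^bsub>B\<^esub> act k1 b) k' h)) Y) X"
  unfolding crossed_mult_def Let_def cocycle_mult_def ..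

lemma cmult_inner_bilinear:
  assumes "a \<in> carrier B" "k \<in> carrier H"
  shows "(\<lambda>b h. sw H BH k (\<lambda>k1 k'. cocycle_mult (a \<otimes>\<^bsub>B\<^esub> act k1 b) k' h)) \<in> bilinear_maps R B H BH"
  by (insert assms, (assumption | rule cocycle_mult_lins cocycle_mult_closed c_lins)+)

lemma cmult_outer_bilinear:
  assumes "Y \<in> carrier BH"
  shows "(\<lambda>a k. tensor_lift BH (\<lambda>b h. sw H BH k (\<lambda>k1 k'. cocycle_mult (a \<otimes>\<^bsub>B\<^esub> act k1 b) k' h)) Y) \<in> bilinear_maps R B H BH"
proof (rule bilinI)
  show "(\<lambda>k. tensor_lift BH (\<lambda>b h. sw H BH k (\<lambda>k1 k'. cocycle_mult (a \<otimes>\<^bsub>B\<^esub> act k1 b) k' h)) Y) \<in> linear_maps R H BH"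
    if "a \<in> carrier B" for a
    by (rule lift_lin_fun[OF modB modH modBH modH cmult_inner_bilinear _ assms], insert that)
      (assumption | rule cocycle_mult_lins cocycle_mult_closed c_lins)+
  show "(\<lambda>a. tensor_lift BH (\<lambda>b h. sw H BH k (\<lambda>k1 k'. cocycle_mult (a \<otimes>\<^bsub>B\<^esub> act k1 b) k' h)) Y) \<in> linear_maps R B BH"
    if "k \<in> carrier H" for k
    by (rule lift_lin_fun[OF modB modH modBH modB cmult_inner_bilinear _ assms], insert that)
      (assumption | rule cocycle_mult_lins cocycle_mult_closed c_lins)+
qed

lemma cmult_bilinear: "cmult \<in> bilinear_maps R BH BH BH"
proof (rule bilinI)
  show "(\<lambda>X. cmult X Y) \<in> linear_maps R BH BH" if "Y \<in> carrier BH" for Y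
    unfolding cmult_eq by (rule lift_linear[OF modB modH modBH cmult_outer_bilinear[OF that]])
  show "cmult X \<in> linear_maps R BH BH" if "X \<in> carrier BH" for X
    unfolding cmult_eq[abs_def]
    by (rule lift_lin_fun[OF modB modH modBH modBH cmult_outer_bilinear _ that])
      (auto intro: lift_linear[OF modB modH modBH cmult_inner_bilinear])
qed

lemma cmult_tens:
  assumes "a \<in> carrier B" "k \<in> carrier H" "b \<in> carrier B" "h \<in> carrier H"
  shows "cmult (bh a k) (bh b h) = sw H BH k (\<lambda>k1 k'. cocycle_mult (a \<otimes>\<^bsub>B\<^esub> act k1 b) k' h)"
  unfolding cmult_eq using assms
  by (simp add: lift_tens[OF modB modH modBH cmult_outer_bilinear] lift_tens[OF modB modH modBH cmult_inner_bilinear]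
    tens_closed[OF modB modH])

lemma cmult_one_left:
  assumes a: "a \<in> carrier B" and k: "k \<in> carrier H" and h: "h \<in> carrier H"
  shows "cmult (bh a k) (bh \<one>\<^bsub>B\<^esub> h) = cocycle_mult a k h"
proof -
  have "cmult (bh a k) (bh \<one>\<^bsub>B\<^esub> h) = sw H BH k (\<lambda>k1 k'. cocycle_mult (a \<otimes>\<^bsub>B\<^esub> act k1 \<one>\<^bsub>B\<^esub>) k' h)"
    using assms by (simp add: cmult_tens)
  also have "\<dots> = sw H BH k (\<lambda>k1 k'. counit H k1 \<odot>\<^bsub>BH\<^esub> cocycle_mult a k' h)"
  proof (rule sw_cong[OF modBH _ _ k])
    show "(\<lambda>k1 k'. cocycle_mult (a \<otimes>\<^bsub>B\<^esub> act k1 \<one>\<^bsub>B\<^esub>) k' h) \<in> bilinear_maps R H H BH"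
      by (insert assms B.one_closed, (assumption | rule cocycle_mult_lins cocycle_mult_closed c_lins)+)
    fix k1 k' assume k': "k1 \<in> carrier H" "k' \<in> carrier H"
    then have "a \<otimes>\<^bsub>B\<^esub> act k1 \<one>\<^bsub>B\<^esub> = counit H k1 \<odot>\<^bsub>B\<^esub> a"
      using a by (simp add: act_one B.smult_mult_right counit_closed)
    then show "cocycle_mult (a \<otimes>\<^bsub>B\<^esub> act k1 \<one>\<^bsub>B\<^esub>) k' h = counit H k1 \<odot>\<^bsub>BH\<^esub> cocycle_mult a k' h"
      using lin_smult[OF cocycle_mult_lins(1)[OF k'(2) h lin_id modB] counit_closed[OF k'(1)] a] by simp
  qed
  also have "\<dots> = cocycle_mult a k h"
    by (rule sw_counit_left[OF modBH _ k]) (rule cocycle_mult_lins(2)[OF a h lin_id])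
  finally show ?thesis .
qed

lemma cocycle_mult_one:
  assumes a: "a \<in> carrier B" and h: "h \<in> carrier H"
  shows "cocycle_mult a \<one>\<^bsub>H\<^esub> h = sw H BH h (\<lambda>h1 h2. bh (a \<otimes>\<^bsub>B\<^esub> \<sigma> \<one>\<^bsub>H\<^esub> h1) h2)"
proof -
  have "cocycle_mult a \<one>\<^bsub>H\<^esub> h = sw H BH h (\<lambda>h1 h2. bh (a \<otimes>\<^bsub>B\<^esub> \<sigma> \<one>\<^bsub>H\<^esub> h1) (\<one>\<^bsub>H\<^esub> \<otimes>\<^bsub>H\<^esub> h2))"
    unfolding cocycle_mult_def by (rule sw_one[OF modBH], insert assms) (assumption | rule c_lins)+
  also have "\<dots> = sw H BH h (\<lambda>h1 h2. bh (a \<otimes>\<^bsub>B\<^esub> \<sigma> \<one>\<^bsub>H\<^esub> h1) h2)"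
    by (rule sw_cong[OF modBH _ _ h], insert a one_closed) ((assumption | rule c_lins)+, simp)
  finally show ?thesis .
qed

definition "counit_right_map M = tensor_lift M (\<lambda>x h. counit H h \<odot>\<^bsub>M\<^esub> x)"

lemma counit_right_map_bilinear: "module R M \<Longrightarrow> (\<lambda>x h. counit H h \<odot>\<^bsub>M\<^esub> x) \<in> bilinear_maps R M H M"
  by (assumption | rule bilinI lins)+

lemma counit_right_map_linear: "module R M \<Longrightarrow> counit_right_map M \<in> linear_maps R (tensor R M H) M"
  unfolding counit_right_map_def by (rule lift_linear[OF _ modH _ counit_right_map_bilinear])

lemma counit_right_map_tens: "module R M \<Longrightarrow> x \<in> carrier M \<Longrightarrow> h \<in> carrier H \<Longrightarrow>
    counit_right_map M (tens R M H x h) = counit H h \<odot>\<^bsub>M\<^esub> x"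
  unfolding counit_right_map_def by (rule lift_tens[OF _ modH _ counit_right_map_bilinear])

text \<open>
  The left unit law of the crossed product for \<open>1 # h\<close> reads
  \<open>\<sigma>(1, h\<^sub>(\<^sub>1\<^sub>)) # h\<^sub>(\<^sub>2\<^sub>) = 1 # h\<close>; applying the counit to the second factor gives the claim.
\<close>

lemma cocycle_one_left:
  assumes h: "h \<in> carrier H"
  shows "\<sigma> \<one>\<^bsub>H\<^esub> h = counit H h \<odot>\<^bsub>B\<^esub> \<one>\<^bsub>B\<^esub>"
proof -
  interpret A: Group.monoid A by (rule crossed_prod_monoid)
  note L = counit_right_map_linear[OF modB]
  note ins = h B.one_closed one_closed
  have "bh \<one>\<^bsub>B\<^esub> h = cmult (bh \<one>\<^bsub>B\<^esub> \<one>\<^bsub>H\<^esub>) (bh \<one>\<^bsub>B\<^esub> h)"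
    using A.l_one[of "bh \<one>\<^bsub>B\<^esub> h"] h by (simp add: A_simps tens_closed[OF modB modH])
  also have "\<dots> = sw H BH h (\<lambda>h1 h2. bh (\<one>\<^bsub>B\<^esub> \<otimes>\<^bsub>B\<^esub> \<sigma> \<one>\<^bsub>H\<^esub> h1) h2)"
    using h by (simp add: cmult_one_left cocycle_mult_one)
  finally have "counit_right_map B (bh \<one>\<^bsub>B\<^esub> h) = counit_right_map B \<dots>" by simp
  also have "\<dots> = sw H B h (\<lambda>h1 h2. counit_right_map B (bh (\<one>\<^bsub>B\<^esub> \<otimes>\<^bsub>B\<^esub> \<sigma> \<one>\<^bsub>H\<^esub> h1) h2))"
    by (rule sw_lin[OF modBH modB _ L h], insert ins) (assumption | rule c_lins)+
  also have "\<dots> = sw H B h (\<lambda>h1 h2. counit H h2 \<odot>\<^bsub>B\<^esub> \<sigma> \<one>\<^bsub>H\<^esub> h1)"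
    by (rule sw_cong[OF modB _ _ h], insert ins) ((assumption | rule c_lins lin_compose[OF L])+,
      simp add: counit_right_map_tens[OF modB] bilin_closed[OF cocycle_bilinear])
  also have "\<dots> = \<sigma> \<one>\<^bsub>H\<^esub> h"
    by (rule sw_counit_right[OF modB _ h]) (rule bilin1[OF cocycle_bilinear one_closed])
  finally show ?thesis using h by (simp add: counit_right_map_tens[OF modB])
qed

lemma cmult_base:
  assumes a: "a \<in> carrier B" and b: "b \<in> carrier B" and h: "h \<in> carrier H"
  shows "cmult (bh a \<one>\<^bsub>H\<^esub>) (bh b h) = bh (a \<otimes>\<^bsub>B\<^esub> b) h"
proof -
  note ins = a b h one_closed
  have ab: "a \<otimes>\<^bsub>B\<^esub> b \<in> carrier B" using a b by simp
  have "cmult (bh a \<one>\<^bsub>H\<^esub>) (bh b h) = cocycle_mult (a \<otimes>\<^bsub>B\<^esub> act \<one>\<^bsub>H\<^esub> b) \<one>\<^bsub>H\<^esub> h"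
    unfolding cmult_tens[OF a one_closed b h]
    by (rule sw_one[OF modBH], insert ins) (assumption | rule cocycle_mult_lins cocycle_mult_closed c_lins)+
  also have "\<dots> = sw H BH h (\<lambda>h1 h2. bh (a \<otimes>\<^bsub>B\<^esub> b \<otimes>\<^bsub>B\<^esub> \<sigma> \<one>\<^bsub>H\<^esub> h1) h2)"
    using a b h by (simp add: one_act cocycle_mult_one)
  also have "\<dots> = sw H BH h (\<lambda>h1 h2. counit H h1 \<odot>\<^bsub>BH\<^esub> bh (a \<otimes>\<^bsub>B\<^esub> b) h2)"
    by (rule sw_cong[OF modBH _ _ h], insert ins) ((assumption | rule c_lins)+,
      simp add: cocycle_one_left B.smult_mult_right tens_smult_left[OF modB modH] counit_closed)
  also have "\<dots> = bh (a \<otimes>\<^bsub>B\<^esub> b) h"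
    by (rule sw_counit_left[OF modBH _ h], insert ab) (assumption | rule c_lins)+
  finally show ?thesis .
qed

text \<open>
  Right multiplication by the value \<open>1 # h\<close> of the cleaving map.
\<close>

definition "cleaving_op z h = cmult z (bh \<one>\<^bsub>B\<^esub> h)"

lemma cleaving_op_bilinear: "cleaving_op \<in> bilinear_maps R BH H BH"
  unfolding cleaving_op_def[abs_def]
  by (insert B.one_closed, (assumption | rule c_lins bilin_app1[OF cmult_bilinear] bilin_app2[OF cmult_bilinear])+)

abbreviation "right_mul \<equiv> op_right B H mul_op"

lemmas right_mul_bilinear = op_right_bilinear[OF modB modH mul_op_bilinear(1)]
  op_right_bilinear[OF modB modH mul_op_bilinear(2)]

text \<open>
  Both sides are \<open>b \<sigma>(k\<^sub>(\<^sub>1\<^sub>), h\<^sub>(\<^sub>1\<^sub>)) # k\<^sub>(\<^sub>2\<^sub>) h\<^sub>(\<^sub>2\<^sub>)\<close> at \<open>z = b # k\<close>, up to the order of the two sums.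
\<close>

lemma cleaving_op_factor:
  assumes z: "z \<in> carrier BH" and h: "h \<in> carrier H"
  shows "cleaving_op z h = op_conv BH (cocycle_op \<sigma>) right_mul z h"
proof -
  note S = cocycle_op_bilinear[OF cocycle_bilinear]
  note rules = c_lins bilin_app1[OF S] bilin_app2[OF S] bilin_closed[OF S] bilin_app1[OF right_mul_bilinear(1)]
    bilin_app2[OF right_mul_bilinear(1)] bilin_closed[OF right_mul_bilinear(1)]
  show ?thesis
  proof (rule lin_ext[OF modB modH modBH bilin2[OF cleaving_op_bilinear h]
        op_conv_lin1[OF modBH S right_mul_bilinear(1) h] _ z])
    fix b k assume b: "b \<in> carrier B" and k: "k \<in> carrier H"
    note ins = b k h
    have "op_conv BH (cocycle_op \<sigma>) right_mul (bh b k) h =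
      sw H BH h (\<lambda>h1 h2. sw H BH k (\<lambda>k1 k2. bh (b \<otimes>\<^bsub>B\<^esub> \<sigma> k1 h1) (k2 \<otimes>\<^bsub>H\<^esub> h2)))"
      unfolding op_conv_def
    proof (rule sw_cong[OF modBH _ _ h])
      show "(\<lambda>h1. right_mul (cocycle_op \<sigma> (bh b k) h1)) \<in> bilinear_maps R H H BH"
        by (insert ins, (assumption | rule rules)+)
      fix h1 h2 assume h12: "h1 \<in> carrier H" "h2 \<in> carrier H"
      have "right_mul (cocycle_op \<sigma> (bh b k) h1) h2 = sw H BH k (\<lambda>k1 k2. right_mul (bh (b \<otimes>\<^bsub>B\<^esub> \<sigma> k1 h1) k2) h2)"
        unfolding cocycle_op_tens[OF cocycle_bilinear b k h12(1)]
        by (rule sw_lin[OF modBH modBH _ _ k, where L = "\<lambda>z. right_mul z h2"], insert ins h12) (assumption | rule rules)+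
      also have "\<dots> = sw H BH k (\<lambda>k1 k2. bh (b \<otimes>\<^bsub>B\<^esub> \<sigma> k1 h1) (k2 \<otimes>\<^bsub>H\<^esub> h2))"
        by (rule sw_cong[OF modBH _ _ k], insert ins h12) ((assumption | rule rules)+,
         simp add: op_right_tens[OF modB modH mul_op_bilinear(1)] mul_op_def bilin_closed[OF cocycle_bilinear])
      finally show "right_mul (cocycle_op \<sigma> (bh b k) h1) h2 = \<dots>" .
    qed
    also have "\<dots> = cocycle_mult b k h"
      unfolding cocycle_mult_def
      by (rule sw_swap[OF modBH _ _ h k], insert ins) (assumption | rule rules)+
    also have "\<dots> = cleaving_op (bh b k) h"
      unfolding cleaving_op_def by (rule cmult_one_left[OF b k h, symmetric])
    finally show "cleaving_op (bh b k) h = op_conv BH (cocycle_op \<sigma>) right_mul (bh b k) h" ..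
  qed
qed

lemma cocycle_inverse_obtain:
  obtains \<tau> where "\<tau> \<in> bilinear_maps R H H B"
   "\<And>z h. z \<in> carrier BH \<Longrightarrow> h \<in> carrier H \<Longrightarrow> op_conv BH (cocycle_op \<sigma>) (cocycle_op \<tau>) z h = counit H h \<odot>\<^bsub>BH\<^esub> z"
   "\<And>z h. z \<in> carrier BH \<Longrightarrow> h \<in> carrier H \<Longrightarrow> op_conv BH (cocycle_op \<tau>) (cocycle_op \<sigma>) z h = counit H h \<odot>\<^bsub>BH\<^esub> z"
proof -
  obtain \<tau> where t: "\<tau> \<in> bilinear_maps R H H B" and inv: "\<forall>h\<in>carrier H. \<forall>k\<in>carrier H.
        sw H B h (\<lambda>h1 h2. sw H B k (\<lambda>k1 k2. \<sigma> h1 k1 \<otimes>\<^bsub>B\<^esub> \<tau> h2 k2)) =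
          (counit H h \<otimes>\<^bsub>R\<^esub> counit H k) \<odot>\<^bsub>B\<^esub> \<one>\<^bsub>B\<^esub> \<and>
        sw H B h (\<lambda>h1 h2. sw H B k (\<lambda>k1 k2. \<tau> h1 k1 \<otimes>\<^bsub>B\<^esub> \<sigma> h2 k2)) =
          (counit H h \<otimes>\<^bsub>R\<^esub> counit H k) \<odot>\<^bsub>B\<^esub> \<one>\<^bsub>B\<^esub>"
    using cocycle_invertible unfolding conv_invertible_def by (elim bexE) (rule that)
  show ?thesis
    by (rule that[OF t cocycle_op_inverse[OF cocycle_bilinear t] cocycle_op_inverse[OF t cocycle_bilinear]])
      (use inv in auto)
qed

abbreviation "galois_map \<equiv> twist BH cleaving_op"

lemma galois_map_factor:
  assumes z: "z \<in> carrier (tensor R BH H)"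
  shows "galois_map z = twist BH right_mul (twist BH (cocycle_op \<sigma>) z)"
proof -
  note S = cocycle_op_bilinear[OF cocycle_bilinear]
  note c = op_conv_bilinear[OF modBH S right_mul_bilinear(1)]
  have "galois_map z = twist BH (op_conv BH (cocycle_op \<sigma>) right_mul) z"
  proof (rule lin_ext[OF modBH modH _ twist_linear[OF modBH cleaving_op_bilinear] twist_linear[OF modBH c] _ z])
    show T: "module R (tensor R BH H)" by (rule tensor_is_module[OF modBH modH])
    fix x h assume xh: "x \<in> carrier BH" "h \<in> carrier H"
    show "galois_map (tens R BH H x h) = twist BH (op_conv BH (cocycle_op \<sigma>) right_mul) (tens R BH H x h)"
      unfolding twist_tens[OF modBH cleaving_op_bilinear xh] twist_tens[OF modBH c xh]
      by (rule sw_cong[OF T _ _ xh(2)], insert xh) ((assumption | rule c_lins bilin_app2[OF cleaving_op_bilinear]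
         bilin_closed[OF cleaving_op_bilinear])+, simp add: cleaving_op_factor)
  qed
  then show ?thesis using twist_op_conv[OF modBH S right_mul_bilinear(1) z] by simp
qed

lemma galois_map_linear: "galois_map \<in> linear_maps R (tensor R BH H) (tensor R BH H)"
  by (rule twist_linear[OF modBH cleaving_op_bilinear])

lemma galois_map_bij: "bij_betw galois_map (carrier (tensor R BH H)) (carrier (tensor R BH H))"
proof -
  note S = cocycle_op_bilinear[OF cocycle_bilinear]
  obtain \<tau> where t: "\<tau> \<in> bilinear_maps R H H B"
   "\<And>z h. z \<in> carrier BH \<Longrightarrow> h \<in> carrier H \<Longrightarrow> op_conv BH (cocycle_op \<sigma>) (cocycle_op \<tau>) z h = counit H h \<odot>\<^bsub>BH\<^esub> z"
   "\<And>z h. z \<in> carrier BH \<Longrightarrow> h \<in> carrier H \<Longrightarrow> op_conv BH (cocycle_op \<tau>) (cocycle_op \<sigma>) z h = counit H h \<odot>\<^bsub>BH\<^esub> z"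
    by (rule cocycle_inverse_obtain[OF that])
  have 1: "bij_betw (twist BH (cocycle_op \<sigma>)) (carrier (tensor R BH H)) (carrier (tensor R BH H))"
    by (rule twist_bij[OF modBH S cocycle_op_bilinear[OF t(1)] t(2,3)])
  have 2: "bij_betw (twist BH right_mul) (carrier (tensor R BH H)) (carrier (tensor R BH H))"
    by (rule twist_bij[OF modBH right_mul_bilinear op_right_inverse[OF modB modH mul_op_bilinear(1,2) mul_op_inverse(1)]
      op_right_inverse[OF modB modH mul_op_bilinear(2,1) mul_op_inverse(2)]])
  show ?thesis
    using bij_betw_trans[OF 1 2] by (rule bij_betw_cong[THEN iffD1, rotated]) (simp add: galois_map_factor)
qed

end

section \<open>The cotensor product\<close>

lemma tensor_cong_left:
  fixes M :: "('r, 'm, 'x) module_scheme" and M' :: "('r, 'm, 'y) module_scheme"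
  assumes "carrier M = carrier M'" "add M = add M'" "smult M = smult M'"
  shows "tensor R M N = tensor R M' N" "tens R M N = tens R M' N"
  using assms
  by (simp_all add: tensor_def bal_tensor_def bal_group_def bal_null_def bal_rels_def tens_def bal_tens_def fun_eq_iff)

lemma lin_diff:
  assumes N: "module R N" and f: "f \<in> linear_maps R M N" and g: "g \<in> linear_maps R M N"
  shows "(\<lambda>x. f x \<ominus>\<^bsub>N\<^esub> g x) \<in> linear_maps R M N"
proof -
  interpret N: module R N by fact
  have *: "a \<oplus>\<^bsub>N\<^esub> b \<ominus>\<^bsub>N\<^esub> (c \<oplus>\<^bsub>N\<^esub> d) = a \<ominus>\<^bsub>N\<^esub> c \<oplus>\<^bsub>N\<^esub> (b \<ominus>\<^bsub>N\<^esub> d)"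
    if "a \<in> carrier N" "b \<in> carrier N" "c \<in> carrier N" "d \<in> carrier N" for a b c d
    using that by (simp add: N.minus_eq N.minus_add N.a_ac)
  show ?thesis
    by (rule linI) (simp_all add: lin_closed[OF f] lin_closed[OF g] lin_add[OF f] lin_add[OF g]
      lin_smult[OF f] lin_smult[OF g] *[unfolded N.minus_eq] N.smult_r_distr N.smult_r_minus N.minus_eq)
qed

context crossed_product
begin

lemma tensor_A: "tensor R A N = tensor R BH N" "tens R A N = tens R BH N"
  by (rule tensor_cong_left; simp add: A_simps)+

abbreviation "AH \<equiv> tensor R BH H"
abbreviation "ah \<equiv> tens R BH H"

abbreviation "incl \<equiv> map_left R BH H (\<lambda>x. x)"
abbreviation "sub S \<equiv> BH\<lparr>carrier := S\<rparr>"

lemma modAH: "module R AH"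
  by (rule tensor_is_module[OF modBH modH])

abbreviation "coact \<equiv> crossed_coact R H B act \<sigma>"

lemma coact_eq: "coact = tensor_lift AH (\<lambda>b h. sw H AH h (\<lambda>h1 h2. ah (bh b h1) h2))"
  by (simp add: crossed_coact_def Let_def tensor_A)

lemma coact_bilinear: "(\<lambda>b h. sw H AH h (\<lambda>h1 h2. ah (bh b h1) h2)) \<in> bilinear_maps R B H AH"
  by (insert modAH, (assumption | rule c_lins)+)

lemma coact_linear: "coact \<in> linear_maps R BH AH"
  unfolding coact_eq by (rule lift_linear[OF modB modH modAH coact_bilinear])

lemma coact_tens: "b \<in> carrier B \<Longrightarrow> h \<in> carrier H \<Longrightarrow> coact (bh b h) = sw H AH h (\<lambda>h1 h2. ah (bh b h1) h2)"
  unfolding coact_eq by (rule lift_tens[OF modB modH modAH coact_bilinear])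

end

locale crossed_quotient = crossed_product R H B act \<sigma> + right_ideal_quotient R H I
  for R (structure) and H :: "('r, 'h, 'x) hopf_scheme" (structure)
    and B :: "('r, 'b, 'y) module_scheme" (structure) and act \<sigma> I
begin

abbreviation "AQ \<equiv> tensor R BH Q"
abbreviation "aq \<equiv> tens R BH Q"
abbreviation "AQH \<equiv> tensor R AQ H"
abbreviation "aqh \<equiv> tens R AQ H"

lemma modAQ: "module R AQ"
  by (rule tensor_is_module[OF modBH modQ])

lemma modAQH: "module R AQH"
  by (rule tensor_is_module[OF modAQ modH])

lemmas q_lins = c_lins modQ modAQ modAQH modAH lin_compose[OF pr_linear] lin_closed[OF pr_linear]

definition "qcoact z = tensor_map R BH H Q pr (coact z)"
definition "qtriv z = aq z (pr \<one>\<^bsub>H\<^esub>)"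

lemma qcoact_linear: "qcoact \<in> linear_maps R BH AQ"
  unfolding qcoact_def[abs_def]
  by (rule lin_compose[OF tensor_map_linear[OF modBH modH modQ pr_linear] coact_linear])

lemma qtriv_linear: "qtriv \<in> linear_maps R BH AQ"
  unfolding qtriv_def[abs_def] by (insert one_closed, (assumption | rule q_lins)+)

lemma qcoact_tens:
  assumes b: "b \<in> carrier B" and h: "h \<in> carrier H"
  shows "qcoact (bh b h) = sw H AQ h (\<lambda>h1 h2. aq (bh b h1) (pr h2))"
proof -
  note L = tensor_map_linear[OF modBH modH modQ pr_linear]
  have "qcoact (bh b h) = sw H AQ h (\<lambda>h1 h2. tensor_map R BH H Q pr (ah (bh b h1) h2))"
    unfolding qcoact_def coact_tens[OF b h]
    by (rule sw_lin[OF modAH modAQ _ L h], insert b) (assumption | rule q_lins)+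
  also have "\<dots> = sw H AQ h (\<lambda>h1 h2. aq (bh b h1) (pr h2))"
    by (rule sw_cong[OF modAQ _ _ h], insert b) ((assumption | rule q_lins lin_compose[OF L])+,
     simp add: tensor_map_tens[OF modBH modH modQ pr_linear] tens_closed[OF modB modH])
  finally show ?thesis .
qed

abbreviation "opL f \<equiv> op_left BH Q f"
abbreviation "opR \<equiv> op_right BH Q quot_op"

lemmas opR_bilinear = op_right_bilinear[OF modBH modQ quot_op_bilinear]

text \<open>
  The coaction \<open>b # k \<mapsto> (b # k\<^sub>(\<^sub>1\<^sub>)) \<otimes> \<pi>(k\<^sub>(\<^sub>2\<^sub>))\<close> splits off the last tensorand of the iterated coproduct of
  \<open>k\<close> and the cocycle operator uses the first, so that they commute by coassociativity.
\<close>

lemma qcoact_cocycle_op: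
  assumes z: "z \<in> carrier BH" and h: "h \<in> carrier H"
  shows "qcoact (cocycle_op \<sigma> z h) = opL (cocycle_op \<sigma>) (qcoact z) h"
proof -
  note S = cocycle_op_bilinear[OF cocycle_bilinear]
  note O = op_left_bilinear[OF modBH modQ S]
  note rules = q_lins bilin_app1[OF S] bilin_app2[OF S] bilin_closed[OF S] bilin_app1[OF O] bilin_app2[OF O] bilin_closed[OF O]
    lin_compose[OF qcoact_linear]
  show ?thesis
  proof (rule lin_ext[OF modB modH modAQ lin_compose[OF qcoact_linear bilin2[OF S h]]
      lin_compose[OF bilin2[OF O h] qcoact_linear] _ z])
    fix b k assume b: "b \<in> carrier B" and k: "k \<in> carrier H"
    note ins = b k h
    have "qcoact (cocycle_op \<sigma> (bh b k) h) = sw H AQ k (\<lambda>k1 k'. qcoact (bh (b \<otimes>\<^bsub>B\<^esub> \<sigma> k1 h) k'))"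
      unfolding cocycle_op_tens[OF cocycle_bilinear b k h]
      by (rule sw_lin[OF modBH modAQ _ qcoact_linear k], insert ins) (assumption | rule rules)+
    also have "\<dots> = sw H AQ k (\<lambda>k1 k'. sw H AQ k' (\<lambda>k2 k3. aq (bh (b \<otimes>\<^bsub>B\<^esub> \<sigma> k1 h) k2) (pr k3)))"
      by (rule sw_cong[OF modAQ _ _ k], insert ins) ((assumption | rule rules)+,
        simp add: qcoact_tens bilin_closed[OF cocycle_bilinear])
    also have "\<dots> = sw H AQ k (\<lambda>k' k3. sw H AQ k' (\<lambda>k1 k2. aq (bh (b \<otimes>\<^bsub>B\<^esub> \<sigma> k1 h) k2) (pr k3)))"
      by (rule sw_coassoc[OF modAQ _ _ _ k, symmetric], insert ins) (assumption | rule rules)+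
    also have "\<dots> = sw H AQ k (\<lambda>k' k3. opL (cocycle_op \<sigma>) (aq (bh b k') (pr k3)) h)"
    proof (rule sw_cong[OF modAQ _ _ k])
      show "(\<lambda>k' k3. sw H AQ k' (\<lambda>k1 k2. aq (bh (b \<otimes>\<^bsub>B\<^esub> \<sigma> k1 h) k2) (pr k3))) \<in> bilinear_maps R H H AQ"
        by (insert ins, (assumption | rule rules)+)
      fix k' k3 assume k': "k' \<in> carrier H" "k3 \<in> carrier H"
      have "sw H AQ k' (\<lambda>k1 k2. aq (bh (b \<otimes>\<^bsub>B\<^esub> \<sigma> k1 h) k2) (pr k3)) =
        aq (sw H BH k' (\<lambda>k1 k2. bh (b \<otimes>\<^bsub>B\<^esub> \<sigma> k1 h) k2)) (pr k3)"
        by (rule sw_lin[OF modBH modAQ _ _ k'(1), symmetric, where L = "\<lambda>z. aq z (pr k3)"], insert ins k')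
          (assumption | rule rules)+
      then show "sw H AQ k' (\<lambda>k1 k2. aq (bh (b \<otimes>\<^bsub>B\<^esub> \<sigma> k1 h) k2) (pr k3)) = opL (cocycle_op \<sigma>) (aq (bh b k') (pr k3)) h"
        using ins k' by (simp add: op_left_tens[OF modBH modQ S] cocycle_op_tens[OF cocycle_bilinear]
          tens_closed[OF modB modH] lin_closed[OF pr_linear])
    qed
    also have "\<dots> = opL (cocycle_op \<sigma>) (qcoact (bh b k)) h"
      unfolding qcoact_tens[OF b k]
      by (rule sw_lin[OF modAQ modAQ _ _ k, symmetric, where L = "\<lambda>z. opL (cocycle_op \<sigma>) z h"], insert ins)
          (assumption | rule rules)+
    finally show "qcoact (cocycle_op \<sigma> (bh b k) h) = opL (cocycle_op \<sigma>) (qcoact (bh b k)) h" .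
  qed
qed

text \<open>
  Here multiplicativity of the coproduct and right \<open>H\<close>-linearity of \<open>\<pi>\<close> enter; they produce the
  additional factor \<open>opR\<close> that acts on \<open>Q\<close>.
\<close>

lemma qcoact_right_mul:
  assumes z: "z \<in> carrier BH" and h: "h \<in> carrier H"
  shows "qcoact (right_mul z h) = op_conv AQ (opL right_mul) opR (qcoact z) h"
proof -
  note S = right_mul_bilinear(1)
  note O = op_left_bilinear[OF modBH modQ S]
  note C = op_conv_bilinear[OF modAQ O opR_bilinear]
  note rules = q_lins bilin_app1[OF S] bilin_app2[OF S] bilin_closed[OF S] bilin_app1[OF O] bilin_app2[OF O] bilin_closed[OF O]
    bilin_app1[OF opR_bilinear] bilin_app2[OF opR_bilinear] bilin_closed[OF opR_bilinear]
    lin_compose[OF qcoact_linear]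
  show ?thesis
  proof (rule lin_ext[OF modB modH modAQ lin_compose[OF qcoact_linear bilin2[OF S h]]
      lin_compose[OF bilin2[OF C h] qcoact_linear] _ z])
    fix b k assume b: "b \<in> carrier B" and k: "k \<in> carrier H"
    note ins = b k h
    have "qcoact (right_mul (bh b k) h) = sw H AQ (k \<otimes>\<^bsub>H\<^esub> h) (\<lambda>u v. aq (bh b u) (pr v))"
      using b k h by (simp add: op_right_tens[OF modB modH mul_op_bilinear(1)] mul_op_def qcoact_tens)
    also have "\<dots> = sw H AQ k (\<lambda>k1 k2. sw H AQ h (\<lambda>h1 h2. aq (bh b (k1 \<otimes>\<^bsub>H\<^esub> h1)) (pr (k2 \<otimes>\<^bsub>H\<^esub> h2))))"
      by (rule sw_mult[OF modAQ _ k h], insert ins) (assumption | rule rules)+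
    also have "\<dots> = sw H AQ h (\<lambda>h1 h2. sw H AQ k (\<lambda>k1 k2. aq (bh b (k1 \<otimes>\<^bsub>H\<^esub> h1)) (pr (k2 \<otimes>\<^bsub>H\<^esub> h2))))"
      by (rule sw_swap[OF modAQ _ _ k h], insert ins) (assumption | rule rules)+
    also have "\<dots> = sw H AQ h (\<lambda>h1 h2. opR (opL right_mul (qcoact (bh b k)) h1) h2)"
    proof (rule sw_cong[OF modAQ _ _ h])
      show "(\<lambda>h1 h2. sw H AQ k (\<lambda>k1 k2. aq (bh b (k1 \<otimes>\<^bsub>H\<^esub> h1)) (pr (k2 \<otimes>\<^bsub>H\<^esub> h2)))) \<in> bilinear_maps R H H AQ"
        by (insert ins, (assumption | rule rules)+)
      fix h1 h2 assume h12: "h1 \<in> carrier H" "h2 \<in> carrier H"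
      have "opR (opL right_mul (qcoact (bh b k)) h1) h2 = sw H AQ k (\<lambda>k1 k2. opR (opL right_mul (aq (bh b k1) (pr k2)) h1) h2)"
        unfolding qcoact_tens[OF b k]
        by (rule sw_lin[OF modAQ modAQ _ _ k, where L = "\<lambda>z. opR (opL right_mul z h1) h2"], insert ins h12)
          (assumption | rule rules)+
      also have "\<dots> = sw H AQ k (\<lambda>k1 k2. aq (bh b (k1 \<otimes>\<^bsub>H\<^esub> h1)) (pr (k2 \<otimes>\<^bsub>H\<^esub> h2)))"
        by (rule sw_cong[OF modAQ _ _ k], insert ins h12) ((assumption | rule rules)+,
          simp add: op_left_tens[OF modBH modQ S] op_right_tens[OF modBH modQ quot_op_bilinear]
           op_right_tens[OF modB modH mul_op_bilinear(1)] tens_closed[OF modB modH] lin_closed[OF pr_linear]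
           mul_op_def quot_op_pr)
      finally show "sw H AQ k (\<lambda>k1 k2. aq (bh b (k1 \<otimes>\<^bsub>H\<^esub> h1)) (pr (k2 \<otimes>\<^bsub>H\<^esub> h2))) =
        opR (opL right_mul (qcoact (bh b k)) h1) h2" ..
    qed
    finally show "qcoact (right_mul (bh b k) h) = op_conv AQ (opL right_mul) opR (qcoact (bh b k)) h"
      by (simp add: op_conv_def)
  qed
qed

lemma qtriv_op:
  assumes m: "m \<in> bilinear_maps R BH H BH" and z: "z \<in> carrier BH" and h: "h \<in> carrier H"
  shows "qtriv (m z h) = opL m (qtriv z) h"
  using z h one_closed by (simp add: qtriv_def op_left_tens[OF modBH modQ m] lin_closed[OF pr_linear])

text \<open>
  The cotensor product is the equaliser of \<open>coact_first\<close> and \<open>coact_second\<close>, while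
  \<open>coact_first\<close> and \<open>triv_first\<close> arise from the two maps \<open>A \<rightarrow> A \<otimes> Q\<close> whose equaliser is the algebra
  of coinvariants.
\<close>

abbreviation "coact_first \<equiv> map_left R AQ H qcoact"
abbreviation "triv_first \<equiv> map_left R AQ H qtriv"
definition "coact_second = tensor_lift AQH (\<lambda>z h. sw H AQH h (\<lambda>h1 h2. aqh (aq z (pr h1)) h2))"

text \<open>
  The analogue of the Galois map on \<open>A \<otimes> Q \<otimes> H\<close>, namely
  \<open>a \<otimes> q \<otimes> h \<mapsto> a (1 # h\<^sub>(\<^sub>1\<^sub>)) \<otimes> q h\<^sub>(\<^sub>2\<^sub>) \<otimes> h\<^sub>(\<^sub>3\<^sub>)\<close>.
\<close>

definition "quot_twist z = twist AQ opR (twist AQ (opL right_mul) (twist AQ (opL (cocycle_op \<sigma>)) z))"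

lemma coact_first_linear: "coact_first \<in> linear_maps R AH AQH"
  by (rule map_left_linear[OF modBH modAQ modH qcoact_linear])

lemma triv_first_linear: "triv_first \<in> linear_maps R AH AQH"
  by (rule map_left_linear[OF modBH modAQ modH qtriv_linear])

lemma coact_first_galois_map:
  assumes y: "y \<in> carrier AH"
  shows "coact_first (galois_map y) = quot_twist (coact_first y)"
proof -
  note S = cocycle_op_bilinear[OF cocycle_bilinear] and S' = right_mul_bilinear(1)
  note O = op_left_bilinear[OF modBH modQ S] and O' = op_left_bilinear[OF modBH modQ S']
  have y': "twist BH (cocycle_op \<sigma>) y \<in> carrier AH"
    by (rule lin_closed[OF twist_linear[OF modBH S] y])
  note C = op_conv_bilinear[OF modAQ O' opR_bilinear]
  have "coact_first (twist BH right_mul (twist BH (cocycle_op \<sigma>) y)) =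
      twist AQ (op_conv AQ (opL right_mul) opR) (coact_first (twist BH (cocycle_op \<sigma>) y))"
    using twist_intertwine[OF modBH S' modAQ C qcoact_linear _ y'] qcoact_right_mul by blast
  then have "coact_first (galois_map y) = twist AQ (op_conv AQ (opL right_mul) opR) (coact_first (twist BH (cocycle_op \<sigma>) y))"
    by (simp only: galois_map_factor[OF y])
  moreover have "twist AQ (op_conv AQ (opL right_mul) opR) (coact_first (twist BH (cocycle_op \<sigma>) y)) =
      twist AQ opR (twist AQ (opL right_mul) (coact_first (twist BH (cocycle_op \<sigma>) y)))"
    by (rule twist_op_conv[OF modAQ O' opR_bilinear lin_closed[OF coact_first_linear y']])
  moreover have "coact_first (twist BH (cocycle_op \<sigma>) y) = twist AQ (opL (cocycle_op \<sigma>)) (coact_first y)"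
    using twist_intertwine[OF modBH S modAQ O qcoact_linear _ y] qcoact_cocycle_op by blast
  ultimately show ?thesis by (simp only: quot_twist_def)
qed

lemma coact_second_bilinear: "(\<lambda>z h. sw H AQH h (\<lambda>h1 h2. aqh (aq z (pr h1)) h2)) \<in> bilinear_maps R BH H AQH"
  by (assumption | rule q_lins)+

lemma coact_second_linear: "coact_second \<in> linear_maps R AH AQH"
  unfolding coact_second_def by (rule lift_linear[OF modBH modH modAQH coact_second_bilinear])

text \<open>
  Twisting the trivial coaction \<open>a \<otimes> \<pi>(1) \<otimes> h\<close> by right multiplication on \<open>Q\<close> produces
  \<open>a \<otimes> \<pi>(h\<^sub>(\<^sub>1\<^sub>)) \<otimes> h\<^sub>(\<^sub>2\<^sub>)\<close>.  This is the reason why \<open>coact_second\<close> and \<open>triv_first\<close> correspond to each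
  other under the Galois map.
\<close>

lemma coact_second_eq:
  assumes y: "y \<in> carrier AH"
  shows "coact_second y = twist AQ opR (triv_first y)"
proof (rule lin_ext[OF modBH modH modAQH coact_second_linear lin_compose[OF twist_linear[OF modAQ opR_bilinear] triv_first_linear] _ y])
  fix z h assume z: "z \<in> carrier BH" and h: "h \<in> carrier H"
  have "coact_second (ah z h) = sw H AQH h (\<lambda>h1 h2. aqh (aq z (pr h1)) h2)"
    unfolding coact_second_def by (rule lift_tens[OF modBH modH modAQH coact_second_bilinear z h])
  also have "\<dots> = sw H AQH h (\<lambda>h1 h2. aqh (opR (qtriv z) h1) h2)"
    by (rule sw_cong[OF modAQH _ _ h], insert z) ((assumption | rule q_lins)+,
      simp add: qtriv_def op_right_tens[OF modBH modQ quot_op_bilinear] lin_closed[OF pr_linear] quot_op_pr)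
  also have "\<dots> = twist AQ opR (triv_first (ah z h))"
    using z h by (simp add: map_left_tens[OF modBH modAQ modH qtriv_linear] twist_tens[OF modAQ opR_bilinear]
      lin_closed[OF qtriv_linear])
  finally show "coact_second (ah z h) = twist AQ opR (triv_first (ah z h))" .
qed

lemma coact_second_galois_map:
  assumes y: "y \<in> carrier AH"
  shows "coact_second (galois_map y) = quot_twist (triv_first y)"
proof -
  note S = cocycle_op_bilinear[OF cocycle_bilinear] and S' = right_mul_bilinear(1)
  note O = op_left_bilinear[OF modBH modQ S] and O' = op_left_bilinear[OF modBH modQ S']
  have y': "twist BH (cocycle_op \<sigma>) y \<in> carrier AH"
    by (rule lin_closed[OF twist_linear[OF modBH S] y])
  have "coact_second (galois_map y) = twist AQ opR (triv_first (galois_map y))"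
    by (rule coact_second_eq[OF lin_closed[OF galois_map_linear y]])
  moreover have "triv_first (twist BH right_mul (twist BH (cocycle_op \<sigma>) y)) =
      twist AQ (opL right_mul) (triv_first (twist BH (cocycle_op \<sigma>) y))"
    using twist_intertwine[OF modBH S' modAQ O' qtriv_linear _ y'] qtriv_op[OF S'] by blast
  moreover have "triv_first (twist BH (cocycle_op \<sigma>) y) = twist AQ (opL (cocycle_op \<sigma>)) (triv_first y)"
    using twist_intertwine[OF modBH S modAQ O qtriv_linear _ y] qtriv_op[OF S] by blast
  ultimately show ?thesis by (simp only: quot_twist_def galois_map_factor[OF y])
qed

lemma quot_twist_inj: "inj_on quot_twist (carrier AQH)"
proof -
  note S = cocycle_op_bilinear[OF cocycle_bilinear] and S' = right_mul_bilinear(1)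
  note O = op_left_bilinear[OF modBH modQ S] and O' = op_left_bilinear[OF modBH modQ S']
  obtain \<tau> where t: "\<tau> \<in> bilinear_maps R H H B"
   "\<And>z h. z \<in> carrier BH \<Longrightarrow> h \<in> carrier H \<Longrightarrow> op_conv BH (cocycle_op \<sigma>) (cocycle_op \<tau>) z h = counit H h \<odot>\<^bsub>BH\<^esub> z"
   "\<And>z h. z \<in> carrier BH \<Longrightarrow> h \<in> carrier H \<Longrightarrow> op_conv BH (cocycle_op \<tau>) (cocycle_op \<sigma>) z h = counit H h \<odot>\<^bsub>BH\<^esub> z"
    by (rule cocycle_inverse_obtain[OF that])
  note T = cocycle_op_bilinear[OF t(1)]
  have 1: "inj_on (twist AQ (opL (cocycle_op \<sigma>))) (carrier AQH)"
    by (rule twist_inj[OF modAQ O op_left_bilinear[OF modBH modQ T] op_left_inverse[OF modBH modQ S T t(2)]])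
  have 2: "inj_on (twist AQ (opL right_mul)) (carrier AQH)"
    by (rule twist_inj[OF modAQ O' op_left_bilinear[OF modBH modQ right_mul_bilinear(2)]
      op_left_inverse[OF modBH modQ right_mul_bilinear
        op_right_inverse[OF modB modH mul_op_bilinear(1,2) mul_op_inverse(1)]]])
  have 3: "inj_on (twist AQ opR) (carrier AQH)"
    by (rule twist_inj[OF modAQ opR_bilinear op_right_bilinear[OF modBH modQ quot_antipode_op_bilinear]
      op_right_inverse[OF modBH modQ quot_op_bilinear quot_antipode_op_bilinear quot_op_inverse]])
  show ?thesis
    using 1 2 3 lin_closed[OF twist_linear[OF modAQ O]] lin_closed[OF twist_linear[OF modAQ O']]
    unfolding quot_twist_def[abs_def] inj_on_def by meson
qed

lemma cotensor_galois_map: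
  assumes y: "y \<in> carrier AH"
  shows "coact_first (galois_map y) = coact_second (galois_map y) \<longleftrightarrow> coact_first y = triv_first y"
  using coact_first_galois_map[OF y] coact_second_galois_map[OF y] inj_onD[OF quot_twist_inj] lin_closed[OF coact_first_linear y] lin_closed[OF triv_first_linear y]
  by metis

abbreviation "cotens \<equiv> cotensor R H A coact I"

lemma cotensor_simps:
  "carrier cotens = {z \<in> carrier AH. coact_first z = coact_second z}" "add cotens = add AH" "smult cotens = smult AH"
  by (simp_all add: cotensor_def Let_def tensor_A tensor_map_def coact_second_def qcoact_def[abs_def] flip: Q_def pr_def)

lemma cotensor_image: "carrier cotens = galois_map ` {y \<in> carrier AH. coact_first y = triv_first y}"
proof -
  have G: "galois_map ` carrier AH = carrier AH" using galois_map_bij by (simp add: bij_betw_def)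
  have "carrier cotens = {z \<in> galois_map ` carrier AH. coact_first z = coact_second z}"
    unfolding cotensor_simps G ..
  also have "\<dots> = galois_map ` {y \<in> carrier AH. coact_first (galois_map y) = coact_second (galois_map y)}"
    by blast
  also have "{y \<in> carrier AH. coact_first (galois_map y) = coact_second (galois_map y)} = {y \<in> carrier AH. coact_first y = triv_first y}"
    by (rule Collect_cong, rule conj_cong[OF refl], rule cotensor_galois_map)
  finally show ?thesis .
qed

abbreviation "coinv \<equiv> coinvariants R H A coact I"

lemma coinvariants_eq: "coinv = {a \<in> carrier BH. qcoact a = qtriv a}"
  by (simp add: coinvariants_def A_simps qcoact_def qtriv_def tensor_A tensor_map_def Q_def pr_def[abs_def])

definition "coinv_tensor = {y \<in> carrier AH. coact_first y = triv_first y}"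

text \<open>
  The coinvariants are the kernel of the difference of the coaction and the trivial coaction, and
  tensoring with the flat module \<open>H\<close> preserves this kernel.
\<close>

lemma coinv_tensor_flat:
  assumes H: "flat R H"
  shows "coinv_tensor = incl ` carrier (tensor R (sub coinv) H)"
proof -
  interpret BHm: module R BH by (rule modBH)
  interpret AQm: module R AQ by (rule modAQ)
  interpret AQHm: module R AQH by (rule modAQH)
  define D where "D = (\<lambda>a. qcoact a \<ominus>\<^bsub>AQ\<^esub> qtriv a)"
  have D: "D \<in> linear_maps R BH AQ"
    unfolding D_def by (rule lin_diff[OF modAQ qcoact_linear qtriv_linear])
  have ker: "{x \<in> carrier BH. D x = \<zero>\<^bsub>AQ\<^esub>} = coinv"
    unfolding coinvariants_eq D_def
    by (rule Collect_cong, rule conj_cong[OF refl],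
      rule AQm.diff_zero_iff[OF lin_closed[OF qcoact_linear] lin_closed[OF qtriv_linear]])
  have L: "(\<lambda>y. coact_first y \<ominus>\<^bsub>AQH\<^esub> triv_first y) \<in> linear_maps R AH AQH"
    by (rule lin_diff[OF modAQH coact_first_linear triv_first_linear])
  have eq: "map_left R AQ H D y = coact_first y \<ominus>\<^bsub>AQH\<^esub> triv_first y" if "y \<in> carrier AH" for y
  proof (rule lin_ext[OF modBH modH modAQH map_left_linear[OF modBH modAQ modH D] L _ that])
    fix z h assume z: "z \<in> carrier BH" and h: "h \<in> carrier H"
    note T = bilin2[OF tens_bilinear[OF modAQ modH] h]
    show "map_left R AQ H D (ah z h) = coact_first (ah z h) \<ominus>\<^bsub>AQH\<^esub> triv_first (ah z h)"
      unfolding map_left_tens[OF modBH modAQ modH D z h] map_left_tens[OF modBH modAQ modH qcoact_linear z h]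
        map_left_tens[OF modBH modAQ modH qtriv_linear z h]
      using lin_closed[OF qcoact_linear z] lin_closed[OF qtriv_linear z]
      by (simp add: D_def AQm.minus_eq AQHm.minus_eq lin_add[OF T] lin_minus[OF modAQ modAQH T])
  qed
  note K = kernel_submodule[OF modBH modAQ D, unfolded ker]
  have modK: "module R (sub coinv)" by (rule submodule_module[OF modBH K])
  have i: "(\<lambda>x. x) \<in> linear_maps R (sub coinv) BH"
    by (auto simp: linear_maps_def coinvariants_eq)
  note I = map_left_linear[OF modK modBH modH i]
  show ?thesis
  proof
    show "coinv_tensor \<subseteq> incl ` carrier (tensor R (sub coinv) H)"
    proof
      fix y assume y: "y \<in> coinv_tensor"
      then have "map_left R AQ H D y = \<zero>\<^bsub>AQH\<^esub>"
        using eq[of y] lin_closed[OF triv_first_linear, of y] by (simp add: coinv_tensor_def AQHm.diff_zero_iff)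
      then show "y \<in> incl ` carrier (tensor R (sub coinv) H)"
        using flat_kernel[OF H modBH modAQ D, of y] y by (simp add: ker coinv_tensor_def)
    qed
    show "incl ` carrier (tensor R (sub coinv) H) \<subseteq> coinv_tensor"
    proof clarify
      fix w assume w: "w \<in> carrier (tensor R (sub coinv) H)"
      have "coact_first (incl w) = triv_first (incl w)"
      proof (rule lin_ext[OF modK modH modAQH lin_compose[OF coact_first_linear I] lin_compose[OF triv_first_linear I] _ w])
        fix x h assume x: "x \<in> carrier (sub coinv)" and h: "h \<in> carrier H"
        then have x': "x \<in> carrier BH" "qcoact x = qtriv x" by (simp_all add: coinvariants_eq)
        show "coact_first (incl (tens R (sub coinv) H x h)) =
          triv_first (incl (tens R (sub coinv) H x h))"
          unfolding map_left_tens[OF modK modBH modH i x h] using x' h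
          by (simp add: map_left_tens[OF modBH modAQ modH] qcoact_linear qtriv_linear)
      qed
      then show "incl w \<in> coinv_tensor"
        using lin_closed[OF I w] by (simp add: coinv_tensor_def)
    qed
  qed
qed

text \<open>
  The counit on the last factor undoes \<open>a \<mapsto> a \<otimes> 1\<close>.
\<close>

lemma coinv_tensor_one:
  assumes a: "a \<in> carrier BH"
  shows "ah a \<one>\<^bsub>H\<^esub> \<in> coinv_tensor \<longleftrightarrow> a \<in> coinv"
proof
  note C = counit_right_map_tens[OF modAQ]
  note cl = lin_closed[OF qcoact_linear a] lin_closed[OF qtriv_linear a]
  interpret AQm: module R AQ by (rule modAQ)
  assume "ah a \<one>\<^bsub>H\<^esub> \<in> coinv_tensor"
  then have "aqh (qcoact a) \<one>\<^bsub>H\<^esub> = aqh (qtriv a) \<one>\<^bsub>H\<^esub>"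
    using a one_closed by (simp add: coinv_tensor_def map_left_tens[OF modBH modAQ modH] qcoact_linear qtriv_linear)
  then have "counit_right_map AQ (aqh (qcoact a) \<one>\<^bsub>H\<^esub>) = counit_right_map AQ (aqh (qtriv a) \<one>\<^bsub>H\<^esub>)" by simp
  then show "a \<in> coinv" using cl one_closed a by (simp add: C counit_one coinvariants_eq)
next
  assume "a \<in> coinv"
  then show "ah a \<one>\<^bsub>H\<^esub> \<in> coinv_tensor"
    using one_closed a by (simp add: coinvariants_eq coinv_tensor_def map_left_tens[OF modBH modAQ modH]
      qcoact_linear qtriv_linear tens_closed[OF modBH modH])
qed

lemma tensor_eq_coinv_tensor_iff:
  assumes H: "flat R H" and S: "submodule S R BH"
  shows "incl ` carrier (tensor R (sub S) H) = coinv_tensor \<longleftrightarrow> coinv = S"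
    (is "?W = _ \<longleftrightarrow> _")
proof
  assume W: "?W = coinv_tensor"
  interpret BHm: module R BH by (rule modBH)
  have modS: "module R (sub S)" by (rule submodule_module[OF modBH S])
  interpret Sm: module R "sub S" by (rule modS)
  have SB: "S \<subseteq> carrier BH" using BHm.submoduleE(1)[OF S] .
  have i: "(\<lambda>x. x) \<in> linear_maps R (sub S) BH"
    using SB by (auto simp: linear_maps_def)
  note I = map_left_linear[OF modS modBH modH i]
  note CL = lin_compose[OF counit_right_map_linear[OF modBH] I]
  show "coinv = S"
  proof
    show "coinv \<subseteq> S"
    proof
      fix a assume a: "a \<in> coinv"
      then have aB: "a \<in> carrier BH" by (simp add: coinvariants_eq)
      then have "ah a \<one>\<^bsub>H\<^esub> \<in> ?W" using a coinv_tensor_one W by simp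
      then obtain w where w: "w \<in> carrier (tensor R (sub S) H)"
        "ah a \<one>\<^bsub>H\<^esub> = incl w" by auto
      have "counit_right_map BH (incl w) \<in> S"
        using modS modH w(1)
      proof (induction rule: tens_induct)
        case zero
        have "counit_right_map BH (incl \<zero>\<^bsub>tensor R (sub S) H\<^esub>) = \<zero>\<^bsub>BH\<^esub>"
          by (rule lin_zero[OF tensor_is_module[OF modS modH] modBH CL])
        then show ?case using Sm.zero_closed by simp
      next
        case (tens x h)
        then have "counit_right_map BH (incl (tens R (sub S) H x h)) = counit H h \<odot>\<^bsub>BH\<^esub> x"
          using SB by (subst map_left_tens[OF modS modBH modH i]) (auto simp: counit_right_map_tens[OF modBH])
        then show ?case using tens Sm.smult_closed[of "counit H h" x] by (simp add: counit_closed)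
      next
        case (add u v)
        then show ?case using Sm.a_closed by (simp add: lin_add[OF CL])
      qed
      then show "a \<in> S" using w(2)[symmetric] aB one_closed by (simp add: counit_right_map_tens[OF modBH] counit_one)
    qed
    show "S \<subseteq> coinv"
    proof
      fix s assume s: "s \<in> S"
      have "incl (tens R (sub S) H s \<one>\<^bsub>H\<^esub>) = ah s \<one>\<^bsub>H\<^esub>"
        by (rule map_left_tens[OF modS modBH modH i]) (use s one_closed in auto)
      moreover have "tens R (sub S) H s \<one>\<^bsub>H\<^esub> \<in> carrier (tensor R (sub S) H)"
        by (rule tens_closed[OF modS modH]) (use s one_closed in auto)
      ultimately have "ah s \<one>\<^bsub>H\<^esub> \<in> coinv_tensor" using W by force
      then show "s \<in> coinv" using coinv_tensor_one s SB by auto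
    qed
  qed
next
  assume "coinv = S"
  then show "?W = coinv_tensor" using coinv_tensor_flat[OF H] by simp
qed

end

section \<open>The canonical map\<close>

context crossed_product
begin

lemma modA: "module R A"
proof -
  interpret BHm: module R BH by (rule modBH)
  show ?thesis
    by (rule moduleI)
      (auto simp: A_simps BHm.smult_l_distr BHm.smult_r_distr BHm.smult_assoc1 R.is_cring BHm.a_ac BHm.l_neg
        intro!: abelian_groupI intro: BHm.add.inv_closed BHm.l_neg bexI[of _ "\<ominus>\<^bsub>BH\<^esub> _"])
qed

end

locale crossed_subalgebra = crossed_product R H B act \<sigma>
  for R (structure) and H :: "('r, 'h, 'x) hopf_scheme" (structure)
    and B :: "('r, 'b, 'y) module_scheme" (structure) and act \<sigma> +
  fixes S :: "('b \<times> 'h \<Rightarrow>\<^sub>0 int) set set"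
  assumes S_subring: "subring S (crossed_prod R H B act \<sigma>)"
    and S_submodule: "submodule S R (crossed_prod R H B act \<sigma>)"
    and S_base: "crossed_base R H B \<subseteq> S"
begin

abbreviation "BA \<equiv> crossed_base R H B"
abbreviation "SA \<equiv> A\<lparr>carrier := S\<rparr>"
abbreviation "SB \<equiv> sub S"

lemma submodule_BH: "submodule S R BH"
proof -
  interpret BHm: module R BH by (rule modBH)
  interpret Am: module R A by (rule modA)
  note E = Am.submoduleE[OF S_submodule]
  have inv: "\<ominus>\<^bsub>A\<^esub> x = \<ominus>\<^bsub>BH\<^esub> x" for x by (simp add: a_inv_def A_simps)
  show ?thesis
    by (rule BHm.submoduleI) (use E in \<open>auto simp: A_simps inv intro: submodule.smult_closed[OF S_submodule, unfolded A_simps]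
      subgroup.one_closed[OF submodule.axioms(1)[OF S_submodule], simplified, unfolded A_simps]\<close>)
qed

lemma S_sub: "s \<in> S \<Longrightarrow> s \<in> carrier BH"
proof -
  interpret BHm: module R BH by (rule modBH)
  show "s \<in> S \<Longrightarrow> s \<in> carrier BH" using BHm.submoduleE(1)[OF submodule_BH] by blast
qed

lemma modS: "module R SB"
  by (rule submodule_module[OF modBH submodule_BH])

lemma modSA: "module R SA"
  by (rule submodule_module[OF modA S_submodule])

lemma cmult_closed: "x \<in> carrier BH \<Longrightarrow> y \<in> carrier BH \<Longrightarrow> cmult x y \<in> carrier BH"
  by (rule bilin_closed[OF cmult_bilinear])

lemma S_mult: "s \<in> S \<Longrightarrow> t \<in> S \<Longrightarrow> cmult s t \<in> S"
  using subringE(6)[OF S_subring] by (simp add: A_simps)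

lemma BA_E: assumes "x \<in> BA" obtains b where "b \<in> carrier B" "x = bh b \<one>\<^bsub>H\<^esub>"
  using assms by (auto simp: crossed_base_def)

lemma BA_S: "x \<in> BA \<Longrightarrow> x \<in> S"
  using S_base by blast

lemma base_S: "b \<in> carrier B \<Longrightarrow> bh b \<one>\<^bsub>H\<^esub> \<in> S"
  using S_base by (auto simp: crossed_base_def)

lemma cmult_assoc: "x \<in> carrier BH \<Longrightarrow> y \<in> carrier BH \<Longrightarrow> z \<in> carrier BH \<Longrightarrow>
    cmult (cmult x y) z = cmult x (cmult y z)"
  using monoid.m_assoc[OF crossed_prod_monoid] by (simp add: A_simps)

lemma cmult_one: "x \<in> carrier BH \<Longrightarrow> cmult x (bh \<one>\<^bsub>B\<^esub> \<one>\<^bsub>H\<^esub>) = x"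
  using monoid.r_one[OF crossed_prod_monoid, of x] by (simp add: A_simps)

sublocale base: tensor_module R BA cmult cmult SA A
proof -
  interpret SAm: module R SA by (rule modSA)
  interpret Am: module R A by (rule modA)
  show "tensor_module R BA cmult cmult SA A"
    by unfold_locales (auto simp: A_simps S_mult BA_S S_sub cmult_closed
       lin_smult[OF bilin2[OF cmult_bilinear]])
qed

abbreviation "TB \<equiv> tensor_base A BA S"

lemma TB_eq: "TB = base.TM"
  by (simp add: tensor_base_def A_simps)

abbreviation "SH \<equiv> tensor R SB H"
abbreviation "sh \<equiv> tens R SB H"

lemma modSH: "module R SH"
  by (rule tensor_is_module[OF modS modH])

lemma modTB: "module R TB"
  unfolding TB_eq by (rule base.TM_module)

text \<open>
  The map \<open>(s, b # h) \<mapsto> s b \<otimes> h\<close>, which induces \<open>S \<otimes>\<^sub>B A \<rightarrow> S \<otimes> H\<close>.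
\<close>

definition "flatten_pair s = tensor_lift SH (\<lambda>b h. sh (cmult s (bh b \<one>\<^bsub>H\<^esub>)) h)"

lemma S_mult_base_lin:
  "s \<in> S \<Longrightarrow> (\<lambda>b. cmult s (bh b \<one>\<^bsub>H\<^esub>)) \<in> linear_maps R B SB"
  "b \<in> carrier B \<Longrightarrow> (\<lambda>s. cmult s (bh b \<one>\<^bsub>H\<^esub>)) \<in> linear_maps R SB SB"
proof -
  assume s: "s \<in> S"
  have "(\<lambda>b. cmult s (bh b \<one>\<^bsub>H\<^esub>)) \<in> linear_maps R B BH"
    by (rule bilin_app2[OF cmult_bilinear _ S_sub[OF s]], insert one_closed) (assumption | rule c_lins)+
  then show "(\<lambda>b. cmult s (bh b \<one>\<^bsub>H\<^esub>)) \<in> linear_maps R B SB"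
    using s base_S S_mult by (auto simp: linear_maps_def)
next
  assume b: "b \<in> carrier B"
  have "(\<lambda>s. cmult s (bh b \<one>\<^bsub>H\<^esub>)) \<in> linear_maps R BH BH"
    by (rule bilin2[OF cmult_bilinear], insert one_closed b) (assumption | rule c_lins)+
  then show "(\<lambda>s. cmult s (bh b \<one>\<^bsub>H\<^esub>)) \<in> linear_maps R SB SB"
    using b base_S S_mult S_sub by (auto simp: linear_maps_def)
qed

lemma flatten_pair_inner: "s \<in> S \<Longrightarrow> (\<lambda>b h. sh (cmult s (bh b \<one>\<^bsub>H\<^esub>)) h) \<in> bilinear_maps R B H SH"
  by (intro bilinI tens_lin1[OF modS modH] tens_lin2[OF modS modH] S_mult_base_lin lin_id)
    (auto simp: S_mult base_S)

lemma flatten_pair_linear: "s \<in> S \<Longrightarrow> flatten_pair s \<in> linear_maps R BH SH"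
  unfolding flatten_pair_def by (rule lift_linear[OF modB modH modSH flatten_pair_inner])

lemma flatten_pair_tens: "s \<in> S \<Longrightarrow> b \<in> carrier B \<Longrightarrow> h \<in> carrier H \<Longrightarrow>
    flatten_pair s (bh b h) = sh (cmult s (bh b \<one>\<^bsub>H\<^esub>)) h"
  unfolding flatten_pair_def by (rule lift_tens[OF modB modH modSH flatten_pair_inner])

lemma flatten_pair_linear_left: "a \<in> carrier BH \<Longrightarrow> (\<lambda>s. flatten_pair s a) \<in> linear_maps R SB SH"
  unfolding flatten_pair_def
  by (rule lift_lin_fun[OF modB modH modSH modS])
    (auto intro: flatten_pair_inner tens_lin1[OF modS modH] S_mult_base_lin)

text \<open>
  For \<open>t = b' # 1\<close> both sides send \<open>b # h\<close> to \<open>s b' b \<otimes> h\<close>, by associativity and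
  \<open>(b' # 1)(b # h) = b' b # h\<close>.
\<close>

lemma flatten_pair_balanced: "base.balanced_biadditive SH flatten_pair"
  unfolding base.balanced_biadditive_def
proof (intro conjI ballI)
  fix x y assume xy: "x \<in> carrier SA" "y \<in> carrier A"
  then show "flatten_pair x y \<in> carrier SH"
    by (simp add: A_simps lin_closed[OF flatten_pair_linear])
  fix t assume t: "t \<in> BA"
  then obtain b' where b': "b' \<in> carrier B" "t = bh b' \<one>\<^bsub>H\<^esub>" by (rule BA_E)
  have x: "x \<in> S" and y: "y \<in> carrier BH" using xy by (simp_all add: A_simps)
  have xt: "cmult x t \<in> S" using x t BA_S S_mult by blast
  have t': "t \<in> carrier BH" using t BA_S S_sub by blast
  have "flatten_pair (cmult x t) y = flatten_pair x (cmult t y)"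
  proof (rule lin_ext[OF modB modH modSH flatten_pair_linear[OF xt]
      lin_compose[OF flatten_pair_linear[OF x] bilin1[OF cmult_bilinear t']] _ y])
    fix b h assume b: "b \<in> carrier B" and h: "h \<in> carrier H"
    have "cmult (cmult x t) (bh b \<one>\<^bsub>H\<^esub>) = cmult x (bh (b' \<otimes>\<^bsub>B\<^esub> b) \<one>\<^bsub>H\<^esub>)"
      using b b' t' S_sub[OF x] S_sub[OF base_S[OF b]] cmult_base[OF b'(1) b one_closed]
      by (simp add: cmult_assoc)
    then show "flatten_pair (cmult x t) (bh b h) = flatten_pair x (cmult t (bh b h))"
      using b b' h x xt by (simp add: flatten_pair_tens cmult_base)
  qed
  then show "flatten_pair (cmult x t) y = flatten_pair x (cmult t y)" .
next
  fix x x' y assume "x \<in> carrier SA" "x' \<in> carrier SA" "y \<in> carrier A"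
  then show "flatten_pair (x \<oplus>\<^bsub>SA\<^esub> x') y = flatten_pair x y \<oplus>\<^bsub>SH\<^esub> flatten_pair x' y"
    using lin_add[OF flatten_pair_linear_left] by (simp add: A_simps)
next
  fix x y y' assume "x \<in> carrier SA" "y \<in> carrier A" "y' \<in> carrier A"
  then show "flatten_pair x (y \<oplus>\<^bsub>A\<^esub> y') = flatten_pair x y \<oplus>\<^bsub>SH\<^esub> flatten_pair x y'"
    using lin_add[OF flatten_pair_linear] by (simp add: A_simps)
qed

definition "flatten_base = tensor_lift SH flatten_pair"

lemma flatten_base_linear: "flatten_base \<in> linear_maps R TB SH"
  unfolding flatten_base_def TB_eq
  by (rule base.TM_lift_linear[OF modSH flatten_pair_balanced])
    (use lin_smult[OF flatten_pair_linear_left] in \<open>simp add: A_simps\<close>)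

lemma flatten_base_tn: "s \<in> S \<Longrightarrow> a \<in> carrier BH \<Longrightarrow> flatten_base (base.tn s a) = flatten_pair s a"
proof -
  interpret SHm: module R SH by (rule modSH)
  show "s \<in> S \<Longrightarrow> a \<in> carrier BH \<Longrightarrow> flatten_base (base.tn s a) = flatten_pair s a"
    unfolding flatten_base_def
    by (rule base.tensor_lift_tn[OF SHm.abelian_group_axioms flatten_pair_balanced]) (simp_all add: A_simps)
qed

lemma tn_closed: "s \<in> S \<Longrightarrow> a \<in> carrier BH \<Longrightarrow> base.tn s a \<in> carrier TB"
  using base.tn_closed[of s a] by (simp add: A_simps TB_eq base.TM_simps)

lemma tn_linear_left: "a \<in> carrier BH \<Longrightarrow> (\<lambda>s. base.tn s a) \<in> linear_maps R SB TB"
  by (rule linI) (use base.tn_add_left base.TM_smult_tn in \<open>simp_all add: A_simps TB_eq base.TM_simps tn_closed[unfolded TB_eq base.TM_simps]\<close>)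

text \<open>
  Scalars may be moved across the tensor sign because they come from the subalgebra \<open>B\<close>:
  multiplication by \<open>r\<close> is multiplication by \<open>r1 # 1\<close>.
\<close>

lemma tn_linear_right:
  assumes s: "s \<in> S" shows "base.tn s \<in> linear_maps R BH TB"
proof (rule linI)
  show "\<And>x. x \<in> carrier BH \<Longrightarrow> base.tn s x \<in> carrier TB" by (rule tn_closed[OF s])
  show "\<And>x y. x \<in> carrier BH \<Longrightarrow> y \<in> carrier BH \<Longrightarrow> base.tn s (x \<oplus>\<^bsub>BH\<^esub> y) = base.tn s x \<oplus>\<^bsub>TB\<^esub> base.tn s y"
    using base.tn_add_right[of s] s by (simp add: A_simps TB_eq base.TM_simps)
  fix r x assume r: "r \<in> carrier R" and x: "x \<in> carrier BH"
  let ?e = "bh (r \<odot>\<^bsub>B\<^esub> \<one>\<^bsub>B\<^esub>) \<one>\<^bsub>H\<^esub>"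
  have e: "?e \<in> BA" using r by (auto simp: crossed_base_def)
  have e1: "?e = r \<odot>\<^bsub>BH\<^esub> bh \<one>\<^bsub>B\<^esub> \<one>\<^bsub>H\<^esub>" using r one_closed by (simp add: tens_smult_left[OF modB modH])
  have one: "bh \<one>\<^bsub>B\<^esub> \<one>\<^bsub>H\<^esub> \<in> carrier BH" using one_closed by (simp add: tens_closed[OF modB modH])
  have l: "cmult (bh \<one>\<^bsub>B\<^esub> \<one>\<^bsub>H\<^esub>) x = x"
    using monoid.l_one[OF crossed_prod_monoid, of x] x by (simp add: A_simps)
  have "base.tn (cmult s ?e) x = base.tn s (cmult ?e x)"
    using base.tn_balanced[of s ?e x] s e x by (simp add: A_simps)
  moreover have "cmult s ?e = r \<odot>\<^bsub>BH\<^esub> s"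
    unfolding e1 using lin_smult[OF bilin1[OF cmult_bilinear S_sub[OF s]] r one] cmult_one[OF S_sub[OF s]] by simp
  moreover have "cmult ?e x = r \<odot>\<^bsub>BH\<^esub> x"
    unfolding e1 using lin_smult[OF bilin2[OF cmult_bilinear x] r one] l by simp
  moreover have "base.tn (r \<odot>\<^bsub>BH\<^esub> s) x = r \<odot>\<^bsub>TB\<^esub> base.tn s x"
    using lin_smult[OF tn_linear_left[OF x] r, of s] s by simp
  ultimately show "base.tn s (r \<odot>\<^bsub>BH\<^esub> x) = r \<odot>\<^bsub>TB\<^esub> base.tn s x" by simp
qed

definition "unflatten_base = tensor_lift TB (\<lambda>s h. base.tn s (bh \<one>\<^bsub>B\<^esub> h))"

lemma unflatten_base_inner: "(\<lambda>s h. base.tn s (bh \<one>\<^bsub>B\<^esub> h)) \<in> bilinear_maps R SB H TB"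
  by (intro bilinI lin_compose[OF tn_linear_right] tn_linear_left tens_lin2[OF modB modH] lin_id)
    (auto simp: tens_closed[OF modB modH])

lemma unflatten_base_linear: "unflatten_base \<in> linear_maps R SH TB"
  unfolding unflatten_base_def by (rule lift_linear[OF modS modH modTB unflatten_base_inner])

lemma unflatten_base_tens: "s \<in> S \<Longrightarrow> h \<in> carrier H \<Longrightarrow> unflatten_base (sh s h) = base.tn s (bh \<one>\<^bsub>B\<^esub> h)"
  unfolding unflatten_base_def by (rule lift_tens[OF modS modH modTB unflatten_base_inner]) simp_all

lemma TB_ext:
  assumes f: "f \<in> linear_maps R TB G" and g: "g \<in> linear_maps R TB G" and G: "module R G"
    and eq: "\<And>s a. s \<in> S \<Longrightarrow> a \<in> carrier BH \<Longrightarrow> f (base.tn s a) = g (base.tn s a)"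
    and z: "z \<in> carrier TB"
  shows "f z = g z"
  using z unfolding TB_eq
proof (induction rule: base.TM_induct)
  case zero
  show ?case using lin_zero[OF modTB G f] lin_zero[OF modTB G g] by (simp add: TB_eq)
next
  case (tens x y)
  then show ?case using eq by (simp add: A_simps)
next
  case (add u v)
  then show ?case using lin_add[OF f] lin_add[OF g] by (simp add: TB_eq)
qed

text \<open>
  The composite sends \<open>s \<otimes> (b # h)\<close> to \<open>s b \<otimes> (1 # h) = s \<otimes> b (1 # h)\<close>.
\<close>

lemma unflatten_flatten:
  assumes z: "z \<in> carrier TB" shows "unflatten_base (flatten_base z) = z"
proof (rule TB_ext[OF lin_compose[OF unflatten_base_linear flatten_base_linear] lin_id modTB _ z])
  fix s a assume s: "s \<in> S" and a: "a \<in> carrier BH"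
  have "unflatten_base (flatten_pair s a) = base.tn s a"
  proof (rule lin_ext[OF modB modH modTB lin_compose[OF unflatten_base_linear flatten_pair_linear[OF s]] tn_linear_right[OF s] _ a])
    fix b h assume b: "b \<in> carrier B" and h: "h \<in> carrier H"
    have bA: "bh b \<one>\<^bsub>H\<^esub> \<in> BA" using b by (auto simp: crossed_base_def)
    have 1: "bh \<one>\<^bsub>B\<^esub> h \<in> carrier BH" using h by (simp add: tens_closed[OF modB modH])
    have "unflatten_base (flatten_pair s (bh b h)) = base.tn (cmult s (bh b \<one>\<^bsub>H\<^esub>)) (bh \<one>\<^bsub>B\<^esub> h)"
      using s b h S_mult[OF s base_S[OF b]] by (simp add: flatten_pair_tens unflatten_base_tens)
    also have "\<dots> = base.tn s (cmult (bh b \<one>\<^bsub>H\<^esub>) (bh \<one>\<^bsub>B\<^esub> h))"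
      using base.tn_balanced[of s "bh b \<one>\<^bsub>H\<^esub>" "bh \<one>\<^bsub>B\<^esub> h"] s bA 1 by (simp add: A_simps)
    also have "\<dots> = base.tn s (bh b h)" using b h by (simp add: cmult_base)
    finally show "unflatten_base (flatten_pair s (bh b h)) = base.tn s (bh b h)" .
  qed
  then show "unflatten_base (flatten_base (base.tn s a)) = base.tn s a" using s a by (simp add: flatten_base_tn)
qed

lemma flatten_unflatten:
  assumes z: "z \<in> carrier SH" shows "flatten_base (unflatten_base z) = z"
proof (rule lin_ext[OF modS modH modSH lin_compose[OF flatten_base_linear unflatten_base_linear] lin_id _ z])
  fix s h assume s: "s \<in> carrier SB" and h: "h \<in> carrier H"
  then show "flatten_base (unflatten_base (sh s h)) = sh s h"
    using S_sub[of s] by (simp add: unflatten_base_tens flatten_base_tn flatten_pair_tens cmult_one tens_closed[OF modB modH])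
qed

lemma flatten_base_bij: "bij_betw flatten_base (carrier TB) (carrier SH)"
  by (rule bij_betw_byWitness[where f' = unflatten_base])
    (auto simp: unflatten_flatten flatten_unflatten lin_closed[OF unflatten_base_linear] lin_closed[OF flatten_base_linear])

lemma id_linear: "(\<lambda>x. x) \<in> linear_maps R SB BH"
  using S_sub by (auto simp: linear_maps_def)

lemmas incl_linear = map_left_linear[OF modS modBH modH id_linear]
lemmas incl_tens = map_left_tens[OF modS modBH modH id_linear]

lemma incl_inj: "flat R H \<Longrightarrow> inj_on incl (carrier SH)"
  by (rule flat_injective[OF _ modS modBH id_linear]) (auto intro: inj_onI)

text \<open>
  On \<open>a = b # h\<close> the canonical map gives \<open>s (b # h\<^sub>(\<^sub>1\<^sub>)) \<otimes> h\<^sub>(\<^sub>2\<^sub>) = (s b)(1 # h\<^sub>(\<^sub>1\<^sub>)) \<otimes> h\<^sub>(\<^sub>2\<^sub>)\<close>, the Galois map at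
  \<open>s b \<otimes> h\<close>.
\<close>

lemma can_tn:
  assumes s: "s \<in> S" and a: "a \<in> carrier BH"
  shows "tensor_lift AH (\<lambda>a0 a1. ah (cmult s a0) a1) (coact a) = galois_map (incl (flatten_pair s a))"
proof -
  have s': "s \<in> carrier BH" by (rule S_sub[OF s])
  note M = bilin_app2[OF cmult_bilinear]
  have inner: "(\<lambda>a0 a1. ah (cmult s a0) a1) \<in> bilinear_maps R BH H AH"
    by (intro bilinI tens_lin1[OF modBH modH] tens_lin2[OF modBH modH] bilin1[OF cmult_bilinear s'] lin_id
      cmult_closed s')
  note L = lift_linear[OF modBH modH modAH inner]
  show ?thesis
  proof (rule lin_ext[OF modB modH modAH lin_compose[OF L coact_linear]
      lin_compose[OF galois_map_linear lin_compose[OF incl_linear flatten_pair_linear[OF s]]] _ a])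
    fix b h assume b: "b \<in> carrier B" and h: "h \<in> carrier H"
    have sb: "cmult s (bh b \<one>\<^bsub>H\<^esub>) \<in> S" by (rule S_mult[OF s base_S[OF b]])
    have "tensor_lift AH (\<lambda>a0 a1. ah (cmult s a0) a1) (coact (bh b h)) =
      sw H AH h (\<lambda>h1 h2. tensor_lift AH (\<lambda>a0 a1. ah (cmult s a0) a1) (ah (bh b h1) h2))"
      unfolding coact_tens[OF b h]
      by (rule sw_lin[OF modAH modAH _ L h], insert b modAH) (assumption | rule c_lins)+
    also have "\<dots> = sw H AH h (\<lambda>h1 h2. ah (cleaving_op (cmult s (bh b \<one>\<^bsub>H\<^esub>)) h1) h2)"
    proof (rule sw_cong[OF modAH _ _ h])
      show "(\<lambda>h1 h2. tensor_lift AH (\<lambda>a0 a1. ah (cmult s a0) a1) (ah (bh b h1) h2)) \<in> bilinear_maps R H H AH"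
        by (insert b modAH, (assumption | rule c_lins lin_compose[OF L])+)
      fix h1 h2 assume h12: "h1 \<in> carrier H" "h2 \<in> carrier H"
      have "cmult s (bh b h1) = cleaving_op (cmult s (bh b \<one>\<^bsub>H\<^esub>)) h1"
        using b h12 s' S_sub[OF base_S[OF b]]
        by (simp add: cleaving_op_def cmult_assoc cmult_base tens_closed[OF modB modH])
      then show "tensor_lift AH (\<lambda>a0 a1. ah (cmult s a0) a1) (ah (bh b h1) h2) =
         ah (cleaving_op (cmult s (bh b \<one>\<^bsub>H\<^esub>)) h1) h2"
        using b h12 by (simp add: lift_tens[OF modBH modH modAH inner] tens_closed[OF modB modH])
    qed
    also have "\<dots> = galois_map (incl (flatten_pair s (bh b h)))"
      using s b h sb by (simp add: flatten_pair_tens incl_tens twist_tens[OF modBH cleaving_op_bilinear] S_sub)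
    finally show "tensor_lift AH (\<lambda>a0 a1. ah (cmult s a0) a1) (coact (bh b h)) = galois_map (incl (flatten_pair s (bh b h)))" .
  qed
qed

abbreviation "can \<equiv> can_map R H A coact"

definition "can_factored z = galois_map (incl (flatten_base z))"

lemma can_factored_linear: "can_factored \<in> linear_maps R TB AH"
  unfolding can_factored_def[abs_def] by (rule lin_compose[OF galois_map_linear lin_compose[OF incl_linear flatten_base_linear]])

lemma can_eq:
  assumes z: "z \<in> carrier TB" shows "can z = can_factored z"
proof -
  interpret AHm: module R AH by (rule modAH)
  define f where "f = (\<lambda>s a. tensor_lift AH (\<lambda>a0 a1. ah (cmult s a0) a1) (coact a))"
  have can: "can = tensor_lift AH f"
    by (simp add: can_map_def f_def tensor_A A_simps)
  have f: "f s a = can_factored (base.tn s a)" if "s \<in> S" "a \<in> carrier BH" for s a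
    using that by (simp add: f_def can_tn can_factored_def flatten_base_tn)
  have fl: "(\<lambda>s. f s a) \<in> linear_maps R SB AH" if "a \<in> carrier BH" for a
    by (rule lin_cong[OF lin_compose[OF can_factored_linear tn_linear_left[OF that]] modS]) (use that f in simp)
  have fr: "f s \<in> linear_maps R BH AH" if "s \<in> S" for s
    by (rule lin_cong[OF lin_compose[OF can_factored_linear tn_linear_right[OF that]] modBH]) (use that f in simp)
  have bal: "f (cmult s t) a = f s (cmult t a)" if "s \<in> S" "t \<in> BA" "a \<in> carrier BH" for s t a
    using that base.tn_balanced[of s t a] BA_S[of t] S_sub[of t] S_mult[of s t] cmult_closed[of t a] by (simp add: f A_simps)
  have b: "base.balanced_biadditive AH f"
    unfolding base.balanced_biadditive_def
    using lin_closed[OF fr] lin_add[OF fl] lin_add[OF fr] bal by (simp add: A_simps)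
  have l: "tensor_lift AH f \<in> linear_maps R TB AH"
    unfolding TB_eq by (rule base.TM_lift_linear[OF modAH b]) (use lin_smult[OF fl] in \<open>simp add: A_simps\<close>)
  show ?thesis unfolding can
    by (rule TB_ext[OF l can_factored_linear modAH _ z])
      (simp add: base.tensor_lift_tn[OF AHm.abelian_group_axioms b] A_simps f)
qed

lemma can_factored_inj: "flat R H \<Longrightarrow> inj_on can_factored (carrier TB)"
  using galois_map_bij flatten_base_bij incl_inj lin_closed[OF incl_linear] lin_closed[OF flatten_base_linear]
  unfolding can_factored_def[abs_def] bij_betw_def inj_on_def by meson

lemma can_factored_image: "can_factored ` carrier TB = galois_map ` incl ` carrier SH"
  using flatten_base_bij unfolding can_factored_def[abs_def] bij_betw_def by (metis image_image)

end

locale crossed_closure = crossed_subalgebra R H B act \<sigma> S + crossed_quotient R H B act \<sigma> I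
  for R (structure) and H :: "('r, 'h, 'x) hopf_scheme" (structure)
    and B :: "('r, 'b, 'y) module_scheme" (structure) and act \<sigma> S I
begin

text \<open>
  The image of the canonical map is the image of \<open>S \<otimes> H\<close> under the Galois map, and the cotensor
  product is the image of the equaliser \<open>coinv_tensor\<close>; since the Galois map is injective, the
  canonical map is onto precisely when the two submodules agree.
\<close>

theorem can_iso_iff_closed:
  assumes H: "flat R H"
  shows "module_iso R TB cotens can \<longleftrightarrow> coinv = S"
proof -
  have E: "coinv_tensor \<subseteq> carrier AH" by (auto simp: coinv_tensor_def)
  have W: "incl ` carrier SH \<subseteq> carrier AH" using lin_closed[OF incl_linear] by auto
  have cot: "carrier cotens = galois_map ` coinv_tensor" unfolding cotensor_image coinv_tensor_def ..
  have "module_iso R TB cotens can \<longleftrightarrow> can_factored ` carrier TB = carrier cotens"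
  proof
    assume "module_iso R TB cotens can"
    then have "can ` carrier TB = carrier cotens" by (simp add: module_iso_def bij_betw_def)
    then show "can_factored ` carrier TB = carrier cotens" using can_eq by (simp cong: image_cong)
  next
    assume im: "can_factored ` carrier TB = carrier cotens"
    have "can_factored \<in> linear_maps R TB cotens"
      using can_factored_linear im by (auto simp: linear_maps_def cotensor_simps)
    then have "can \<in> linear_maps R TB cotens"
      by (rule lin_cong[OF _ modTB]) (simp add: can_eq)
    moreover have "bij_betw can (carrier TB) (carrier cotens)"
      using can_factored_inj[OF H] im by (simp add: bij_betw_def can_eq cong: image_cong inj_on_cong)
    ultimately show "module_iso R TB cotens can" by (simp add: module_iso_def)
  qed
  also have "\<dots> \<longleftrightarrow> galois_map ` incl ` carrier SH = galois_map ` coinv_tensor"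
    unfolding can_factored_image cot ..
  also have "\<dots> \<longleftrightarrow> incl ` carrier SH = coinv_tensor"
    using galois_map_bij by (intro inj_on_image_eq_iff[OF _ W E]) (simp add: bij_betw_def)
  also have "\<dots> \<longleftrightarrow> coinv = S"
    by (rule tensor_eq_coinv_tensor_iff[OF H submodule_BH])
  finally show ?thesis .
qed

end

section \<open>Suprema of generalised quotients\<close>

context hopf_algebra
begin

lemma right_ideal_coideal_zero: "right_ideal_coideal R H {\<zero>\<^bsub>H\<^esub>}"
  unfolding right_ideal_coideal_def
proof (intro conjI ballI)
  have T: "module R (tensor R H H)" by (rule tensor_is_module[OF modH modH])
  interpret T: module R "tensor R H H" by (rule T)
  show "submodule {\<zero>\<^bsub>H\<^esub>} R H" by (rule submoduleI) auto
  fix x assume x: "x \<in> {\<zero>\<^bsub>H\<^esub>}"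
  show "x \<otimes>\<^bsub>H\<^esub> h \<in> {\<zero>\<^bsub>H\<^esub>}" if "h \<in> carrier H" for h using x that by simp
  show "counit H x = \<zero>\<^bsub>R\<^esub>"
    using x counit_smult[of "\<zero>\<^bsub>R\<^esub>" "\<zero>\<^bsub>H\<^esub>"] counit_closed[of "\<zero>\<^bsub>H\<^esub>"] by (simp add: smult_l_null)
  show "comult H x \<in> generate (add_monoid (tensor R H H))
          ({tens R H H x h | x h. x \<in> {\<zero>\<^bsub>H\<^esub>} \<and> h \<in> carrier H} \<union> {tens R H H h x | x h. x \<in> {\<zero>\<^bsub>H\<^esub>} \<and> h \<in> carrier H})"
    using x lin_zero[OF modH T comult_linear] generate.one[of "add_monoid (tensor R H H)"] by simp
qed

lemma right_ideal_coidealD: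
  assumes "right_ideal_coideal R H I"
  shows "submodule I R H" "\<And>x h. x \<in> I \<Longrightarrow> h \<in> carrier H \<Longrightarrow> x \<otimes>\<^bsub>H\<^esub> h \<in> I"
    "\<And>x. x \<in> I \<Longrightarrow> counit H x = \<zero>\<^bsub>R\<^esub>"
    "\<And>x. x \<in> I \<Longrightarrow> comult H x \<in> generate (add_monoid (tensor R H H))
          ({tens R H H x h | x h. x \<in> I \<and> h \<in> carrier H} \<union> {tens R H H h x | x h. x \<in> I \<and> h \<in> carrier H})"
  using assms by (simp_all add: right_ideal_coideal_def)

text \<open>
  Each clause in the definition of a right ideal coideal holds for a sum because it holds for the
  summands and is preserved by addition.
\<close>

lemma right_ideal_coideal_Union:
  assumes U: "\<And>I. I \<in> U \<Longrightarrow> right_ideal_coideal R H I"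
  shows "right_ideal_coideal R H (generate (add_monoid H) (\<Union>U))"
proof -
  let ?G = "generate (add_monoid H) (\<Union>U)"
  have T: "module R (tensor R H H)" by (rule tensor_is_module[OF modH modH])
  interpret T: module R "tensor R H H" by (rule T)
  have UH: "\<Union>U \<subseteq> carrier H"
    by (rule Union_least) (rule submoduleE(1)[OF right_ideal_coidealD(1)[OF U]])
  have G: "group (add_monoid H)" by (rule a_group)
  have sub: "subgroup ?G (add_monoid H)" by (rule group.generate_is_subgroup[OF G]) (use UH in simp)
  have GH: "?G \<subseteq> carrier H" using subgroup.subset[OF sub] by simp
  have neg: "\<ominus>\<^bsub>H\<^esub> x \<in> ?G" if "x \<in> ?G" for x using subgroup.m_inv_closed[OF sub that] by (simp add: a_inv_def)
  have add: "x \<oplus>\<^bsub>H\<^esub> y \<in> ?G" if "x \<in> ?G" "y \<in> ?G" for x y using subgroup.m_closed[OF sub that] by simp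
  have ind: "P x" if x: "x \<in> ?G" and zero: "P \<zero>\<^bsub>H\<^esub>" and incl: "\<And>I x. I \<in> U \<Longrightarrow> x \<in> I \<Longrightarrow> x \<in> carrier H \<Longrightarrow> P x"
    and add: "\<And>x y. x \<in> ?G \<Longrightarrow> y \<in> ?G \<Longrightarrow> P x \<Longrightarrow> P y \<Longrightarrow> P (x \<oplus>\<^bsub>H\<^esub> y)" for P x
    using x
  proof (induction rule: generate.induct)
    case one then show ?case using zero by simp
  next
    case (incl h) then show ?case using that(3) UH by blast
  next
    case (inv h)
    from UnionE[OF inv] obtain I where I: "I \<in> U" "h \<in> I" .
    have "\<ominus>\<^bsub>H\<^esub> h \<in> I" by (rule submoduleE(3)[OF right_ideal_coidealD(1)[OF U[OF I(1)]] I(2)])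
    then have "P (\<ominus>\<^bsub>H\<^esub> h)" by (rule that(3)[OF I(1)]) (use I UH in auto)
    then show ?case by (simp add: a_inv_def)
  next
    case (eng h1 h2) then show ?case using add by simp
  qed
  show ?thesis unfolding right_ideal_coideal_def
  proof (intro conjI ballI)
    show "submodule ?G R H"
    proof (rule submoduleI)
      show "a \<odot>\<^bsub>H\<^esub> x \<in> ?G" if a: "a \<in> carrier R" and x: "x \<in> ?G" for a x
        using x
      proof (rule ind)
        show "a \<odot>\<^bsub>H\<^esub> x \<in> ?G" if "I \<in> U" "x \<in> I" for I x
          using submodule.smult_closed[OF right_ideal_coidealD(1)[OF U[OF that(1)]] a that(2)] that(1)
          by (intro generate.incl UnionI)
        show "a \<odot>\<^bsub>H\<^esub> (x \<oplus>\<^bsub>H\<^esub> y) \<in> ?G" if "x \<in> ?G" "y \<in> ?G" "a \<odot>\<^bsub>H\<^esub> x \<in> ?G" "a \<odot>\<^bsub>H\<^esub> y \<in> ?G" for x y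
          using that GH a add by (simp add: smult_r_distr subset_iff)
      qed (use a subgroup.one_closed[OF sub] in simp)
    qed (use GH neg add subgroup.one_closed[OF sub] in auto)
    fix x assume x: "x \<in> ?G"
    show "x \<otimes>\<^bsub>H\<^esub> h \<in> ?G" if h: "h \<in> carrier H" for h
      using x
    proof (rule ind)
      show "x \<otimes>\<^bsub>H\<^esub> h \<in> ?G" if "I \<in> U" "x \<in> I" for I x
        using right_ideal_coidealD(2)[OF U[OF that(1)] that(2) h] that(1) by (intro generate.incl UnionI)
      show "(x \<oplus>\<^bsub>H\<^esub> y) \<otimes>\<^bsub>H\<^esub> h \<in> ?G" if "x \<in> ?G" "y \<in> ?G" "x \<otimes>\<^bsub>H\<^esub> h \<in> ?G" "y \<otimes>\<^bsub>H\<^esub> h \<in> ?G" for x y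
        using that GH h add by (simp add: l_distr subset_iff)
    qed (use h subgroup.one_closed[OF sub] in simp)
    show "counit H x = \<zero>\<^bsub>R\<^esub>"
      using x
    proof (rule ind)
      show "counit H \<zero>\<^bsub>H\<^esub> = \<zero>\<^bsub>R\<^esub>" using right_ideal_coideal_zero by (simp add: right_ideal_coideal_def)
      show "counit H x = \<zero>\<^bsub>R\<^esub>" if "I \<in> U" "x \<in> I" for I x
        by (rule right_ideal_coidealD(3)[OF U[OF that(1)] that(2)])
      show "counit H (x \<oplus>\<^bsub>H\<^esub> y) = \<zero>\<^bsub>R\<^esub>" if "x \<in> ?G" "y \<in> ?G" "counit H x = \<zero>\<^bsub>R\<^esub>" "counit H y = \<zero>\<^bsub>R\<^esub>" for x y
        using that GH counit_hom by (simp add: ring_hom_def subset_iff)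
    qed
    let ?X = "\<lambda>I. {tens R H H x h | x h. x \<in> I \<and> h \<in> carrier H} \<union> {tens R H H h x | x h. x \<in> I \<and> h \<in> carrier H}"
    let ?T = "add_monoid (tensor R H H)"
    show "comult H x \<in> generate ?T (?X ?G)"
      using x
    proof (rule ind)
      show "comult H \<zero>\<^bsub>H\<^esub> \<in> generate ?T (?X ?G)"
        using lin_zero[OF modH T comult_linear] generate.one[of ?T] by simp
      show "comult H x \<in> generate ?T (?X ?G)" if "I \<in> U" "x \<in> I" for I x
      proof -
        have "I \<subseteq> ?G" using that(1) by (auto intro: generate.incl)
        then have "?X I \<subseteq> ?X ?G" by blast
        then have "generate ?T (?X I) \<subseteq> generate ?T (?X ?G)"
          by (rule group.mono_generate[OF T.a_group])
        then show ?thesis using right_ideal_coidealD(4)[OF U[OF that(1)] that(2)] by (rule subsetD)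
      qed
      show "comult H (x \<oplus>\<^bsub>H\<^esub> y) \<in> generate ?T (?X ?G)" if "x \<in> ?G" "y \<in> ?G"
        "comult H x \<in> generate ?T (?X ?G)" "comult H y \<in> generate ?T (?X ?G)" for x y
        using generate.eng[OF that(3,4)] that(1,2) GH by (simp add: lin_add[OF comult_linear] subset_iff)
    qed
  qed
qed

text \<open>
  In the reversed order the upper bounds of \<open>F\<close> are the right ideal coideals contained in every
  member of \<open>F\<close>.  Their sum is the largest of them, hence the least upper bound.
\<close>

lemma Quot_gen_sup:
  assumes F: "F \<subseteq> carrier (Quot_gen R H)"
  shows "right_ideal_coideal R H (\<Squnion>\<^bsub>Quot_gen R H\<^esub> F)"
proof -
  let ?L = "Quot_gen R H"
  let ?U = "{I. right_ideal_coideal R H I \<and> (\<forall>J\<in>F. I \<subseteq> J)}"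
  let ?G = "generate (add_monoid H) (\<Union>?U)"
  have G: "right_ideal_coideal R H ?G" by (rule right_ideal_coideal_Union) simp
  have up: "Upper ?L F = ?U" using F by (auto simp: Upper_def Quot_gen_def)
  have "?G \<subseteq> J" if J: "J \<in> F" for J
  proof -
    have "submodule J R H" using F J by (auto simp: Quot_gen_def right_ideal_coideal_def)
    then have "subgroup J (add_monoid H)" by (rule submodule.axioms(1))
    then show ?thesis using group.generate_subgroup_incl[OF a_group, of "\<Union>?U" J] J by blast
  qed
  then have "least ?L ?G (Upper ?L F)"
    unfolding up least_def using G by (auto simp: Quot_gen_def intro: generate.incl)
  then have "least ?L (\<Squnion>\<^bsub>?L\<^esub> F) (Upper ?L F)" unfolding sup_def by (rule someI)
  then show ?thesis by (auto simp: least_def up Quot_gen_def)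
qed

end

theorem theorem4p7p2:
  fixes R :: "'r ring" and H :: "('r, 'h) hopf" and B :: "('r, 'b) module"
    and act :: "'h \<Rightarrow> 'b \<Rightarrow> 'b" and \<sigma> :: "'h \<Rightarrow> 'h \<Rightarrow> 'b"
    and S :: "('b \<times> 'h \<Rightarrow>\<^sub>0 int) set set"
  defines "A \<equiv> crossed_prod R H B act \<sigma>"
    and "\<delta> \<equiv> crossed_coact R H B act \<sigma>"
    and "B\<^sub>A \<equiv> crossed_base R H B"
  assumes "hopf_algebra R H"
    and "crossed_product R H B act \<sigma>"
    and "faithfully_flat R B"
    and "Mittag_Leffler R B"
    and "flat R H"
    and "S \<in> carrier (Sub_Alg R A B\<^sub>A)"
  shows "galois_closed R H A \<delta> S \<longleftrightarrow>
    module_iso R (tensor_base A B\<^sub>A S) (cotensor R H A \<delta> (galois_psi R H A \<delta> S)) (can_map R H A \<delta>)"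
proof -
  interpret crossed_product R H B act \<sigma> by fact
  have "right_ideal_coideal R H (galois_psi R H A \<delta> S)"
    unfolding galois_psi_def by (rule Quot_gen_sup) auto
  note I = right_ideal_coidealD(1,2)[OF this]
  have S: "subring S (crossed_prod R H B act \<sigma>)" "submodule S R (crossed_prod R H B act \<sigma>)"
    "crossed_base R H B \<subseteq> S"
    using assms(9) by (simp_all add: Sub_Alg_def A_def B\<^sub>A_def)
  have "crossed_closure R H B act \<sigma> S (galois_psi R H A \<delta> S)"
    by (intro crossed_closure.intro crossed_subalgebra.intro crossed_subalgebra_axioms.intro
      crossed_quotient.intro right_ideal_quotient.intro right_ideal_quotient_axioms.intro
      crossed_product_axioms hopf_algebra_axioms S I)
  from crossed_closure.can_iso_iff_closed[OF this \<open>flat R H\<close>]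
  show ?thesis unfolding galois_closed_def A_def \<delta>_def B\<^sub>A_def by (rule sym)
qed

end
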